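(* Let $n\ge 3$ and let $L_i=f_i(x,y,y',\dots,y^{(n)})\,dx$, $i=1,2$, be Lagrangians with $\frac{\partial^2 f_i}{\partial y_n^2}\neq 0$. Let $D_i$ be the rank 2 distribution on $J^n(\mathbb R,\mathbb R)\times\mathbb R$ (coordinates $(x,y_0,\dots,y_n,z)$) spanned by $\frac{\partial}{\partial x}+\sum_{k=0}^{n-1}y_{k+1}\frac{\partial}{\partial y_k}+f_i\frac{\partial}{\partial z}$ and $\frac{\partial}{\partial y_n}$. Then $D_1$ and $D_2$ are (locally) equivalent if and only if $L_1$ and $L_2$ are (locally) equivalent.
   Context: On $J^\infty=J^\infty(\mathbb R,\mathbb R)$ with coordinates $(x,y_0,y_1,\dots)$ let $\theta_k=dy_k-y_{k+1}dx$ be the contact forms and, for a function $\mu$, $d_H\mu=D_x(\mu)\,dx$ with $D_x=\frac{\partial}{\partial x}+\sum_{k\ge0}y_{k+1}\frac{\partial}{\partial y_k}$. Two Lagrangians $L_1,L_2$ are equivalent if there is a (local) contact transformation $\varphi$ of $J^1(\mathbb R,\mathbb R)$ with prolongation $\Phi$ to $J^\infty$, a nonzero constant $\alpha\in\mathbb R$ and a function $\mu$ on $J^\infty$ such that $\Phi^*(L_2)=\alpha L_1+d_H(\mu)$ modulo the span of $\{\theta_k\}_{k\ge0}$. Two distributions are (locally) equivalent if there is a local diffeomorphism $\phi$ with $\phi_*D_1=D_2$. *)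

theory Defs
  imports "HOL-Analysis.Analysis"
begin

text \<open>Coordinate conventions.  Points of R^m are encoded as functions nat => real vanishing
  at all indices >= m (the set Rn m, with its subspace topology of the product topology, which
  is the Euclidean topology).  Points of the infinite jet space J^infinity(R,R) are arbitrary
  functions p :: nat => real with the product (inverse limit) topology, where
  p 0 = x and p (k+1) = y_k.  J^N(R,R) = Rn (N+2) with the same coordinates, and
  J^n(R,R) x R = Rn (n+3) with the extra coordinate z at index n+2.\<close>

definition Rn :: "nat \<Rightarrow> (nat \<Rightarrow> real) set" where
  "Rn m = {p. \<forall>i\<ge>m. p i = 0}"

definition tr :: "nat \<Rightarrow> (nat \<Rightarrow> real) \<Rightarrow> (nat \<Rightarrow> real)" where
  "tr m p = (\<lambda>i. if i < m then p i else 0)"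

definition pd :: "nat \<Rightarrow> ((nat \<Rightarrow> real) \<Rightarrow> real) \<Rightarrow> (nat \<Rightarrow> real) \<Rightarrow> real" where
  "pd i F p = deriv (\<lambda>t. F (p(i := t))) (p i)"

fun ipd :: "nat list \<Rightarrow> ((nat \<Rightarrow> real) \<Rightarrow> real) \<Rightarrow> (nat \<Rightarrow> real) \<Rightarrow> real" where
  "ipd [] F = F"
| "ipd (j # js) F = pd j (ipd js F)"

definition smooth_in :: "nat set \<Rightarrow> (nat \<Rightarrow> real) set \<Rightarrow> ((nat \<Rightarrow> real) \<Rightarrow> real) \<Rightarrow> bool" where
  "smooth_in I S F \<longleftrightarrow>
     (\<forall>js. set js \<subseteq> I \<longrightarrow>
        continuous_on S (ipd js F) \<and>
        (\<forall>j\<in>I. \<forall>p\<in>S. (\<lambda>t. ipd js F (p(j := t))) differentiable (at (p j))))"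

definition smooth_map :: "nat \<Rightarrow> (nat \<Rightarrow> real) set \<Rightarrow> ((nat \<Rightarrow> real) \<Rightarrow> (nat \<Rightarrow> real)) \<Rightarrow> bool" where
  "smooth_map m U \<psi> \<longleftrightarrow> (\<forall>q\<in>U. \<psi> q \<in> Rn m) \<and> (\<forall>j<m. smooth_in {..<m} U (\<lambda>q. \<psi> q j))"

definition diffeo :: "nat \<Rightarrow> (nat \<Rightarrow> real) set \<Rightarrow> (nat \<Rightarrow> real) set \<Rightarrow> ((nat \<Rightarrow> real) \<Rightarrow> (nat \<Rightarrow> real)) \<Rightarrow> bool" where
  "diffeo m U V \<psi> \<longleftrightarrow>
     openin (top_of_set (Rn m)) U \<and> openin (top_of_set (Rn m)) V \<and>
     bij_betw \<psi> U V \<and> smooth_map m U \<psi> \<and> smooth_map m V (inv_into U \<psi>)"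

definition dmap :: "nat \<Rightarrow> ((nat \<Rightarrow> real) \<Rightarrow> (nat \<Rightarrow> real)) \<Rightarrow> (nat \<Rightarrow> real) \<Rightarrow> (nat \<Rightarrow> real) \<Rightarrow> (nat \<Rightarrow> real)" where
  "dmap m \<psi> q v = (\<lambda>j. if j < m then (\<Sum>i<m. pd i (\<lambda>r. \<psi> r j) q * v i) else 0)"

definition span2 :: "(nat \<Rightarrow> real) \<Rightarrow> (nat \<Rightarrow> real) \<Rightarrow> (nat \<Rightarrow> real) set" where
  "span2 u v = {(\<lambda>i. a * u i + b * v i) | a b. True}"

text \<open>d/dx + sum_{k<n} y_{k+1} d/dy_k + f d/dz  (x: index 0, y_k: index k+1, z: index n+2).\<close>
definition Xfield :: "nat \<Rightarrow> ((nat \<Rightarrow> real) \<Rightarrow> real) \<Rightarrow> (nat \<Rightarrow> real) \<Rightarrow> (nat \<Rightarrow> real)" where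
  "Xfield n f q = (\<lambda>j. if j = 0 then 1
                       else if 1 \<le> j \<and> j \<le> n then q (j + 1)
                       else if j = n + 2 then f (tr (n + 2) q)
                       else 0)"

definition Yfield :: "nat \<Rightarrow> (nat \<Rightarrow> real) \<Rightarrow> (nat \<Rightarrow> real)" where
  "Yfield n q = (\<lambda>j. if j = n + 1 then 1 else 0)"

text \<open>D_f is defined on O x R where O (subset of J^n) is the domain of f.  Local equivalence:
  some nonempty open piece of the domain of D_1 is mapped diffeomorphically onto an open piece
  of the domain of D_2 with the pushforward of D_1 equal to D_2.\<close>
definition distr_loc_equiv ::
  "nat \<Rightarrow> (nat \<Rightarrow> real) set \<Rightarrow> ((nat \<Rightarrow> real) \<Rightarrow> real) \<Rightarrow>
          (nat \<Rightarrow> real) set \<Rightarrow> ((nat \<Rightarrow> real) \<Rightarrow> real) \<Rightarrow> bool" where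
  "distr_loc_equiv n O1 f1 O2 f2 \<longleftrightarrow>
     (\<exists>U V \<psi>. U \<noteq> {} \<and> diffeo (n + 3) U V \<psi> \<and>
        (\<forall>q\<in>U. tr (n + 2) q \<in> O1) \<and> (\<forall>q\<in>V. tr (n + 2) q \<in> O2) \<and>
        (\<forall>q\<in>U. dmap (n + 3) \<psi> q ` span2 (Xfield n f1 q) (Yfield n q)
                 = span2 (Xfield n f2 (\<psi> q)) (Yfield n (\<psi> q))))"

text \<open>Total derivative D_x = d/dx + sum_k y_{k+1} d/dy_k (finitely many nonzero terms for
  functions of finite order).\<close>
definition Dx :: "((nat \<Rightarrow> real) \<Rightarrow> real) \<Rightarrow> (nat \<Rightarrow> real) \<Rightarrow> real" where
  "Dx F p = pd 0 F p + (\<Sum>k. p (Suc (Suc k)) * pd (Suc k) F p)"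

text \<open>1-forms on J^infinity: at a point, the coefficient of d(coordinate i).\<close>
type_synonym form1 = "(nat \<Rightarrow> real) \<Rightarrow> nat \<Rightarrow> real"

definition hdx :: "((nat \<Rightarrow> real) \<Rightarrow> real) \<Rightarrow> form1" where
  "hdx F = (\<lambda>p i. if i = 0 then F p else 0)"

definition theta :: "nat \<Rightarrow> form1" where
  "theta k = (\<lambda>p i. if i = Suc k then 1 else if i = 0 then - p (Suc (Suc k)) else 0)"

definition pullback :: "((nat \<Rightarrow> real) \<Rightarrow> (nat \<Rightarrow> real)) \<Rightarrow> form1 \<Rightarrow> form1" where
  "pullback \<Phi> \<omega> = (\<lambda>p i. (\<Sum>j. \<omega> (\<Phi> p) j * pd i (\<lambda>q. \<Phi> q j) p))"

text \<open>Local contact transformation of J^1 = Rn 3 (coordinates x, y_0, y_1 at 0, 1, 2):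
  a diffeomorphism phi with phi^* theta_0 in the span of theta_0.\<close>
definition contact_transf :: "(nat \<Rightarrow> real) set \<Rightarrow> (nat \<Rightarrow> real) set \<Rightarrow> ((nat \<Rightarrow> real) \<Rightarrow> (nat \<Rightarrow> real)) \<Rightarrow> bool" where
  "contact_transf U V \<phi> \<longleftrightarrow> diffeo 3 U V \<phi> \<and>
     (\<forall>p\<in>U. \<exists>c. \<forall>i<3.
        pd i (\<lambda>q. \<phi> q 1) p - \<phi> p 2 * pd i (\<lambda>q. \<phi> q 0) p = c * theta 0 p i)"

fun prol :: "((nat \<Rightarrow> real) \<Rightarrow> (nat \<Rightarrow> real)) \<Rightarrow> nat \<Rightarrow> (nat \<Rightarrow> real) \<Rightarrow> real" where
  "prol \<phi> 0 = (\<lambda>p. \<phi> (tr 3 p) 0)"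
| "prol \<phi> (Suc 0) = (\<lambda>p. \<phi> (tr 3 p) 1)"
| "prol \<phi> (Suc (Suc 0)) = (\<lambda>p. \<phi> (tr 3 p) 2)"
| "prol \<phi> (Suc (Suc (Suc k))) = (\<lambda>p. Dx (prol \<phi> (Suc (Suc k))) p / Dx (prol \<phi> 0) p)"

definition prolong :: "((nat \<Rightarrow> real) \<Rightarrow> (nat \<Rightarrow> real)) \<Rightarrow> (nat \<Rightarrow> real) \<Rightarrow> (nat \<Rightarrow> real)" where
  "prolong \<phi> p = (\<lambda>i. prol \<phi> i p)"

definition eq_mod_contact :: "(nat \<Rightarrow> real) set \<Rightarrow> form1 \<Rightarrow> form1 \<Rightarrow> bool" where
  "eq_mod_contact W \<omega>1 \<omega>2 \<longleftrightarrow>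
     (\<forall>p\<in>W. \<exists>c K. \<forall>i. \<omega>1 p i - \<omega>2 p i = (\<Sum>k<K. c k * theta k p i))"

text \<open>Local equivalence of the Lagrangians f1 dx and f2 dx, f_i defined on O_i in J^n
  (pulled back to J^infinity along the projection tr (n+2)): on some nonempty open W of
  J^infinity, Phi^*(L2) = alpha L1 + d_H mu mod contact forms, Phi the prolongation of a local
  contact transformation, mu a smooth function of finite order on W.\<close>
definition lagr_loc_equiv ::
  "nat \<Rightarrow> (nat \<Rightarrow> real) set \<Rightarrow> ((nat \<Rightarrow> real) \<Rightarrow> real) \<Rightarrow>
          (nat \<Rightarrow> real) set \<Rightarrow> ((nat \<Rightarrow> real) \<Rightarrow> real) \<Rightarrow> bool" where
  "lagr_loc_equiv n O1 f1 O2 f2 \<longleftrightarrow>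
     (\<exists>W U V \<phi> (\<alpha>::real) \<mu> N.
        open W \<and> W \<noteq> {} \<and> contact_transf U V \<phi> \<and> tr 3 ` W \<subseteq> U \<and>
        (\<forall>p\<in>W. Dx (prol \<phi> 0) p \<noteq> 0) \<and>
        (\<forall>p\<in>W. tr (n + 2) p \<in> O1) \<and> (\<forall>p\<in>W. tr (n + 2) (prolong \<phi> p) \<in> O2) \<and>
        \<alpha> \<noteq> 0 \<and>
        smooth_in UNIV W \<mu> \<and> (\<forall>p\<in>W. \<forall>q\<in>W. (\<forall>i<N. p i = q i) \<longrightarrow> \<mu> p = \<mu> q) \<and>
        eq_mod_contact W
          (pullback (prolong \<phi>) (hdx (\<lambda>p. f2 (tr (n + 2) p))))
          (\<lambda>p i. \<alpha> * hdx (\<lambda>p. f1 (tr (n + 2) p)) p i + hdx (Dx \<mu>) p i))"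

end

(*
  From Lagrangians to distributions: lift a contact transformation phi of J^1 to its prolongation
  Phi on J^n and put psi(q, z) = (Phi q, alpha z + mu q).  Since Dx mu has order at most n, mu has
  order at most n - 1, so psi maps d/dy_n to a multiple of itself.  Everything is explicitly
  invertible, because the prolongation of the inverse of phi inverts Phi: F |-> Dx F is related to
  itself by Phi up to the factor Dx (prol phi 0).

  From distributions to Lagrangians: let c_0, c_1, ... be the components of psi and let
  omega_k = dc_k - c_(k+1) dc_0.  If omega_k and omega_(k+1) annihilate two vector fields, then
  omega_k annihilates their bracket.  Starting from the generators T and d/dy_n of D_1, and using
  that f1 is nondegenerate in y_n, this shows that omega_1 is a nonvanishing multiple of theta_0.
  Hence c_0, c_1, c_2 depend only on x, y_0, y_1 and define a contact transformation, whose
  prolongation is given by the remaining c_k.  The last component Z satisfies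
  T Z = f2(psi) T c_0, so T kills dZ/dz, and brackets show that dZ/dz is a constant alpha;
  then Z = alpha z + mu.
*)

theory Submission
  imports Defs
begin

section \<open>Partial derivatives in coordinates\<close>

text \<open>The growth of the flag of D_1 explains the hypotheses. With Y = d/dy_n, [Y,T] =
  d/dy_(n-1) + (df1/dy_n) d/dz, and [Y,[Y,T]] is the second y_n-derivative of f1 times d/dz. So
  nondegeneracy isolates d/dz, and brackets with T then peel off d/dy_(n-2), d/dy_(n-3) and so on.
  Each bracket costs one index, since omega_k is controlled on it only through omega_(k+1).
  Preservation of the span provides omega_1, ..., omega_n, and n >= 3 leaves just enough of them for
  omega_1 to annihilate all directions beyond x and y_0. The relevant index is 1 because c_0 is the
  x component and c_1 the y_0 component. Two obstacles shape the rest. Smoothness is given by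
  iterated partial derivatives in coordinates, so symmetry of second derivatives, the chain rule and
  all closure properties are derived from that. And everything is local: vanishing partial
  derivatives give independence of a variable only on suitable sets, hence the cubes, while
  functions pass between finite jets and J^infinity by freezing the remaining coordinates at a base
  point.\<close>

lemma tendsto_coordI:
  fixes p :: "nat \<Rightarrow> real"
  assumes "\<And>i. ((\<lambda>x. g x i) \<longlongrightarrow> p i) F"
  shows "(g \<longlongrightarrow> p) F"
proof -
  have "limitin (product_topology (\<lambda>i. euclidean) UNIV) g p F"
    unfolding limitin_componentwise using assms by simp
  then show ?thesis by (simp add: euclidean_product_topology)
qed

text \<open>The part of openness that partial derivatives see.  It is common to open subsets of
  R^m (with I = {..<m}) and of J^infinity (with I = UNIV).\<close>

definition coord_open :: "nat set \<Rightarrow> (nat \<Rightarrow> real) set \<Rightarrow> bool" where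
  "coord_open I S \<longleftrightarrow> (\<forall>p\<in>S. \<forall>J. finite J \<longrightarrow> J \<subseteq> I \<longrightarrow>
     (\<exists>e>0. \<forall>q. (\<forall>i\<in>J. \<bar>q i - p i\<bar> < e) \<longrightarrow> (\<forall>i. i \<notin> J \<longrightarrow> q i = p i) \<longrightarrow> q \<in> S))"

lemma coord_openD:
  assumes "coord_open I S" "p \<in> S" "finite J" "J \<subseteq> I"
  obtains e where "e > 0"
    "\<And>q. (\<And>i. i \<in> J \<Longrightarrow> \<bar>q i - p i\<bar> < e) \<Longrightarrow> (\<And>i. i \<notin> J \<Longrightarrow> q i = p i) \<Longrightarrow> q \<in> S"
proof -
  have "\<exists>e>0. \<forall>q. (\<forall>i\<in>J. \<bar>q i - p i\<bar> < e) \<longrightarrow> (\<forall>i. i \<notin> J \<longrightarrow> q i = p i) \<longrightarrow> q \<in> S"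
    using assms unfolding coord_open_def by blast
  then show ?thesis using that by blast
qed

lemma tendsto_finite_coords:
  fixes p :: "nat \<Rightarrow> real"
  assumes "\<And>n i. i \<in> J \<Longrightarrow> \<bar>g n i - p i\<bar> < inverse (real (Suc n))"
    and "\<And>n i. i \<notin> J \<Longrightarrow> g n i = p i"
  shows "g \<longlonglongrightarrow> p"
proof (rule tendsto_coordI)
  fix i
  show "(\<lambda>n. g n i) \<longlonglongrightarrow> p i"
  proof (cases "i \<in> J")
    case True
    have "(\<lambda>n. g n i - p i) \<longlonglongrightarrow> 0"
      by (rule Lim_null_comparison[OF _ LIMSEQ_inverse_real_of_nat])
        (use assms(1)[OF True] in \<open>auto intro!: always_eventually less_imp_le\<close>)
    then show ?thesis by (simp add: LIM_zero_iff)
  qed (simp add: assms(2))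
qed

text \<open>If no \<open>e\<close> works at \<open>p\<close>, points outside \<open>S\<close> that
  differ from \<open>p\<close> by less than \<open>1/(n+1)\<close> in the coordinates of
  \<open>J\<close> converge to \<open>p\<close>. The hypothesis on \<open>X\<close> keeps them in
  the ambient set, so they end up in \<open>S\<close>, a contradiction.\<close>

lemma coord_open_openin:
  assumes "openin (top_of_set X) S"
    and X: "\<And>p q J. p \<in> X \<Longrightarrow> J \<subseteq> I \<Longrightarrow> (\<And>i. i \<notin> J \<Longrightarrow> q i = p i) \<Longrightarrow> q \<in> X"
  shows "coord_open I S"
  unfolding coord_open_def
proof (intro ballI allI impI)
  fix p J assume p: "p \<in> S" and J: "finite J" "J \<subseteq> I"
  obtain T where T: "open T" "S = X \<inter> T" using assms(1) by (auto simp: openin_open)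
  show "\<exists>e>0. \<forall>q. (\<forall>i\<in>J. \<bar>q i - p i\<bar> < e) \<longrightarrow> (\<forall>i. i \<notin> J \<longrightarrow> q i = p i) \<longrightarrow> q \<in> S"
  proof (rule ccontr)
    assume "\<not> ?thesis"
    then have "\<forall>n. \<exists>q. (\<forall>i\<in>J. \<bar>q i - p i\<bar> < inverse (real (Suc n))) \<and> (\<forall>i. i \<notin> J \<longrightarrow> q i = p i) \<and> q \<notin> S"
      by (metis inverse_positive_iff_positive of_nat_0_less_iff zero_less_Suc)
    then obtain g where g: "\<And>n i. i \<in> J \<Longrightarrow> \<bar>g n i - p i\<bar> < inverse (real (Suc n))"
      "\<And>n i. i \<notin> J \<Longrightarrow> g n i = p i" "\<And>n. g n \<notin> S"
      by metis
    have "g \<longlonglongrightarrow> p" using tendsto_finite_coords g(1,2) by blast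
    then have "\<forall>\<^sub>F n in sequentially. g n \<in> T"
      using T p by (simp add: topological_tendstoD)
    then obtain n where "g n \<in> T" by (auto simp: eventually_sequentially)
    moreover have "g n \<in> X" using X[of p J "g n"] p T J g(2) by auto
    ultimately show False using g(3) T by auto
  qed
qed

lemma coord_open_Rn: "openin (top_of_set (Rn m)) S \<Longrightarrow> coord_open {..<m} S"
proof (rule coord_open_openin)
  fix p q :: "nat \<Rightarrow> real" and J
  assume "p \<in> Rn m" "J \<subseteq> {..<m}" and q: "\<And>i. i \<notin> J \<Longrightarrow> q i = p i"
  then have "q i = 0" if "m \<le> i" for i
    using that by (subst q) (auto simp: Rn_def)
  then show "q \<in> Rn m" by (simp add: Rn_def)
qed

lemma coord_open_open: "open S \<Longrightarrow> coord_open I S"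
  by (rule coord_open_openin[of UNIV]) auto

lemma eventually_coord:
  assumes "coord_open I S" "p \<in> S" "i \<in> I"
  shows "\<forall>\<^sub>F t in nhds (p i). p(i := t) \<in> S"
proof -
  obtain e where e: "e > 0"
    "\<And>q. (\<And>j. j \<in> {i} \<Longrightarrow> \<bar>q j - p j\<bar> < e) \<Longrightarrow> (\<And>j. j \<notin> {i} \<Longrightarrow> q j = p j) \<Longrightarrow> q \<in> S"
    using coord_openD[OF assms(1,2), of "{i}"] assms(3) by blast
  show ?thesis unfolding eventually_nhds_metric
    by (rule exI[of _ e]) (use e in \<open>auto simp: dist_real_def\<close>)
qed

lemma pd_cong:
  assumes "coord_open I S" "p \<in> S" "i \<in> I" "\<And>q. q \<in> S \<Longrightarrow> F q = G q"
  shows "pd i F p = pd i G p"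
  unfolding pd_def
  by (rule deriv_cong_ev) (use eventually_coord[OF assms(1-3)] assms(4) in \<open>auto elim: eventually_mono\<close>)

lemma pd_eqI: "((\<lambda>t. F (p(i := t))) has_real_derivative d) (at (p i)) \<Longrightarrow> pd i F p = d"
  unfolding pd_def by (rule DERIV_imp_deriv)

lemma smooth_in_has_pd:
  assumes "smooth_in I S F" "p \<in> S" "i \<in> I"
  shows "((\<lambda>t. F (p(i := t))) has_real_derivative pd i F p) (at (p i))"
proof -
  have "(\<lambda>t. ipd [] F (p(i := t))) differentiable (at (p i))"
    using assms unfolding smooth_in_def by (metis empty_iff list.set(1) subsetI)
  then show ?thesis
    by (simp add: pd_def DERIV_deriv_iff_real_differentiable)
qed

lemma ipd_append: "ipd (js @ ks) F = ipd js (ipd ks F)"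
  by (induction js) auto

lemma smooth_in_pd:
  assumes "smooth_in I S F" "j \<in> I" shows "smooth_in I S (pd j F)"
proof -
  have "ipd js (pd j F) = ipd (js @ [j]) F" for js by (simp add: ipd_append)
  then show ?thesis using assms unfolding smooth_in_def by simp
qed

lemma smooth_in_continuous: "smooth_in I S F \<Longrightarrow> continuous_on S F"
  unfolding smooth_in_def by (metis empty_subsetI ipd.simps(1) list.set(1))

lemma smooth_in_subset: "smooth_in I S F \<Longrightarrow> S' \<subseteq> S \<Longrightarrow> smooth_in I S' F"
  unfolding smooth_in_def by (meson continuous_on_subset subsetD)

text \<open>\<open>smooth_in\<close> speaks of all iterated derivatives at once, so a class
  \<open>P\<close> with the first-order properties that is closed under \<open>pd j\<close> is
  enough. Closure is needed only up to equality on \<open>S\<close>, because by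
  \<open>coord_open\<close> the derivatives at points of \<open>S\<close> depend only on values in
  \<open>S\<close>.\<close>

lemma smooth_in_coinduct:
  assumes op: "coord_open I S" and "P F"
    and step: "\<And>F. P F \<Longrightarrow> continuous_on S F \<and> (\<forall>j\<in>I. \<forall>p\<in>S. (\<lambda>t. F (p(j := t))) differentiable (at (p j)))
      \<and> (\<forall>j\<in>I. \<exists>G. P G \<and> (\<forall>p\<in>S. pd j F p = G p))"
  shows "smooth_in I S F"
proof -
  have *: "\<exists>G. P G \<and> (\<forall>p\<in>S. ipd js F p = G p)" if "set js \<subseteq> I" for js
    using that
  proof (induction js)
    case Nil then show ?case using \<open>P F\<close> by auto
  next
    case (Cons j js)
    then obtain G where G: "P G" "\<forall>p\<in>S. ipd js F p = G p" by auto
    obtain H where H: "P H" "\<forall>p\<in>S. pd j G p = H p" using step[OF G(1)] Cons.prems by auto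
    have "pd j (ipd js F) p = pd j G p" if "p \<in> S" for p
      by (rule pd_cong[OF op that]) (use G(2) Cons.prems in auto)
    then show ?case using H by auto
  qed
  show ?thesis unfolding smooth_in_def
  proof (intro allI impI conjI ballI)
    fix js :: "nat list" assume js: "set js \<subseteq> I"
    then obtain G where G: "P G" "\<forall>p\<in>S. ipd js F p = G p" using *[OF js] by blast
    show "continuous_on S (ipd js F)" using step[OF G(1)] G(2) by (simp cong: continuous_on_cong)
    fix j p assume j: "j \<in> I" "p \<in> S"
    have "(\<lambda>t. G (p(j := t))) differentiable (at (p j))" using step[OF G(1)] j by blast
    then obtain D where D: "((\<lambda>t. G (p(j := t))) has_real_derivative D) (at (p j))"
      by (auto simp: real_differentiable_def)
    have "((\<lambda>t. ipd js F (p(j := t))) has_real_derivative D) (at (p j))"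
      by (rule DERIV_cong_ev[THEN iffD1, OF _ _ _ D])
        (use eventually_coord[OF op j(2,1)] G(2) in \<open>auto elim: eventually_mono\<close>)
    then show "(\<lambda>t. ipd js F (p(j := t))) differentiable (at (p j))"
      by (auto simp: real_differentiable_def)
  qed
qed

lemma smooth_in_cong:
  assumes op: "coord_open I S" and F: "smooth_in I S F" and eq: "\<And>p. p \<in> S \<Longrightarrow> G p = F p"
  shows "smooth_in I S G"
proof (rule smooth_in_coinduct[OF op, where P = "\<lambda>G. \<exists>F. smooth_in I S F \<and> (\<forall>p\<in>S. G p = F p)"])
  show "\<exists>F. smooth_in I S F \<and> (\<forall>p\<in>S. G p = F p)" using F eq by blast
next
  fix G assume "\<exists>F. smooth_in I S F \<and> (\<forall>p\<in>S. G p = F p)"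
  then obtain F where F: "smooth_in I S F" and eq: "\<forall>p\<in>S. G p = F p" by blast
  have "continuous_on S G" using smooth_in_continuous[OF F] eq by (simp cong: continuous_on_cong)
  moreover have "(\<lambda>t. G (p(j := t))) differentiable at (p j)" if j: "j \<in> I" "p \<in> S" for j p
  proof -
    have "((\<lambda>t. G (p(j := t))) has_real_derivative pd j F p) (at (p j))"
      by (rule DERIV_cong_ev[THEN iffD1, OF _ _ _ smooth_in_has_pd[OF F j(2,1)]])
        (use eventually_coord[OF op j(2,1)] eq in \<open>auto elim: eventually_mono\<close>)
    then show ?thesis by (auto simp: real_differentiable_def)
  qed
  moreover have "\<exists>H. (\<exists>F. smooth_in I S F \<and> (\<forall>p\<in>S. H p = F p)) \<and> (\<forall>p\<in>S. pd j G p = H p)" if "j \<in> I" for j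
    using smooth_in_pd[OF F that] pd_cong[OF op _ that, of _ G F] eq by blast
  ultimately show "continuous_on S G \<and> (\<forall>j\<in>I. \<forall>p\<in>S. (\<lambda>t. G (p(j := t))) differentiable at (p j)) \<and>
      (\<forall>j\<in>I. \<exists>H. (\<exists>F. smooth_in I S F \<and> (\<forall>p\<in>S. H p = F p)) \<and> (\<forall>p\<in>S. pd j G p = H p))"
    by blast
qed

section \<open>Mean values, symmetry of mixed derivatives and the chain rule\<close>

lemma mvt_coord:
  assumes F: "smooth_in I S F" and i: "i \<in> I"
    and S: "\<And>s. min a b \<le> s \<Longrightarrow> s \<le> max a b \<Longrightarrow> q(i := s) \<in> S"
  shows "\<exists>s. min a b \<le> s \<and> s \<le> max a b \<and>
    F (q(i := b)) - F (q(i := a)) = (b - a) * pd i F (q(i := s))"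
proof -
  have D: "((\<lambda>t. F (q(i := t))) has_real_derivative pd i F (q(i := s))) (at s)"
    if "min a b \<le> s" "s \<le> max a b" for s
    using smooth_in_has_pd[OF F S[OF that] i] by simp
  consider "a < b" | "a = b" | "b < a" by linarith
  then show ?thesis
  proof cases
    case 1
    then obtain z where z: "a < z" "z < b" "F (q(i := b)) - F (q(i := a)) = (b - a) * pd i F (q(i := z))"
      using MVT2[of a b "\<lambda>t. F (q(i := t))" "\<lambda>s. pd i F (q(i := s))"] D by auto
    then show ?thesis using 1 by (intro exI[of _ z]) auto
  next
    case 2 then show ?thesis by (intro exI[of _ a]) auto
  next
    case 3
    then obtain z where z: "b < z" "z < a" "F (q(i := a)) - F (q(i := b)) = (a - b) * pd i F (q(i := z))"
      using MVT2[of b a "\<lambda>t. F (q(i := t))" "\<lambda>s. pd i F (q(i := s))"] D by auto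
    then show ?thesis using 3 by (intro exI[of _ z]) (auto simp: algebra_simps)
  qed
qed

text \<open>The mean value theorem is applied in direction \<open>i\<close> to the difference of
  \<open>F\<close> between two opposite sides of the square, and then to \<open>pd i F\<close> in
  direction \<open>j\<close>. The left side is symmetric in \<open>i\<close> and \<open>j\<close>,
  which \<open>pd_commute\<close> exploits.\<close>

lemma second_difference:
  assumes F: "smooth_in I S F" and ij: "i \<in> I" "j \<in> I" "i \<noteq> j" and h: "0 < h"
    and S: "\<And>q. (\<And>k. k \<in> {i, j} \<Longrightarrow> \<bar>q k - p k\<bar> \<le> h) \<Longrightarrow> (\<And>k. k \<notin> {i, j} \<Longrightarrow> q k = p k) \<Longrightarrow> q \<in> S"
  shows "\<exists>q. (\<forall>k\<in>{i, j}. \<bar>q k - p k\<bar> \<le> h) \<and> (\<forall>k. k \<notin> {i, j} \<longrightarrow> q k = p k) \<and>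
    F (p(i := p i + h, j := p j + h)) - F (p(i := p i + h)) - F (p(j := p j + h)) + F p
      = h\<^sup>2 * pd j (pd i F) q"
proof -
  define g where "g s = F (p(j := p j + h, i := s)) - F (p(i := s))" for s
  have "((\<lambda>s. g s) has_real_derivative (pd i F (p(j := p j + h, i := s)) - pd i F (p(i := s)))) (at s)"
    if "p i \<le> s" "s \<le> p i + h" for s
  proof -
    have "p(j := p j + h, i := s) \<in> S" "p(i := s) \<in> S"
      using that h ij by (auto intro!: S split: if_splits)
    then show ?thesis unfolding g_def
      using smooth_in_has_pd[OF F _ ij(1), of "p(j := p j + h, i := s)"]
        smooth_in_has_pd[OF F _ ij(1), of "p(i := s)"]
      by (auto intro!: derivative_eq_intros)
  qed
  then obtain s where s: "p i < s" "s < p i + h"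
    "g (p i + h) - g (p i) = h * (pd i F (p(j := p j + h, i := s)) - pd i F (p(i := s)))"
    using MVT2[of "p i" "p i + h" g "\<lambda>s. pd i F (p(j := p j + h, i := s)) - pd i F (p(i := s))"] h by auto
  have S': "(p(i := s))(j := t) \<in> S" if "min (p j) (p j + h) \<le> t" "t \<le> max (p j) (p j + h)" for t
    using that s h ij by (auto intro!: S split: if_splits)
  obtain t where t: "min (p j) (p j + h) \<le> t" "t \<le> max (p j) (p j + h)"
    "pd i F ((p(i := s))(j := p j + h)) - pd i F ((p(i := s))(j := p j)) = (p j + h - p j) * pd j (pd i F) ((p(i := s))(j := t))"
    using mvt_coord[OF smooth_in_pd[OF F ij(1)] ij(2) S'] by blast
  have e: "p(i := s, j := p j) = p(i := s)" "p(j := p j + h, i := s) = p(i := s, j := p j + h)"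
    "p(j := p j + h, i := p i + h) = p(i := p i + h, j := p j + h)"  "p(j := p j + h, i := p i) = p(j := p j + h)"
    using ij by (auto simp: fun_upd_twist)
  show ?thesis
    using s t h ij unfolding g_def e
    by (intro exI[of _ "p(i := s, j := t)"]) (auto simp: power2_eq_square algebra_simps)
qed

text \<open>Both mixed derivatives, taken at two points near \<open>p\<close>, equal the same second
  difference divided by the squared side length. Continuity carries both to \<open>p\<close> as the
  squares shrink.\<close>

lemma pd_commute:
  assumes F: "smooth_in I S F" and op: "coord_open I S" and p: "p \<in> S" and ij: "i \<in> I" "j \<in> I"
  shows "pd i (pd j F) p = pd j (pd i F) p"
proof (cases "i = j")
  case False
  obtain e where e: "e > 0"
    "\<And>q. (\<And>k. k \<in> {i, j} \<Longrightarrow> \<bar>q k - p k\<bar> < e) \<Longrightarrow> (\<And>k. k \<notin> {i, j} \<Longrightarrow> q k = p k) \<Longrightarrow> q \<in> S"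
    using coord_openD[OF op p, of "{i, j}"] ij by blast
  \<comment> \<open>Below \<open>e\<close>, so that the squares lie in \<open>S\<close>; below
    \<open>1/(n+1)\<close>, so that points chosen in them converge to \<open>p\<close>.\<close>
  define h where "h n = min (e / 2) (inverse (real (Suc n)) / 2)" for n
  have h: "h n > 0" "h n < e" "h n < inverse (real (Suc n))" for n
    using e(1) by (auto simp: h_def min_def)
  have "\<exists>q q'. (\<forall>k\<in>{i, j}. \<bar>q k - p k\<bar> \<le> h n) \<and> (\<forall>k. k \<notin> {i, j} \<longrightarrow> q k = p k) \<and>
     (\<forall>k\<in>{i, j}. \<bar>q' k - p k\<bar> \<le> h n) \<and> (\<forall>k. k \<notin> {i, j} \<longrightarrow> q' k = p k) \<and>
     pd j (pd i F) q = pd i (pd j F) q'" for n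
  proof -
    have S: "q \<in> S" if "\<And>k. k \<in> {i, j} \<Longrightarrow> \<bar>q k - p k\<bar> \<le> h n" "\<And>k. k \<notin> {i, j} \<Longrightarrow> q k = p k" for q
      using e(2)[of q] that h(2)[of n] by (meson le_less_trans)
    obtain q where q: "\<forall>k\<in>{i, j}. \<bar>q k - p k\<bar> \<le> h n" "\<forall>k. k \<notin> {i, j} \<longrightarrow> q k = p k"
      "F (p(i := p i + h n, j := p j + h n)) - F (p(i := p i + h n)) - F (p(j := p j + h n)) + F p
        = (h n)\<^sup>2 * pd j (pd i F) q"
      using second_difference[OF F ij False h(1)] S by blast
    obtain q' where q': "\<forall>k\<in>{j, i}. \<bar>q' k - p k\<bar> \<le> h n" "\<forall>k. k \<notin> {j, i} \<longrightarrow> q' k = p k"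
      "F (p(j := p j + h n, i := p i + h n)) - F (p(j := p j + h n)) - F (p(i := p i + h n)) + F p
        = (h n)\<^sup>2 * pd i (pd j F) q'"
      using second_difference[OF F ij(2,1) False[symmetric] h(1), of p n] S by (auto simp: insert_commute)
    have "(h n)\<^sup>2 * pd j (pd i F) q = (h n)\<^sup>2 * pd i (pd j F) q'"
      using q(3) q'(3) unfolding fun_upd_twist[OF False] by linarith
    then have "pd j (pd i F) q = pd i (pd j F) q'" using h(1)[of n] by simp
    then show ?thesis using q(1,2) q'(1,2) by (intro exI[of _ q] exI[of _ q']) auto
  qed
  then obtain q q' where q: "\<And>n k. k \<in> {i, j} \<Longrightarrow> \<bar>q n k - p k\<bar> \<le> h n" "\<And>n k. k \<notin> {i, j} \<Longrightarrow> q n k = p k"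
     "\<And>n k. k \<in> {i, j} \<Longrightarrow> \<bar>q' n k - p k\<bar> \<le> h n" "\<And>n k. k \<notin> {i, j} \<Longrightarrow> q' n k = p k"
     "\<And>n. pd j (pd i F) (q n) = pd i (pd j F) (q' n)" by metis
  have lim: "q \<longlonglongrightarrow> p" "q' \<longlonglongrightarrow> p"
    by (rule tendsto_finite_coords[of "{i,j}"]; (erule le_less_trans[OF q(1) h(3)] le_less_trans[OF q(3) h(3)] q(2) q(4)))+
  have inS: "q n \<in> S" "q' n \<in> S" for n
    by (rule e(2); (erule le_less_trans[OF q(1) h(2)] le_less_trans[OF q(3) h(2)] q(2) q(4)))+
  have "continuous_on S (pd j (pd i F))" "continuous_on S (pd i (pd j F))"
    using F ij by (auto intro: smooth_in_continuous smooth_in_pd)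
  then have "(\<lambda>n. pd j (pd i F) (q n)) \<longlonglongrightarrow> pd j (pd i F) p" "(\<lambda>n. pd i (pd j F) (q' n)) \<longlonglongrightarrow> pd i (pd j F) p"
    using continuous_on_tendsto_compose[OF _ lim(1) p] continuous_on_tendsto_compose[OF _ lim(2) p] inS
    by simp_all
  then show ?thesis using q(5) LIMSEQ_unique by auto
qed simp

text \<open>The increment along the curve is split into moves of one coordinate at a time. Each move
  is a mean value term whose intermediate point tends to \<open>\<gamma> t0\<close>, so continuity
  of the first partial derivatives gives its limit.\<close>

lemma chain_rule:
  assumes F: "smooth_in {..<m} S F" and op: "coord_open {..<m} S"
    and p: "\<gamma> t0 \<in> S" and const: "\<And>t i. m \<le> i \<Longrightarrow> \<gamma> t i = \<gamma> t0 i"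
    and \<gamma>: "\<And>i. i < m \<Longrightarrow> ((\<lambda>t. \<gamma> t i) has_real_derivative v i) (at t0)"
  shows "((\<lambda>t. F (\<gamma> t)) has_real_derivative (\<Sum>i<m. pd i F (\<gamma> t0) * v i)) (at t0)"
proof -
  let ?p = "\<gamma> t0"
  obtain e where e: "e > 0"
    "\<And>q. (\<And>k. k \<in> {..<m} \<Longrightarrow> \<bar>q k - ?p k\<bar> < e) \<Longrightarrow> (\<And>k. k \<notin> {..<m} \<Longrightarrow> q k = ?p k) \<Longrightarrow> q \<in> S"
    using coord_openD[OF op p] by blast
  \<comment> \<open>Interpolation: the first \<open>k\<close> coordinates follow the curve, the
    others keep their values at \<open>t0\<close>.\<close>
  define \<gamma>' where "\<gamma>' k t = (\<lambda>i. if i < k then \<gamma> t i else ?p i)" for k t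
  have cont: "((\<lambda>t. \<gamma> t i) \<longlongrightarrow> ?p i) (at t0)" for i
  proof (cases "i < m")
    case True then show ?thesis using DERIV_isCont[OF \<gamma>] by (auto simp: isCont_def)
  next
    case False
    then have "\<gamma> t i = ?p i" for t by (intro const) simp
    then have eq: "(\<lambda>t. \<gamma> t i) = (\<lambda>_. ?p i)" by (rule ext)
    show ?thesis unfolding eq by (rule tendsto_const)
  qed
  have near: "\<forall>\<^sub>F t in at t0. \<forall>i\<in>{..<m}. \<bar>\<gamma> t i - ?p i\<bar> < e"
    by (rule eventually_ball_finite)
      (use cont e(1) in \<open>auto simp: tendsto_iff dist_real_def\<close>)
  have "((\<lambda>t. F (\<gamma>' k t)) has_real_derivative (\<Sum>i<k. pd i F ?p * v i)) (at t0)" if "k \<le> m" for k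
    using that
  proof (induction k)
    case 0 then show ?case by (simp add: \<gamma>'_def)
  next
    case (Suc k)
    have k: "k < m" using Suc.prems by simp
    have upd: "\<gamma>' k t = (\<gamma>' (Suc k) t)(k := ?p k)" "\<gamma>' (Suc k) t = (\<gamma>' (Suc k) t)(k := \<gamma> t k)" for t
      by (auto simp: \<gamma>'_def fun_eq_iff)
    \<comment> \<open>The nearness condition stands inside the existential, so that choice yields
      one function \<open>s\<close> of all \<open>t\<close>, controlled only for \<open>t\<close>
      near \<open>t0\<close>.\<close>
    have "\<exists>s. (\<forall>i\<in>{..<m}. \<bar>\<gamma> t i - ?p i\<bar> < e) \<longrightarrow> \<bar>s - ?p k\<bar> \<le> \<bar>\<gamma> t k - ?p k\<bar> \<and> (\<gamma>' (Suc k) t)(k := s) \<in> S \<and>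
        F (\<gamma>' (Suc k) t) - F (\<gamma>' k t) = (\<gamma> t k - ?p k) * pd k F ((\<gamma>' (Suc k) t)(k := s))" for t
    proof (cases "\<forall>i\<in>{..<m}. \<bar>\<gamma> t i - ?p i\<bar> < e")
      case True
      have S: "(\<gamma>' (Suc k) t)(k := s) \<in> S" if "min (?p k) (\<gamma> t k) \<le> s" "s \<le> max (?p k) (\<gamma> t k)" for s
      proof (rule e(2))
        have "\<bar>s - ?p k\<bar> < e" using that bspec[OF True, of k] k by (auto simp: min_def max_def split: if_splits)
        then show "\<bar>((\<gamma>' (Suc k) t)(k := s)) i - ?p i\<bar> < e" if "i \<in> {..<m}" for i
          using True e(1) that by (auto simp: \<gamma>'_def)
        show "((\<gamma>' (Suc k) t)(k := s)) i = ?p i" if "i \<notin> {..<m}" for i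
          using that k by (auto simp: \<gamma>'_def)
      qed
      obtain s where s: "min (?p k) (\<gamma> t k) \<le> s" "s \<le> max (?p k) (\<gamma> t k)"
        "F ((\<gamma>' (Suc k) t)(k := \<gamma> t k)) - F ((\<gamma>' (Suc k) t)(k := ?p k)) = (\<gamma> t k - ?p k) * pd k F ((\<gamma>' (Suc k) t)(k := s))"
        using mvt_coord[OF F _ S] k by blast
      have "\<bar>s - ?p k\<bar> \<le> \<bar>\<gamma> t k - ?p k\<bar>" using s(1,2) by linarith
      then show ?thesis using s(3) S[OF s(1,2)] unfolding upd[symmetric] by blast
    qed blast
    then obtain s where s: "\<And>t. (\<forall>i\<in>{..<m}. \<bar>\<gamma> t i - ?p i\<bar> < e) \<Longrightarrow> \<bar>s t - ?p k\<bar> \<le> \<bar>\<gamma> t k - ?p k\<bar>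
       \<and> (\<gamma>' (Suc k) t)(k := s t) \<in> S \<and>
        F (\<gamma>' (Suc k) t) - F (\<gamma>' k t) = (\<gamma> t k - ?p k) * pd k F ((\<gamma>' (Suc k) t)(k := s t))" by metis
    have s_lim: "(s \<longlongrightarrow> ?p k) (at t0)"
    proof -
      have "((\<lambda>t. \<bar>\<gamma> t k - ?p k\<bar>) \<longlongrightarrow> 0) (at t0)"
        using cont[of k] by (simp add: LIM_zero tendsto_rabs_zero)
      then have "((\<lambda>t. s t - ?p k) \<longlongrightarrow> 0) (at t0)"
        by (rule Lim_null_comparison[rotated]) (use near s in \<open>auto elim!: eventually_mono\<close>)
      then show ?thesis by (simp add: LIM_zero_iff)
    qed
    have pt_lim: "((\<lambda>t. (\<gamma>' (Suc k) t)(k := s t)) \<longlongrightarrow> ?p) (at t0)"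
    proof (rule tendsto_coordI)
      fix i
      consider "i = k" | "i < k" | "i > k" by linarith
      then show "((\<lambda>t. ((\<gamma>' (Suc k) t)(k := s t)) i) \<longlongrightarrow> ?p i) (at t0)"
        by cases (simp_all add: \<gamma>'_def cont s_lim)
    qed
    have "continuous_on S (pd k F)" using F k by (auto intro: smooth_in_continuous smooth_in_pd)
    then have pd_lim: "((\<lambda>t. pd k F ((\<gamma>' (Suc k) t)(k := s t))) \<longlongrightarrow> pd k F ?p) (at t0)"
      by (rule continuous_on_tendsto_compose[OF _ pt_lim p]) (use near s in \<open>auto elim!: eventually_mono\<close>)
    have q: "((\<lambda>t. (\<gamma> t k - ?p k) / (t - t0)) \<longlongrightarrow> v k) (at t0)"
      using \<gamma>[OF k] by (simp add: has_field_derivative_iff)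
    have "((\<lambda>t. ((\<gamma> t k - ?p k) / (t - t0)) * pd k F ((\<gamma>' (Suc k) t)(k := s t))) \<longlongrightarrow> v k * pd k F ?p) (at t0)"
      by (intro tendsto_mult q pd_lim)
    then have "((\<lambda>t. (F (\<gamma>' (Suc k) t) - F (\<gamma>' k t)) / (t - t0)) \<longlongrightarrow> v k * pd k F ?p) (at t0)"
      by (rule Lim_transform_eventually) (use near s in \<open>auto elim!: eventually_mono\<close>)
    moreover have "F (\<gamma>' (Suc k) t0) - F (\<gamma>' k t0) = 0" by (simp add: \<gamma>'_def)
    ultimately have "((\<lambda>t. F (\<gamma>' (Suc k) t) - F (\<gamma>' k t)) has_real_derivative v k * pd k F ?p) (at t0)"
      by (simp add: has_field_derivative_iff)
    from DERIV_add[OF this Suc.IH] Suc.prems show ?case by (simp add: algebra_simps)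
  qed
  from this[of m] have "((\<lambda>t. F (\<gamma>' m t)) has_real_derivative (\<Sum>i<m. pd i F ?p * v i)) (at t0)" by simp
  moreover have "\<gamma>' m t = \<gamma> t" for t using const[of _ t] by (auto simp: \<gamma>'_def fun_eq_iff not_less)
  ultimately show ?thesis by simp
qed

section \<open>Closure properties of smooth functions\<close>

lemma tr_id: "p \<in> Rn m \<Longrightarrow> tr m p = p"
  by (auto simp: tr_def Rn_def fun_eq_iff)

text \<open>\<open>chain_rule\<close> wants a curve that is constant from coordinate
  \<open>m\<close> on for every \<open>t\<close>, but \<open>G\<close> is known to take values in
  \<open>Rn m\<close> only on \<open>S\<close>. Truncation by \<open>tr m\<close> repairs this and
  changes nothing for \<open>t\<close> near \<open>p i\<close>.\<close>

lemma has_pd_comp: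
  assumes S: "coord_open I S" "p \<in> S" "i \<in> I"
    and T: "openin (top_of_set (Rn m)) T" "smooth_in {..<m} T F" and GT: "\<forall>p\<in>S. G p \<in> T"
    and G: "\<And>j. j < m \<Longrightarrow> ((\<lambda>t. G (p(i := t)) j) has_real_derivative v j) (at (p i))"
  shows "((\<lambda>t. F (G (p(i := t)))) has_real_derivative (\<Sum>j<m. pd j F (G p) * v j)) (at (p i))"
proof -
  have trG: "tr m (G q) = G q" if "q \<in> S" for q
    by (rule tr_id) (use GT openin_imp_subset[OF T(1)] that in blast)
  have "((\<lambda>t. F (tr m (G (p(i := t))))) has_real_derivative (\<Sum>j<m. pd j F (tr m (G (p(i := p i)))) * v j)) (at (p i))"
  proof (rule chain_rule[OF T(2) coord_open_Rn[OF T(1)]])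
    show "tr m (G (p(i := p i))) \<in> T" using trG GT S(2) by simp
    show "((\<lambda>t. tr m (G (p(i := t))) j) has_real_derivative v j) (at (p i))" if "j < m" for j
      using G[OF that] that by (simp add: tr_def)
  qed (simp add: tr_def)
  then have "((\<lambda>t. F (tr m (G (p(i := t))))) has_real_derivative (\<Sum>j<m. pd j F (G p) * v j)) (at (p i))"
    using trG[OF S(2)] by simp
  then show ?thesis
    by (rule DERIV_cong_ev[THEN iffD1, rotated -1])
      (use eventually_coord[OF S] trG in \<open>auto elim: eventually_mono\<close>)
qed

text \<open>Partial derivatives of these expressions are again such expressions, so that all closure
  properties of smoothness follow from a single coinduction.\<close>

inductive smooth_expr :: "nat set \<Rightarrow> (nat \<Rightarrow> real) set \<Rightarrow> ((nat \<Rightarrow> real) \<Rightarrow> real) \<Rightarrow> bool"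
  for I S where
  base: "smooth_in I S F \<Longrightarrow> smooth_expr I S F"
| add: "smooth_expr I S F \<Longrightarrow> smooth_expr I S G \<Longrightarrow> smooth_expr I S (\<lambda>p. F p + G p)"
| mult: "smooth_expr I S F \<Longrightarrow> smooth_expr I S G \<Longrightarrow> smooth_expr I S (\<lambda>p. F p * G p)"
| inverse: "smooth_expr I S F \<Longrightarrow> \<forall>p\<in>S. F p \<noteq> 0 \<Longrightarrow> smooth_expr I S (\<lambda>p. inverse (F p))"
| comp: "openin (top_of_set (Rn m)) T \<Longrightarrow> smooth_in {..<m} T F \<Longrightarrow> \<forall>p\<in>S. G p \<in> T \<Longrightarrow>
    \<forall>j<m. smooth_expr I S (\<lambda>p. G p j) \<Longrightarrow> smooth_expr I S (\<lambda>p. F (G p))"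

lemma pd_const: "pd i (\<lambda>_. c) p = 0"
  by (simp add: pd_def)

lemma pd_coord: "pd i (\<lambda>p. p k) p = (if i = k then 1 else 0)"
  by (rule pd_eqI) auto

lemma smooth_in_const:
  assumes "coord_open I S" shows "smooth_in I S (\<lambda>_. c)"
  by (rule smooth_in_coinduct[OF assms, where P = "\<lambda>F. \<exists>c. F = (\<lambda>_. c)"]) (auto simp: pd_const)

lemma smooth_expr_const: "coord_open I S \<Longrightarrow> smooth_expr I S (\<lambda>_. c)"
  by (intro smooth_expr.base smooth_in_const)

lemma smooth_expr_sum:
  assumes "coord_open I S"
  shows "finite A \<Longrightarrow> (\<And>a. a \<in> A \<Longrightarrow> smooth_expr I S (F a)) \<Longrightarrow> smooth_expr I S (\<lambda>p. \<Sum>a\<in>A. F a p)"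
  by (induction A rule: finite_induct) (auto intro: smooth_expr.add smooth_expr_const[OF assms])

text \<open>The derivatives are exhibited by the sum, product, inverse and chain rules, and each
  right-hand side is again an expression; in the case \<open>comp\<close> because
  \<open>pd j F\<close> is smooth on \<open>T\<close>. The form with
  \<open>has_real_derivative\<close> carries existence and value through one induction.\<close>

lemma smooth_expr_step:
  assumes S: "coord_open I S" and "smooth_expr I S F"
  shows "continuous_on S F \<and> (\<forall>j\<in>I. \<exists>G. smooth_expr I S G \<and>
    (\<forall>p\<in>S. ((\<lambda>t. F (p(j := t))) has_real_derivative G p) (at (p j))))"
  using assms(2)
proof induction
  case (base F)
  have "smooth_expr I S (pd j F) \<and> (\<forall>p\<in>S. ((\<lambda>t. F (p(j := t))) has_real_derivative pd j F p) (at (p j)))"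
    if "j \<in> I" for j
    using smooth_in_pd[OF base that] smooth_in_has_pd[OF base _ that] smooth_expr.base by blast
  with smooth_in_continuous[OF base] show ?case by blast
next
  case (add F G)
  have "\<exists>H. smooth_expr I S H \<and> (\<forall>p\<in>S. ((\<lambda>t. F (p(j := t)) + G (p(j := t))) has_real_derivative H p) (at (p j)))"
    if j: "j \<in> I" for j
  proof -
    obtain F' G' where *: "smooth_expr I S F'" "smooth_expr I S G'"
      "\<forall>p\<in>S. ((\<lambda>t. F (p(j := t))) has_real_derivative F' p) (at (p j))"
      "\<forall>p\<in>S. ((\<lambda>t. G (p(j := t))) has_real_derivative G' p) (at (p j))"
      using add.IH j by blast
    show ?thesis
      by (rule exI[of _ "\<lambda>p. F' p + G' p"]) (use * in \<open>auto intro!: smooth_expr.add derivative_intros\<close>)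
  qed
  moreover have "continuous_on S (\<lambda>p. F p + G p)"
    by (rule continuous_on_add) (use add.IH in blast)+
  ultimately show ?case by blast
next
  case (mult F G)
  have "\<exists>H. smooth_expr I S H \<and> (\<forall>p\<in>S. ((\<lambda>t. F (p(j := t)) * G (p(j := t))) has_real_derivative H p) (at (p j)))"
    if j: "j \<in> I" for j
  proof -
    obtain F' G' where *: "smooth_expr I S F'" "smooth_expr I S G'"
      "\<forall>p\<in>S. ((\<lambda>t. F (p(j := t))) has_real_derivative F' p) (at (p j))"
      "\<forall>p\<in>S. ((\<lambda>t. G (p(j := t))) has_real_derivative G' p) (at (p j))"
      using mult.IH j by blast
    have "((\<lambda>t. F (p(j := t)) * G (p(j := t))) has_real_derivative F' p * G p + G' p * F p) (at (p j))"
      if "p \<in> S" for p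
      using DERIV_mult[OF bspec[OF *(3) that] bspec[OF *(4) that]] by simp
    then show ?thesis
      by (intro exI[of _ "\<lambda>p. F' p * G p + G' p * F p"]) (use * mult.hyps in \<open>auto intro!: smooth_expr.add smooth_expr.mult\<close>)
  qed
  moreover have "continuous_on S (\<lambda>p. F p * G p)"
    by (rule continuous_on_mult) (use mult.IH in blast)+
  ultimately show ?case by blast
next
  case (inverse F)
  have "\<exists>H. smooth_expr I S H \<and> (\<forall>p\<in>S. ((\<lambda>t. inverse (F (p(j := t)))) has_real_derivative H p) (at (p j)))"
    if j: "j \<in> I" for j
  proof -
    obtain F' where *: "smooth_expr I S F'"
      "\<forall>p\<in>S. ((\<lambda>t. F (p(j := t))) has_real_derivative F' p) (at (p j))"
      using inverse.IH j by blast
    have "((\<lambda>t. inverse (F (p(j := t)))) has_real_derivative (- 1) * (F' p * (inverse (F p) * inverse (F p)))) (at (p j))"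
      if "p \<in> S" for p
      using DERIV_inverse_fun[OF bspec[OF *(2) that]] that inverse.hyps(2) by (simp add: algebra_simps)
    moreover have "smooth_expr I S (\<lambda>p. (- 1) * (F' p * (inverse (F p) * inverse (F p))))"
      by (intro smooth_expr.mult smooth_expr.inverse smooth_expr_const[OF S] *(1) inverse.hyps)
    ultimately show ?thesis by blast
  qed
  moreover have "continuous_on S (\<lambda>p. inverse (F p))"
    by (rule continuous_on_inverse) (use inverse in blast)+
  ultimately show ?case by blast
next
  case (comp m T F G)
  have cont: "continuous_on S (\<lambda>p. F (G p))"
  proof (rule continuous_on_compose2[OF smooth_in_continuous[OF comp.hyps(2)]])
    show "continuous_on S G"
    proof (rule continuous_on_coordinatewise_then_product)
      fix j
      show "continuous_on S (\<lambda>p. G p j)"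
      proof (cases "j < m")
        case False
        have "G p j = 0" if "p \<in> S" for p
        proof -
          have "G p \<in> Rn m" using comp.hyps(3) openin_imp_subset[OF comp.hyps(1)] that by blast
          then show ?thesis using False by (simp add: Rn_def)
        qed
        then show ?thesis by (simp cong: continuous_on_cong)
      qed (use comp.IH in blast)
    qed
  qed (use comp.hyps(3) in auto)
  have "\<exists>H. smooth_expr I S H \<and> (\<forall>p\<in>S. ((\<lambda>t. F (G (p(i := t)))) has_real_derivative H p) (at (p i)))"
    if i: "i \<in> I" for i
  proof -
    have "\<forall>j. \<exists>v. j < m \<longrightarrow> smooth_expr I S v \<and>
       (\<forall>p\<in>S. ((\<lambda>t. G (p(i := t)) j) has_real_derivative v p) (at (p i)))"
      using comp.IH i by blast
    then obtain v where v: "\<And>j. j < m \<Longrightarrow> smooth_expr I S (v j)"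
      "\<And>j p. j < m \<Longrightarrow> p \<in> S \<Longrightarrow> ((\<lambda>t. G (p(i := t)) j) has_real_derivative v j p) (at (p i))"
      by metis
    have "((\<lambda>t. F (G (p(i := t)))) has_real_derivative (\<Sum>j<m. pd j F (G p) * v j p)) (at (p i))"
      if p: "p \<in> S" for p
      by (rule has_pd_comp[OF S p i comp.hyps(1-3)]) (use v(2) p in auto)
    moreover have "smooth_expr I S (\<lambda>p. pd j F (G p) * v j p)" if "j < m" for j
      by (intro smooth_expr.mult smooth_expr.comp[OF comp.hyps(1)] v(1) smooth_in_pd comp.hyps)
        (use that comp.IH in auto)
    then have "smooth_expr I S (\<lambda>p. \<Sum>j<m. pd j F (G p) * v j p)"
      by (intro smooth_expr_sum S) auto
    ultimately show ?thesis by blast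
  qed
  with cont show ?case by blast
qed

lemma smooth_expr_smooth_in:
  assumes S: "coord_open I S" and "smooth_expr I S F"
  shows "smooth_in I S F"
proof (rule smooth_in_coinduct[OF S, where P = "smooth_expr I S"])
  fix F assume "smooth_expr I S F"
  from smooth_expr_step[OF S this]
  show "continuous_on S F \<and> (\<forall>j\<in>I. \<forall>p\<in>S. (\<lambda>t. F (p(j := t))) differentiable at (p j)) \<and>
         (\<forall>j\<in>I. \<exists>G. smooth_expr I S G \<and> (\<forall>p\<in>S. pd j F p = G p))"
    using pd_eqI unfolding real_differentiable_def by blast
qed fact

context
  fixes I S assumes S: "coord_open I S"
begin

lemma smooth_in_add: "smooth_in I S F \<Longrightarrow> smooth_in I S G \<Longrightarrow> smooth_in I S (\<lambda>p. F p + G p)"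
  by (rule smooth_expr_smooth_in[OF S smooth_expr.add]; rule smooth_expr.base)

lemma smooth_in_mult: "smooth_in I S F \<Longrightarrow> smooth_in I S G \<Longrightarrow> smooth_in I S (\<lambda>p. F p * G p)"
  by (rule smooth_expr_smooth_in[OF S smooth_expr.mult]; rule smooth_expr.base)

lemma smooth_in_diff: "smooth_in I S F \<Longrightarrow> smooth_in I S G \<Longrightarrow> smooth_in I S (\<lambda>p. F p - G p)"
  using smooth_in_add[OF _ smooth_in_mult[OF smooth_in_const[OF S, of "-1"]], of F G] by simp

lemma smooth_in_divide:
  "smooth_in I S F \<Longrightarrow> smooth_in I S G \<Longrightarrow> (\<And>p. p \<in> S \<Longrightarrow> G p \<noteq> 0) \<Longrightarrow> smooth_in I S (\<lambda>p. F p / G p)"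
  unfolding divide_inverse
  by (rule smooth_expr_smooth_in[OF S smooth_expr.mult[OF smooth_expr.base smooth_expr.inverse[OF smooth_expr.base]]]) auto

lemma smooth_in_sum:
  "finite A \<Longrightarrow> (\<And>a. a \<in> A \<Longrightarrow> smooth_in I S (F a)) \<Longrightarrow> smooth_in I S (\<lambda>p. \<Sum>a\<in>A. F a p)"
  by (rule smooth_expr_smooth_in[OF S smooth_expr_sum[OF S]]; simp add: smooth_expr.base)

lemma smooth_in_comp:
  assumes "openin (top_of_set (Rn m)) T" "smooth_in {..<m} T F" "\<And>p. p \<in> S \<Longrightarrow> G p \<in> T"
    "\<And>j. j < m \<Longrightarrow> smooth_in I S (\<lambda>p. G p j)"
  shows "smooth_in I S (\<lambda>p. F (G p))"
  by (rule smooth_expr_smooth_in[OF S smooth_expr.comp[OF assms(1,2)]])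
    (use assms(3,4) smooth_expr.base in blast)+

text \<open>Coordinate functions are atoms for \<open>smooth_expr\<close> and need a coinduction of
  their own: together with the constants they are closed under partial derivatives.\<close>

lemma smooth_in_coord: "smooth_in I S (\<lambda>p. p k)"
proof (rule smooth_in_coinduct[OF S, where P = "\<lambda>F. F = (\<lambda>p. p k) \<or> (\<exists>c. F = (\<lambda>_. c))"])
  fix F :: "(nat \<Rightarrow> real) \<Rightarrow> real"
  assume "F = (\<lambda>p. p k) \<or> (\<exists>c. F = (\<lambda>_. c))"
  then show "continuous_on S F \<and> (\<forall>j\<in>I. \<forall>p\<in>S. (\<lambda>t. F (p(j := t))) differentiable at (p j)) \<and>
    (\<forall>j\<in>I. \<exists>G. (G = (\<lambda>p. p k) \<or> (\<exists>c. G = (\<lambda>_. c))) \<and> (\<forall>p\<in>S. pd j F p = G p))"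
  proof
    assume F: "F = (\<lambda>p. p k)"
    have "(\<lambda>t. (p(j := t)) k) differentiable at (p j)" for p :: "nat \<Rightarrow> real" and j
      by (cases "j = k") auto
    moreover have "continuous_on S (\<lambda>p. p k)"
      by (rule continuous_on_subset[OF continuous_on_product_coordinates]) simp
    ultimately show ?thesis unfolding F using pd_coord by blast
  next
    assume "\<exists>c. F = (\<lambda>_. c)" then show ?thesis by (auto simp: pd_const)
  qed
qed simp

lemma pd_add:
  "smooth_in I S F \<Longrightarrow> smooth_in I S G \<Longrightarrow> p \<in> S \<Longrightarrow> i \<in> I \<Longrightarrow> pd i (\<lambda>p. F p + G p) p = pd i F p + pd i G p"
  by (intro pd_eqI DERIV_add smooth_in_has_pd)

lemma pd_mult:
  assumes "smooth_in I S F" "smooth_in I S G" "p \<in> S" "i \<in> I"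
  shows "pd i (\<lambda>p. F p * G p) p = pd i F p * G p + F p * pd i G p"
  using DERIV_mult[OF smooth_in_has_pd[OF assms(1,3,4)] smooth_in_has_pd[OF assms(2,3,4)]]
  by (intro pd_eqI) (simp add: algebra_simps)

lemma pd_sum:
  "(\<And>a. a \<in> A \<Longrightarrow> smooth_in I S (F a)) \<Longrightarrow> p \<in> S \<Longrightarrow> i \<in> I \<Longrightarrow>
    pd i (\<lambda>p. \<Sum>a\<in>A. F a p) p = (\<Sum>a\<in>A. pd i (F a) p)"
  by (intro pd_eqI DERIV_sum smooth_in_has_pd)

lemma pd_comp:
  assumes "openin (top_of_set (Rn m)) T" "smooth_in {..<m} T F" "\<And>p. p \<in> S \<Longrightarrow> G p \<in> T"
    "\<And>j. j < m \<Longrightarrow> smooth_in I S (\<lambda>p. G p j)" "p \<in> S" "i \<in> I"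
  shows "pd i (\<lambda>p. F (G p)) p = (\<Sum>j<m. pd j F (G p) * pd i (\<lambda>p. G p j) p)"
  by (intro pd_eqI has_pd_comp[OF S assms(5,6,1,2)] smooth_in_has_pd assms) (use assms in auto)

end

section \<open>Vector fields as derivations and their brackets\<close>

definition vf_deriv :: "nat \<Rightarrow> (nat \<Rightarrow> (nat \<Rightarrow> real) \<Rightarrow> real) \<Rightarrow> ((nat \<Rightarrow> real) \<Rightarrow> real) \<Rightarrow> (nat \<Rightarrow> real) \<Rightarrow> real" where
  "vf_deriv m A F p = (\<Sum>i<m. A i p * pd i F p)"

lemma smooth_in_vf_deriv:
  assumes S: "coord_open {..<m} S" and "\<And>i. i < m \<Longrightarrow> smooth_in {..<m} S (A i)" "smooth_in {..<m} S F"
  shows "smooth_in {..<m} S (vf_deriv m A F)"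
  unfolding vf_deriv_def using assms
  by (intro smooth_in_sum smooth_in_mult smooth_in_pd) auto

lemma vf_deriv_mult:
  assumes "coord_open {..<m} S" "smooth_in {..<m} S F" "smooth_in {..<m} S G" "p \<in> S"
  shows "vf_deriv m A (\<lambda>p. F p * G p) p = vf_deriv m A F p * G p + F p * vf_deriv m A G p"
  unfolding vf_deriv_def
  by (simp add: pd_mult[OF assms] sum_distrib_left sum_distrib_right sum.distrib algebra_simps)

lemma vf_deriv_cong:
  assumes "coord_open {..<m} S" "p \<in> S" "\<And>q. q \<in> S \<Longrightarrow> F q = G q"
  shows "vf_deriv m A F p = vf_deriv m A G p"
  unfolding vf_deriv_def by (intro sum.cong refl arg_cong2[where f = "(*)"] pd_cong[OF assms(1,2)]) (use assms(3) in auto)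

text \<open>The terms with second derivatives of \<open>F\<close> cancel by symmetry. What remains
  is the derivation whose components are those of the Lie bracket \<open>[A, B]\<close>.\<close>

lemma vf_deriv_bracket:
  assumes S: "coord_open {..<m} S" and A: "\<And>i. i < m \<Longrightarrow> smooth_in {..<m} S (A i)"
    and B: "\<And>i. i < m \<Longrightarrow> smooth_in {..<m} S (B i)" and F: "smooth_in {..<m} S F" and p: "p \<in> S"
  shows "vf_deriv m A (vf_deriv m B F) p - vf_deriv m B (vf_deriv m A F) p =
    (\<Sum>j<m. (vf_deriv m A (B j) p - vf_deriv m B (A j) p) * pd j F p)"
proof -
  have *: "vf_deriv m A (vf_deriv m B F) p =
     (\<Sum>j<m. vf_deriv m A (B j) p * pd j F p) + (\<Sum>i<m. \<Sum>j<m. A i p * B j p * pd i (pd j F) p)"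
    if B: "\<And>i. i < m \<Longrightarrow> smooth_in {..<m} S (B i)" for A B
  proof -
    have "pd i (vf_deriv m B F) p = (\<Sum>j<m. pd i (B j) p * pd j F p + B j p * pd i (pd j F) p)" if "i < m" for i
    proof -
      have "pd i (vf_deriv m B F) p = (\<Sum>j<m. pd i (\<lambda>p. B j p * pd j F p) p)"
        unfolding vf_deriv_def
        by (rule pd_sum[OF S _ p]) (use B F that in \<open>auto intro!: smooth_in_mult[OF S] smooth_in_pd\<close>)
      also have "\<dots> = (\<Sum>j<m. pd i (B j) p * pd j F p + B j p * pd i (pd j F) p)"
        by (intro sum.cong refl pd_mult[OF S] smooth_in_pd F B p) (use that in auto)
      finally show ?thesis .
    qed
    then have "vf_deriv m A (vf_deriv m B F) p =
       (\<Sum>i<m. \<Sum>j<m. A i p * (pd i (B j) p * pd j F p)) + (\<Sum>i<m. \<Sum>j<m. A i p * (B j p * pd i (pd j F) p))"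
      unfolding vf_deriv_def[of m A]
      by (simp add: sum.distrib sum_distrib_left distrib_left)
    also have "(\<Sum>i<m. \<Sum>j<m. A i p * (pd i (B j) p * pd j F p)) = (\<Sum>j<m. vf_deriv m A (B j) p * pd j F p)"
      unfolding vf_deriv_def by (subst sum.swap) (simp add: sum_distrib_right mult.assoc)
    finally show ?thesis by (simp add: mult.assoc)
  qed
  have "(\<Sum>i<m. \<Sum>j<m. A i p * B j p * pd i (pd j F) p) = (\<Sum>i<m. \<Sum>j<m. B i p * A j p * pd i (pd j F) p)"
    by (subst sum.swap) (auto intro!: sum.cong simp: pd_commute[OF F S p])
  moreover have "vf_deriv m A (vf_deriv m B F) p =
      (\<Sum>j<m. vf_deriv m A (B j) p * pd j F p) + (\<Sum>i<m. \<Sum>j<m. A i p * B j p * pd i (pd j F) p)"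
    "vf_deriv m B (vf_deriv m A F) p =
      (\<Sum>j<m. vf_deriv m B (A j) p * pd j F p) + (\<Sum>i<m. \<Sum>j<m. B i p * A j p * pd i (pd j F) p)"
    by (rule *, rule B, assumption, rule *, rule A)
  ultimately show ?thesis by (simp add: sum_subtractf left_diff_distrib)
qed

text \<open>By the chain rule only directions in which \<open>q\<close> and \<open>q'\<close> differ
  contribute along the segment. Asking for vanishing derivatives in those directions alone turns
  this into independence of selected coordinates.\<close>

lemma const_along_segment:
  assumes F: "smooth_in {..<m} S F" and op: "coord_open {..<m} S"
    and seg: "\<And>t. 0 \<le> t \<Longrightarrow> t \<le> 1 \<Longrightarrow> (\<lambda>i. q i + t * (q' i - q i)) \<in> S"
    and eq: "\<And>i. m \<le> i \<Longrightarrow> q i = q' i"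
    and z: "\<And>i p. i < m \<Longrightarrow> q i \<noteq> q' i \<Longrightarrow> p \<in> S \<Longrightarrow> pd i F p = 0"
  shows "F q = F q'"
proof -
  let ?\<gamma> = "\<lambda>t i. q i + t * (q' i - q i)"
  have "((\<lambda>t. F (?\<gamma> t)) has_real_derivative 0) (at t)" if t: "0 \<le> t" "t \<le> 1" for t
  proof -
    have "((\<lambda>t. F (?\<gamma> t)) has_real_derivative (\<Sum>i<m. pd i F (?\<gamma> t) * (q' i - q i))) (at t)"
      by (rule chain_rule[OF F op]) (use seg[OF t] eq in \<open>auto intro!: derivative_eq_intros\<close>)
    moreover have "(\<Sum>i<m. pd i F (?\<gamma> t) * (q' i - q i)) = 0"
      using z seg[OF t] by (intro sum.neutral) auto
    ultimately show ?thesis by simp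
  qed
  then have "\<exists>z::real. z > 0 \<and> z < 1 \<and> F (?\<gamma> 1) - F (?\<gamma> 0) = (1 - 0) * 0"
    by (intro MVT2[of 0 1 "\<lambda>t. F (?\<gamma> t)" "\<lambda>_. 0"]) auto
  then show ?thesis by auto
qed

section \<open>Prolongation to jet spaces\<close>

lemma tr_upd: "i < M \<Longrightarrow> tr M (p(i := t)) = (tr M p)(i := t)"
  by (auto simp: tr_def fun_eq_iff)

lemma tr_upd_ge: "M \<le> i \<Longrightarrow> tr M (p(i := t)) = tr M p"
  by (auto simp: tr_def fun_eq_iff)

lemma tr_tr: "tr M (tr N p) = tr (min M N) p"
  by (auto simp: tr_def fun_eq_iff)

lemma tr_in_Rn: "M \<le> N \<Longrightarrow> tr M p \<in> Rn N"
  by (simp add: tr_def Rn_def)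

lemma tr_nth: "i < M \<Longrightarrow> tr M p i = p i"
  by (simp add: tr_def)

text \<open>\<open>M\<close> counts coordinates, so these are functions of
  \<open>x, y_0, ..., y_(M-2)\<close>. The equation is global: the formulas for \<open>prol\<close>
  are total, so it holds for them off the domain of the transformation as well.\<close>

definition finite_order :: "nat \<Rightarrow> ((nat \<Rightarrow> real) \<Rightarrow> real) \<Rightarrow> bool" where
  "finite_order M F \<longleftrightarrow> (\<forall>q. F (tr M q) = F q)"

lemma finite_order_mono: "finite_order M F \<Longrightarrow> M \<le> N \<Longrightarrow> finite_order N F"
  unfolding finite_order_def by (metis tr_tr min.absorb1)

lemma pd_finite_order: "finite_order M F \<Longrightarrow> M \<le> i \<Longrightarrow> pd i F p = 0"
proof -
  assume F: "finite_order M F" and "M \<le> i"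
  then have "F (p(i := t)) = F p" for t unfolding finite_order_def by (metis tr_upd_ge)
  then show ?thesis by (simp add: pd_def)
qed

lemma pd_tr_comp: "i < M \<Longrightarrow> pd i (\<lambda>q. F (tr M q)) p = pd i F (tr M p)"
  by (simp add: pd_def tr_upd tr_nth)

lemma pd_tr:
  assumes "finite_order M F" shows "pd i F (tr M p) = pd i F p"
proof (cases "i < M")
  case True
  then show ?thesis using pd_tr_comp[OF True, of F p] assms by (simp add: finite_order_def)
qed (simp add: pd_finite_order[OF assms])

text \<open>The components of \<open>D_x\<close> as a vector field: coordinate \<open>i >= 1\<close>
  is \<open>y_(i-1)\<close>, and its rate of change \<open>y_i\<close> is coordinate
  \<open>i + 1\<close>.\<close>

definition jet_dir :: "(nat \<Rightarrow> real) \<Rightarrow> nat \<Rightarrow> real" where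
  "jet_dir p i = (if i = 0 then 1 else p (Suc i))"

text \<open>Vanishing is asked at the single point \<open>p\<close>, because for the function
  \<open>\<mu>\<close> of a Lagrangian equivalence the derivatives are controlled only on its
  domain.\<close>

lemma Dx_finite:
  assumes "\<And>k. M \<le> k \<Longrightarrow> pd k F p = 0" "1 \<le> M"
  shows "Dx F p = (\<Sum>i<M. jet_dir p i * pd i F p)"
proof -
  obtain M' where M: "M = Suc M'" using assms(2) by (cases M) auto
  have "(\<Sum>k. p (Suc (Suc k)) * pd (Suc k) F p) = (\<Sum>k<M'. p (Suc (Suc k)) * pd (Suc k) F p)"
    by (rule suminf_finite) (use assms(1) M in auto)
  then show ?thesis
    unfolding Dx_def M by (simp add: sum.lessThan_Suc_shift jet_dir_def del: sum.lessThan_Suc)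
qed

lemma Dx_finite_order:
  assumes "finite_order M F" "1 \<le> M"
  shows "Dx F p = (\<Sum>i<M. jet_dir p i * pd i F p)"
  by (rule Dx_finite[OF pd_finite_order]) (use assms in auto)

lemma finite_order_Dx:
  assumes F: "finite_order M F" and "1 \<le> M" "M < N"
  shows "finite_order N (Dx F)"
proof -
  have "pd i F (tr N p) = pd i F p" for i p
    by (rule pd_tr[OF finite_order_mono[OF F]]) (use assms in simp)
  moreover have "jet_dir (tr N p) i = jet_dir p i" if "i < M" for i p
    using that assms(3) by (simp add: jet_dir_def tr_def)
  ultimately show ?thesis unfolding finite_order_def Dx_finite_order[OF F assms(2)] by simp
qed

lemma smooth_in_Dx:
  assumes I: "coord_open I S" "{..<M} \<subseteq> I" and F: "smooth_in I S F" "finite_order M F" "1 \<le> M"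
  shows "smooth_in I S (Dx F)"
proof -
  have "smooth_in I S (\<lambda>p. jet_dir p i)" for i
    by (cases "i = 0") (auto simp: jet_dir_def intro: smooth_in_const smooth_in_coord I(1))
  then have "smooth_in I S (\<lambda>p. \<Sum>i<M. jet_dir p i * pd i F p)"
    using I F(1) by (intro smooth_in_sum smooth_in_mult smooth_in_pd) auto
  then show ?thesis by (rule smooth_in_cong[OF I(1)]) (rule Dx_finite_order[OF F(2,3)])
qed

text \<open>The first three components may all read \<open>x, y_0, y_1\<close>, whence
  \<open>3 <= N\<close>; after that each total derivative brings in at most one more
  variable.\<close>

lemma finite_order_prol: "3 \<le> N \<Longrightarrow> j < N \<Longrightarrow> finite_order N (prol \<phi> j)"
proof (induction \<phi> j arbitrary: N rule: prol.induct)
  case (4 \<phi> k)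
  have "finite_order 3 (prol \<phi> 0)" by (simp add: finite_order_def tr_tr)
  then have "finite_order N (Dx (prol \<phi> 0))"
    by (rule finite_order_Dx) (use 4 in auto)
  moreover have "finite_order N (Dx (prol \<phi> (Suc (Suc k))))"
    by (rule finite_order_Dx[OF 4(1), of "Suc (Suc (Suc k))"]) (use 4 in auto)
  ultimately show ?case by (simp add: finite_order_def)
qed (simp_all add: finite_order_def tr_tr)

lemma prol_tr: "3 \<le> N \<Longrightarrow> j < N \<Longrightarrow> prol \<phi> j (tr N p) = prol \<phi> j p"
  using finite_order_prol unfolding finite_order_def by blast

lemma continuous_on_tr: "continuous_on S (tr M)"
proof (rule continuous_on_coordinatewise_then_product)
  fix i show "continuous_on S (\<lambda>p. tr M p i)"
    by (cases "i < M") (auto simp: tr_def intro: continuous_on_subset[OF continuous_on_product_coordinates])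
qed

lemma openin_tr_vimage:
  assumes "openin (top_of_set (Rn M)) U"
  shows "openin (top_of_set (Rn N)) {p \<in> Rn N. tr M p \<in> U}"
proof -
  have "openin (top_of_set (Rn N)) (Rn N \<inter> tr M -` U)"
    by (rule continuous_openin_preimage[OF continuous_on_tr _ assms]) (auto simp: tr_in_Rn)
  then show ?thesis by (simp add: vimage_def Int_def)
qed

lemma openin_nonzero:
  fixes F :: "(nat \<Rightarrow> real) \<Rightarrow> real"
  assumes "openin (top_of_set X) S" "continuous_on S F"
  shows "openin (top_of_set X) {p \<in> S. F p \<noteq> 0}"
proof -
  have "openin (top_of_set S) (S \<inter> F -` (- {0}))"
    by (rule continuous_openin_preimage_gen[OF assms(2)]) auto
  moreover have "S \<inter> F -` (- {0}) = {p \<in> S. F p \<noteq> 0}" by auto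
  ultimately show ?thesis using openin_trans assms(1) by metis
qed

lemma prol0_smooth:
  assumes U: "openin (top_of_set (Rn 3)) U" "smooth_map 3 U \<phi>" and I: "coord_open I S"
    and S: "\<And>p. p \<in> S \<Longrightarrow> tr 3 p \<in> U" and j: "j < 3"
  shows "smooth_in I S (prol \<phi> j)"
proof -
  have *: "smooth_in I S (\<lambda>p. \<phi> (tr 3 p) j)"
    by (rule smooth_in_comp[OF I U(1), where F = "\<lambda>q. \<phi> q j"])
      (use U(2) j S in \<open>auto simp: smooth_map_def tr_def intro: smooth_in_coord I\<close>)
  from j consider "j = 0" | "j = Suc 0" | "j = Suc (Suc 0)" by linarith
  then show ?thesis by cases (use * in \<open>simp_all add: numeral_2_eq_2\<close>)
qed

lemma prol_smooth:
  assumes U: "openin (top_of_set (Rn 3)) U" "smooth_map 3 U \<phi>" and I: "coord_open I S" "{..<N} \<subseteq> I" "3 \<le> N"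
    and S: "\<And>p. p \<in> S \<Longrightarrow> tr 3 p \<in> U" "\<And>p. p \<in> S \<Longrightarrow> Dx (prol \<phi> 0) p \<noteq> 0" and j: "j < N"
  shows "smooth_in I S (prol \<phi> j)"
  using j
proof (induction j rule: less_induct)
  case (less j)
  show ?case
  proof (cases "j < 3")
    case False
    then obtain k where k: "j = Suc (Suc (Suc k))" by (intro that[of "j - 3"]) simp
    have "smooth_in I S (Dx (prol \<phi> 0))"
      by (rule smooth_in_Dx[OF I(1), of 3]) (use I less.IH[of 0] k less.prems finite_order_prol[of 3 0] in auto)
    moreover have "smooth_in I S (Dx (prol \<phi> (Suc (Suc k))))"
      by (rule smooth_in_Dx[OF I(1), of j]) (use I less.IH[of "Suc (Suc k)"] k less.prems finite_order_prol[of j "Suc (Suc k)"] in auto)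
    ultimately show ?thesis unfolding k prol.simps(4) by (intro smooth_in_divide[OF I(1)] S(2))
  next
    case True
    show ?thesis by (rule prol0_smooth[OF U I(1) S(1) True])
  qed
qed

text \<open>The points of the jet space with \<open>N\<close> coordinates at which the prolongation
  is defined: every denominator in \<open>prol\<close> is \<open>Dx (prol \<phi> 0)\<close>.\<close>

definition jet_dom :: "nat \<Rightarrow> (nat \<Rightarrow> real) set \<Rightarrow> ((nat \<Rightarrow> real) \<Rightarrow> (nat \<Rightarrow> real)) \<Rightarrow> (nat \<Rightarrow> real) set" where
  "jet_dom N U \<phi> = {p \<in> Rn N. tr 3 p \<in> U \<and> Dx (prol \<phi> 0) p \<noteq> 0}"

lemma openin_jet_dom:
  assumes U: "openin (top_of_set (Rn 3)) U" "smooth_map 3 U \<phi>" and N: "3 \<le> N"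
  shows "openin (top_of_set (Rn N)) (jet_dom N U \<phi>)"
proof -
  let ?S = "{p \<in> Rn N. tr 3 p \<in> U}"
  have o: "openin (top_of_set (Rn N)) ?S" by (rule openin_tr_vimage[OF U(1)])
  have "smooth_in {..<N} ?S (Dx (prol \<phi> 0))"
    by (rule smooth_in_Dx[OF coord_open_Rn[OF o], of 3])
      (use prol0_smooth[OF U coord_open_Rn[OF o], of 0] N finite_order_prol[of 3 0] in auto)
  from openin_nonzero[OF o smooth_in_continuous[OF this]]
  show ?thesis by (simp add: jet_dom_def conj_assoc)
qed

section \<open>Local diffeomorphisms and their Jacobians\<close>

lemma diffeoD:
  assumes "diffeo m U V \<psi>"
  shows "openin (top_of_set (Rn m)) U" "openin (top_of_set (Rn m)) V"
    "smooth_map m U \<psi>" "smooth_map m V (inv_into U \<psi>)"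
    "\<And>q. q \<in> U \<Longrightarrow> \<psi> q \<in> V" "\<And>r. r \<in> V \<Longrightarrow> inv_into U \<psi> r \<in> U"
    "\<And>q. q \<in> U \<Longrightarrow> inv_into U \<psi> (\<psi> q) = q" "\<And>r. r \<in> V \<Longrightarrow> \<psi> (inv_into U \<psi> r) = r"
    "coord_open {..<m} U" "coord_open {..<m} V" "U \<subseteq> Rn m" "V \<subseteq> Rn m"
    "\<And>j. j < m \<Longrightarrow> smooth_in {..<m} U (\<lambda>q. \<psi> q j)"
    "\<And>j. j < m \<Longrightarrow> smooth_in {..<m} V (\<lambda>q. inv_into U \<psi> q j)"
  using assms unfolding diffeo_def smooth_map_def
  by (auto simp: coord_open_Rn openin_imp_subset bij_betw_def inv_into_into f_inv_into_f)

lemma smooth_map_cong: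
  assumes "coord_open {..<m} U" "smooth_map m U \<psi>" "\<And>q. q \<in> U \<Longrightarrow> \<xi> q = \<psi> q"
  shows "smooth_map m U \<xi>"
  unfolding smooth_map_def
proof (intro conjI ballI allI impI)
  show "\<xi> q \<in> Rn m" if "q \<in> U" for q using assms(2,3) that by (simp add: smooth_map_def)
  show "smooth_in {..<m} U (\<lambda>q. \<xi> q j)" if "j < m" for j
    by (rule smooth_in_cong[OF assms(1), of "\<lambda>q. \<psi> q j"]) (use assms(2,3) that in \<open>auto simp: smooth_map_def\<close>)
qed

lemma diffeoI:
  assumes U: "openin (top_of_set (Rn m)) U" "openin (top_of_set (Rn m)) V"
    and "smooth_map m U \<psi>" "smooth_map m V \<xi>"
    and inv: "\<And>q. q \<in> U \<Longrightarrow> \<psi> q \<in> V" "\<And>r. r \<in> V \<Longrightarrow> \<xi> r \<in> U"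
      "\<And>q. q \<in> U \<Longrightarrow> \<xi> (\<psi> q) = q" "\<And>r. r \<in> V \<Longrightarrow> \<psi> (\<xi> r) = r"
  shows "diffeo m U V \<psi>"
proof -
  have bij: "bij_betw \<psi> U V" by (rule bij_betw_byWitness[of U \<xi>]) (use inv in auto)
  have "inv_into U \<psi> r = \<xi> r" if "r \<in> V" for r
    using bij inv that by (metis bij_betw_imp_inj_on inv_into_f_f)
  then have "smooth_map m V (inv_into U \<psi>)"
    by (intro smooth_map_cong[OF coord_open_Rn[OF U(2)] assms(4)])
  then show ?thesis using assms(1-3) bij by (simp add: diffeo_def)
qed

lemma diffeo_inverse:
  assumes "diffeo m U V \<psi>" shows "diffeo m V U (inv_into U \<psi>)"
  by (rule diffeoI[where \<xi> = \<psi>]) (simp_all add: diffeoD[OF assms])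

lemma diffeo_jacobian:
  assumes d: "diffeo m U V \<psi>" and q: "q \<in> U" and ij: "i < m" "j < m"
  shows "(\<Sum>l<m. pd l (\<lambda>r. inv_into U \<psi> r j) (\<psi> q) * pd i (\<lambda>q. \<psi> q l) q) = (if i = j then 1 else 0)"
proof -
  note D = diffeoD[OF d]
  have "pd i (\<lambda>q. inv_into U \<psi> (\<psi> q) j) q = pd i (\<lambda>q. q j) q"
    by (rule pd_cong[OF D(9) q]) (use D(7) ij in auto)
  moreover have "pd i (\<lambda>q. inv_into U \<psi> (\<psi> q) j) q =
      (\<Sum>l<m. pd l (\<lambda>r. inv_into U \<psi> r j) (\<psi> q) * pd i (\<lambda>q. \<psi> q l) q)"
    by (rule pd_comp[OF D(9,2) D(14)[OF ij(2)] D(5) D(13) q]) (use ij in auto)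
  ultimately show ?thesis by (simp add: pd_coord)
qed

lemma diffeo_jacobian_inverse:
  assumes d: "diffeo m U V \<psi>" and q: "q \<in> U" and ij: "i < m" "j < m"
  shows "(\<Sum>l<m. pd l (\<lambda>q. \<psi> q j) q * pd i (\<lambda>r. inv_into U \<psi> r l) (\<psi> q)) = (if i = j then 1 else 0)"
proof -
  note D = diffeoD[OF d]
  have "pd i (\<lambda>r. \<psi> (inv_into U \<psi> r) j) (\<psi> q) = pd i (\<lambda>q. q j) (\<psi> q)"
    by (rule pd_cong[OF D(10) D(5)[OF q]]) (use D(8) ij in auto)
  moreover have "pd i (\<lambda>r. \<psi> (inv_into U \<psi> r) j) (\<psi> q) =
      (\<Sum>l<m. pd l (\<lambda>q. \<psi> q j) (inv_into U \<psi> (\<psi> q)) * pd i (\<lambda>r. inv_into U \<psi> r l) (\<psi> q))"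
    by (rule pd_comp[OF D(10,1) D(13)[OF ij(2)] D(6) D(14) D(5)[OF q]]) (use ij in auto)
  ultimately show ?thesis by (simp add: pd_coord D(7)[OF q])
qed

text \<open>The Jacobian of the inverse is a right inverse of the Jacobian, so multiplying the
  vanishing combination of rows by it recovers \<open>a\<close>.\<close>

lemma diffeo_rows_independent:
  assumes d: "diffeo m U V \<psi>" and q: "q \<in> U"
    and a: "\<And>i. i < m \<Longrightarrow> (\<Sum>l<m. a l * pd i (\<lambda>q. \<psi> q l) q) = 0" and k: "k < m"
  shows "a k = 0"
proof -
  let ?\<xi> = "inv_into U \<psi>"
  have "a k = (\<Sum>l<m. a l * (if k = l then 1 else 0))" using k by (simp add: if_distrib cong: if_cong)
  also have "\<dots> = (\<Sum>l<m. a l * (\<Sum>i<m. pd i (\<lambda>q. \<psi> q l) q * pd k (\<lambda>r. ?\<xi> r i) (\<psi> q)))"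
    using diffeo_jacobian_inverse[OF d q k] by (intro sum.cong) auto
  also have "\<dots> = (\<Sum>i<m. (\<Sum>l<m. a l * pd i (\<lambda>q. \<psi> q l) q) * pd k (\<lambda>r. ?\<xi> r i) (\<psi> q))"
    by (simp add: sum_distrib_left sum_distrib_right mult.assoc) (rule sum.swap)
  also have "\<dots> = 0" using a by simp
  finally show ?thesis .
qed

text \<open>Let \<open>\<eta>\<close> be the pullback of \<open>theta 0\<close> by the inverse.
  Multiplied by the Jacobian of \<open>\<phi>\<close>, the row \<open>\<eta>\<close> becomes
  \<open>theta 0\<close> at \<open>p\<close>, whereas the row \<open>theta 0\<close> at
  \<open>r\<close> becomes \<open>c\<close> times \<open>theta 0\<close> at \<open>p\<close>.
  Independence of rows gives \<open>c * \<eta> = theta 0\<close> at \<open>r\<close>, and the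
  \<open>dy_0\<close> coefficient forces \<open>c\<close> to be nonzero.\<close>

lemma contact_transf_inverse:
  assumes c: "contact_transf U V \<phi>"
  shows "contact_transf V U (inv_into U \<phi>)"
  unfolding contact_transf_def
proof (intro conjI ballI)
  have d: "diffeo 3 U V \<phi>" using c by (simp add: contact_transf_def)
  note D = diffeoD[OF d]
  show "diffeo 3 V U (inv_into U \<phi>)" by (rule diffeo_inverse[OF d])
  fix r assume r: "r \<in> V"
  let ?\<xi> = "inv_into U \<phi>"
  define p where "p = ?\<xi> r"
  have p: "p \<in> U" "\<phi> p = r" "?\<xi> r = p" using D(6,8) r by (auto simp: p_def)
  obtain c where c: "\<And>i. i < 3 \<Longrightarrow> pd i (\<lambda>q. \<phi> q 1) p - \<phi> p 2 * pd i (\<lambda>q. \<phi> q 0) p = c * theta 0 p i"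
    using c p(1) unfolding contact_transf_def by blast
  define \<eta> where "\<eta> i = pd i (\<lambda>q. ?\<xi> q 1) r - ?\<xi> r 2 * pd i (\<lambda>q. ?\<xi> q 0) r" for i
  have "(\<Sum>l<3. (c * \<eta> l - theta 0 r l) * pd i (\<lambda>q. \<phi> q l) p) = 0" if i: "i < 3" for i
  proof -
    have "(\<Sum>l<3. \<eta> l * pd i (\<lambda>q. \<phi> q l) p)
      = (\<Sum>l<3. pd l (\<lambda>q. ?\<xi> q 1) r * pd i (\<lambda>q. \<phi> q l) p) - p 2 * (\<Sum>l<3. pd l (\<lambda>q. ?\<xi> q 0) r * pd i (\<lambda>q. \<phi> q l) p)"
      unfolding \<eta>_def p(3) by (simp add: sum_distrib_left sum_subtractf[symmetric] algebra_simps)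
    also have "\<dots> = theta 0 p i"
      using diffeo_jacobian[OF d p(1) i, of 0] diffeo_jacobian[OF d p(1) i, of 1]
      unfolding p(2) theta_def by (auto simp: numeral_2_eq_2)
    finally have "(\<Sum>l<3. \<eta> l * pd i (\<lambda>q. \<phi> q l) p) = theta 0 p i" .
    moreover have "(\<Sum>l<3. theta 0 r l * pd i (\<lambda>q. \<phi> q l) p) = c * theta 0 p i"
      using c[OF i] unfolding p(2) by (simp add: theta_def eval_nat_numeral)
    ultimately show ?thesis
      by (simp add: left_diff_distrib sum_subtractf mult.assoc flip: sum_distrib_left)
  qed
  from diffeo_rows_independent[OF d p(1) this]
  have e: "c * \<eta> k = theta 0 r k" if "k < 3" for k using that by simp
  from e[of 1] have "c * \<eta> 1 = 1" by (simp add: theta_def)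
  then have "\<eta> k = (1 / c) * theta 0 r k" if "k < 3" for k
    using e[OF that] by (cases "c = 0") (auto simp: field_simps)
  then show "\<exists>c. \<forall>i<3. pd i (\<lambda>q. ?\<xi> q 1) r - ?\<xi> r 2 * pd i (\<lambda>q. ?\<xi> q 0) r = c * theta 0 r i"
    unfolding \<eta>_def by blast
qed

section \<open>Prolongations of contact transformations\<close>

text \<open>\<open>theta 0\<close> annihilates \<open>D_x\<close>, hence so does its multiple, the
  pullback of \<open>theta 0\<close>. The resulting relation is the recursion of \<open>prol\<close>
  at the level below the first one where it serves as a definition.\<close>

lemma contact_Dx:
  assumes c: "contact_transf U V \<phi>" and p: "tr 3 p \<in> U"
  shows "Dx (prol \<phi> (Suc 0)) p = prol \<phi> (Suc (Suc 0)) p * Dx (prol \<phi> 0) p"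
proof -
  obtain c where c: "\<And>i. i < 3 \<Longrightarrow> pd i (\<lambda>q. \<phi> q 1) (tr 3 p) - \<phi> (tr 3 p) 2 * pd i (\<lambda>q. \<phi> q 0) (tr 3 p) = c * theta 0 (tr 3 p) i"
    using c p unfolding contact_transf_def by blast
  have D: "Dx (\<lambda>q. \<phi> (tr 3 q) j) p = (\<Sum>i<3. jet_dir p i * pd i (\<lambda>q. \<phi> q j) (tr 3 p))" for j
  proof -
    have "Dx (\<lambda>q. \<phi> (tr 3 q) j) p = (\<Sum>i<3. jet_dir p i * pd i (\<lambda>q. \<phi> (tr 3 q) j) p)"
      by (rule Dx_finite_order) (auto simp: finite_order_def tr_tr)
    then show ?thesis using pd_tr_comp[of _ 3 "\<lambda>q. \<phi> q j"] by simp
  qed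
  have "Dx (\<lambda>q. \<phi> (tr 3 q) 1) p - \<phi> (tr 3 p) 2 * Dx (\<lambda>q. \<phi> (tr 3 q) 0) p =
    (\<Sum>i<3. jet_dir p i * (pd i (\<lambda>q. \<phi> q 1) (tr 3 p) - \<phi> (tr 3 p) 2 * pd i (\<lambda>q. \<phi> q 0) (tr 3 p)))"
    unfolding D by (simp add: sum_distrib_left sum_subtractf[symmetric] algebra_simps)
  also have "\<dots> = (\<Sum>i<3. jet_dir p i * (c * theta 0 (tr 3 p) i))" using c by simp
  also have "\<dots> = 0" by (simp add: eval_nat_numeral jet_dir_def theta_def tr_def)
  finally show ?thesis by simp
qed

lemma Dx_prol:
  assumes c: "contact_transf U V \<phi>" and p: "tr 3 p \<in> U" and D: "Dx (prol \<phi> 0) p \<noteq> 0" and j: "1 \<le> j"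
  shows "Dx (prol \<phi> j) p = prol \<phi> (Suc j) p * Dx (prol \<phi> 0) p"
proof (cases "j = 1")
  case True then show ?thesis using contact_Dx[OF c p] by simp
next
  case False
  then have "j = Suc (Suc (j - 2))" using j by simp
  then obtain k where "j = Suc (Suc k)" by blast
  then show ?thesis using D by (simp only: prol.simps(4)) simp
qed

lemma Dx_coord: "Dx (\<lambda>q. q j) p = jet_dir p j"
proof -
  have "Dx (\<lambda>q. q j) p = (\<Sum>i<Suc j. jet_dir p i * pd i (\<lambda>q. q j) p)"
    by (rule Dx_finite_order) (auto simp: finite_order_def tr_def)
  then show ?thesis by (simp add: pd_coord)
qed

lemma finite_order_coord: "j < M \<Longrightarrow> finite_order M (\<lambda>q. q j)"
  by (simp add: finite_order_def tr_def)

lemma contact_diffeo: "contact_transf U V \<phi> \<Longrightarrow> diffeo 3 U V \<phi>"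
  by (simp add: contact_transf_def)

lemma openin_contact_jet_dom:
  assumes "contact_transf U V \<phi>" "4 \<le> N"
  shows "openin (top_of_set (Rn N)) (jet_dom N U \<phi>)"
  by (rule openin_jet_dom) (use diffeoD[OF contact_diffeo[OF assms(1)]] assms(2) in auto)

lemma prol_smooth_jet_dom:
  assumes "contact_transf U V \<phi>" "4 \<le> N" "j < N"
  shows "smooth_in {..<N} (jet_dom N U \<phi>) (prol \<phi> j)"
  by (rule prol_smooth[OF diffeoD(1,3)[OF contact_diffeo[OF assms(1)]] coord_open_Rn[OF openin_contact_jet_dom[OF assms(1,2)]]])
    (use assms in \<open>auto simp: jet_dom_def\<close>)

context
  fixes U V \<phi> and N :: nat
  assumes c: "contact_transf U V \<phi>" and N: "4 \<le> N"
begin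

lemmas contact_diffeoD = diffeoD[OF contact_diffeo[OF c]]

lemma tr_prolong_nth: "j < N \<Longrightarrow> tr N (prolong \<phi> q) j = prol \<phi> j q"
  by (simp add: tr_def prolong_def)

text \<open>The prolongation carries \<open>D_x\<close> to \<open>Dx (prol \<phi> 0)\<close> times
  \<open>D_x\<close>; this is \<open>Dx_prol\<close> read componentwise and inserted into the chain
  rule. \<open>M < N\<close> keeps component \<open>M\<close> of the prolongation, which
  \<open>jet_dir\<close> reads at index \<open>M - 1\<close>, from being truncated.\<close>

lemma Dx_comp_prolong:
  assumes T: "openin (top_of_set (Rn N)) T" "smooth_in {..<N} T F"
    and maps: "\<And>q. q \<in> jet_dom N U \<phi> \<Longrightarrow> tr N (prolong \<phi> q) \<in> T"
    and F: "finite_order M F" "3 \<le> M" "M < N" and p: "p \<in> jet_dom N U \<phi>"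
  shows "Dx (\<lambda>q. F (tr N (prolong \<phi> q))) p = Dx F (tr N (prolong \<phi> p)) * Dx (prol \<phi> 0) p"
proof -
  let ?P = "\<lambda>q. tr N (prolong \<phi> q)" and ?S = "jet_dom N U \<phi>"
  have op: "coord_open {..<N} ?S" by (rule coord_open_Rn[OF openin_contact_jet_dom[OF c N]])
  have "F (?P (tr M q)) = F (?P q)" for q
  proof -
    have "tr M (?P (tr M q)) = tr M (?P q)"
      using F(2,3) by (auto simp: fun_eq_iff tr_def prolong_def prol_tr[of M _ \<phi> q, unfolded tr_def])
    then show ?thesis using F(1) unfolding finite_order_def by metis
  qed
  then have "finite_order M (\<lambda>q. F (?P q))" by (simp add: finite_order_def)
  then have "Dx (\<lambda>q. F (?P q)) p = (\<Sum>i<M. jet_dir p i * pd i (\<lambda>q. F (?P q)) p)"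
    by (rule Dx_finite_order) (use F in simp)
  also have "\<dots> = (\<Sum>i<M. jet_dir p i * (\<Sum>l<M. pd l F (?P p) * pd i (prol \<phi> l) p))"
  proof (intro sum.cong refl arg_cong2[where f = "(*)"])
    fix i assume i: "i \<in> {..<M}"
    have eq: "(\<lambda>q. ?P q j) = prol \<phi> j" if "j < N" for j using tr_prolong_nth[OF that] by auto
    have "pd i (\<lambda>q. F (?P q)) p = (\<Sum>l<N. pd l F (?P p) * pd i (\<lambda>q. ?P q l) p)"
      by (rule pd_comp[OF op T maps _ p]) (use i F(3) eq prol_smooth_jet_dom[OF c N] in auto)
    also have "\<dots> = (\<Sum>l<N. pd l F (?P p) * pd i (prol \<phi> l) p)" using eq by simp
    also have "\<dots> = (\<Sum>l<M. pd l F (?P p) * pd i (prol \<phi> l) p)"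
      using F(3) pd_finite_order[OF F(1)] by (intro sum.mono_neutral_right) auto
    finally show "pd i (\<lambda>q. F (?P q)) p = (\<Sum>l<M. pd l F (?P p) * pd i (prol \<phi> l) p)" .
  qed
  also have "\<dots> = (\<Sum>l<M. pd l F (?P p) * (\<Sum>i<M. jet_dir p i * pd i (prol \<phi> l) p))"
    by (simp add: sum_distrib_left mult.left_commute) (rule sum.swap)
  also have "\<dots> = (\<Sum>l<M. pd l F (?P p) * (jet_dir (?P p) l * Dx (prol \<phi> 0) p))"
  proof (intro sum.cong refl arg_cong2[where f = "(*)"])
    fix l assume l: "l \<in> {..<M}"
    have "(\<Sum>i<M. jet_dir p i * pd i (prol \<phi> l) p) = Dx (prol \<phi> l) p"
      by (rule Dx_finite_order[OF finite_order_prol, symmetric]) (use F l in auto)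
    also have "\<dots> = jet_dir (?P p) l * Dx (prol \<phi> 0) p"
    proof (cases "l = 0")
      case False
      then have "Dx (prol \<phi> l) p = prol \<phi> (Suc l) p * Dx (prol \<phi> 0) p"
        using p by (intro Dx_prol[OF c]) (auto simp: jet_dom_def)
      then show ?thesis using False l F(3) tr_prolong_nth[of "Suc l" p] by (simp add: jet_dir_def)
    qed (simp add: jet_dir_def)
    finally show "(\<Sum>i<M. jet_dir p i * pd i (prol \<phi> l) p) = jet_dir (?P p) l * Dx (prol \<phi> 0) p" .
  qed
  also have "\<dots> = Dx F (?P p) * Dx (prol \<phi> 0) p"
  proof -
    have "1 \<le> M" using F(2) by simp
    from Dx_finite_order[OF F(1) this] show ?thesis by (simp add: sum_distrib_left mult_ac)
  qed
  finally show ?thesis .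
qed

lemma tr3_prolong: "tr 3 (tr N (prolong \<phi> p)) = \<phi> (tr 3 p)" if "tr 3 p \<in> U"
proof -
  have "\<phi> (tr 3 p) \<in> Rn 3" using contact_diffeoD(5,12) that by blast
  moreover have "tr 3 (tr N (prolong \<phi> p)) j = \<phi> (tr 3 p) j" if "j < 3" for j
  proof -
    from that consider "j = 0" | "j = Suc 0" | "j = Suc (Suc 0)" by linarith
    then show ?thesis using N by cases (simp_all add: tr_def prolong_def numeral_2_eq_2)
  qed
  ultimately show ?thesis by (auto simp: fun_eq_iff tr_def Rn_def)
qed

lemma Dx_cong:
  assumes "finite_order M F" "finite_order M G" "1 \<le> M" "M \<le> N"
    and "\<And>q. q \<in> jet_dom N U \<phi> \<Longrightarrow> F q = G q" "p \<in> jet_dom N U \<phi>"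
  shows "Dx F p = Dx G p"
  unfolding Dx_finite_order[OF assms(1,3)] Dx_finite_order[OF assms(2,3)]
  by (intro sum.cong refl arg_cong2[where f = "(*)"] pd_cong[OF coord_open_Rn[OF openin_contact_jet_dom[OF c N]] assms(6)] assms(5))
    (use assms(4) in auto)

lemma finite_order_comp_prolong:
  assumes "finite_order M F" "3 \<le> M" "M \<le> N"
  shows "finite_order M (\<lambda>q. F (tr N (prolong \<phi> q)))"
proof -
  have "tr M (tr N (prolong \<phi> (tr M q))) = tr M (tr N (prolong \<phi> q))" for q
    using assms(2,3) by (auto simp: fun_eq_iff tr_def prolong_def prol_tr[of M _ \<phi> q, unfolded tr_def])
  then show ?thesis using assms(1) unfolding finite_order_def by metis
qed

context
  fixes \<phi>' :: "(nat \<Rightarrow> real) \<Rightarrow> (nat \<Rightarrow> real)"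
  assumes c': "contact_transf V U \<phi>'" and inverse: "\<And>p. p \<in> U \<Longrightarrow> \<phi>' (\<phi> p) = p"
begin

lemma prol_inverse_low:
  assumes "tr 3 p \<in> U" "j < 3"
  shows "prol \<phi>' j (tr N (prolong \<phi> p)) = p j"
proof -
  have *: "\<phi>' (tr 3 (tr N (prolong \<phi> p))) j = p j"
    using assms inverse[OF assms(1)] by (simp add: tr3_prolong tr_nth)
  consider "j = 0" | "j = Suc 0" | "j = Suc (Suc 0)" using assms(2) by linarith
  then show ?thesis using * by cases (simp_all add: numeral_2_eq_2)
qed

text \<open>Apply \<open>Dx_comp_prolong\<close> to component 0 of the inverse: composed with the
  prolongation it is the coordinate \<open>x\<close>, and \<open>D_x x = 1\<close>. So the two
  factors are reciprocal, and neither vanishes.\<close>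

lemma prolong_maps_jet_dom:
  assumes p: "p \<in> jet_dom N U \<phi>"
  shows "Dx (prol \<phi>' 0) (tr N (prolong \<phi> p)) * Dx (prol \<phi> 0) p = 1"
    and "tr N (prolong \<phi> p) \<in> jet_dom N V \<phi>'"
proof -
  \<comment> \<open>The condition \<open>Dx (prol \<phi>' 0) r \<noteq> 0\<close> cannot be part of
    the target set yet, since it is what is being proved; component 0 is smooth over
    \<open>V\<close> without it.\<close>
  let ?T = "{r \<in> Rn N. tr 3 r \<in> V}"
  have T: "openin (top_of_set (Rn N)) ?T" by (rule openin_tr_vimage[OF contact_diffeoD(2)])
  have maps: "tr N (prolong \<phi> q) \<in> ?T" if "q \<in> jet_dom N U \<phi>" for q
    using that contact_diffeoD(5) by (auto simp: jet_dom_def tr3_prolong tr_in_Rn)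
  have "smooth_in {..<N} ?T (prol \<phi>' 0)"
    by (rule prol0_smooth[OF diffeoD(1,3)[OF contact_diffeo[OF c']] coord_open_Rn[OF T]]) auto
  from Dx_comp_prolong[OF T this maps finite_order_prol, of 3 p]
  have "Dx (\<lambda>q. prol \<phi>' 0 (tr N (prolong \<phi> q))) p = Dx (prol \<phi>' 0) (tr N (prolong \<phi> p)) * Dx (prol \<phi> 0) p"
    using p N by simp
  moreover have "Dx (\<lambda>q. prol \<phi>' 0 (tr N (prolong \<phi> q))) p = Dx (\<lambda>q. q 0) p"
    by (rule Dx_cong[OF finite_order_comp_prolong[OF finite_order_prol, of 3] finite_order_coord _ _ _ p])
      (use N prol_inverse_low[of _ 0] in \<open>auto simp: jet_dom_def\<close>)
  ultimately show 1: "Dx (prol \<phi>' 0) (tr N (prolong \<phi> p)) * Dx (prol \<phi> 0) p = 1"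
    by (simp add: Dx_coord jet_dir_def)
  then have "Dx (prol \<phi>' 0) (tr N (prolong \<phi> p)) \<noteq> 0" by force
  with maps[OF p] show "tr N (prolong \<phi> p) \<in> jet_dom N V \<phi>'"
    unfolding jet_dom_def by blast
qed

text \<open>For \<open>j >= 2\<close>, apply \<open>D_x\<close> to the identity for component
  \<open>j\<close>. One side is \<open>p (Suc j)\<close>, the other the numerator of
  \<open>prol \<phi>' (Suc j)\<close> times \<open>Dx (prol \<phi> 0) p\<close>, and by reciprocity
  this factor is one over the denominator.\<close>

lemma prol_inverse:
  assumes p: "p \<in> jet_dom N U \<phi>" and j: "j < N"
  shows "prol \<phi>' j (tr N (prolong \<phi> p)) = p j"
  using p j
proof (induction j arbitrary: p)
  case 0
  then show ?case using prol_inverse_low[of p 0] by (simp add: jet_dom_def)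
next
  case (Suc j)
  let ?P = "\<lambda>q. tr N (prolong \<phi> q)"
  show ?case
  proof (cases "Suc j < 3")
    case True
    then show ?thesis using prol_inverse_low[of p "Suc j"] Suc.prems by (simp add: jet_dom_def)
  next
    case False
    then obtain k where k: "j = Suc (Suc k)" by (intro that[of "j - 2"]) simp
    have D: "Dx (prol \<phi>' 0) (?P p) * Dx (prol \<phi> 0) p = 1"
      by (rule prolong_maps_jet_dom(1)[OF Suc.prems(1)])
    have "Dx (\<lambda>q. prol \<phi>' j (?P q)) p = Dx (prol \<phi>' j) (?P p) * Dx (prol \<phi> 0) p"
      by (rule Dx_comp_prolong[OF openin_contact_jet_dom[OF c' N] prol_smooth_jet_dom[OF c' N]
          prolong_maps_jet_dom(2) finite_order_prol, of _ "Suc j"])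
        (use Suc.prems k in auto)
    moreover have "Dx (\<lambda>q. prol \<phi>' j (?P q)) p = Dx (\<lambda>q. q j) p"
      by (rule Dx_cong[OF finite_order_comp_prolong[OF finite_order_prol, of "Suc j"] finite_order_coord _ _ _ Suc.prems(1)])
        (use Suc k in auto)
    ultimately have "Dx (prol \<phi>' j) (?P p) * Dx (prol \<phi> 0) p = p (Suc j)"
      using k by (simp add: Dx_coord jet_dir_def)
    moreover have "prol \<phi>' (Suc j) (?P p) = Dx (prol \<phi>' j) (?P p) / Dx (prol \<phi>' 0) (?P p)"
      unfolding k prol.simps(4) by (rule refl)
    moreover have "a / d = e" if "a * b = e" "d * b = 1" for a b d e :: real
    proof -
      have "d \<noteq> 0" using that(2) by auto
      then have "b = 1 / d" using that(2) by (simp add: field_simps)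
      then show ?thesis using that(1) by simp
    qed
    ultimately show ?thesis using D by presburger
  qed
qed

lemma prolong_inverse:
  assumes p: "p \<in> jet_dom N U \<phi>"
  shows "tr N (prolong \<phi>' (tr N (prolong \<phi> p))) = p"
proof -
  have "p \<in> Rn N" using p by (simp add: jet_dom_def)
  then show ?thesis using prol_inverse[OF assms]
    by (auto simp: fun_eq_iff tr_def prolong_def Rn_def)
qed

end

end

text \<open>The \<open>dy_k\<close> coefficients can be adjusted freely by contact forms, so modulo
  these a form is determined by its value on \<open>D_x\<close>. The pullback of \<open>F dx\<close>
  is \<open>F\<close> along the prolongation times the differential of \<open>prol \<phi> 0\<close>,
  whose value on \<open>D_x\<close> is \<open>Dx (prol \<phi> 0)\<close>.\<close>

lemma eq_mod_contact_hdx: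
  "eq_mod_contact W (pullback (prolong \<phi>) (hdx F)) (\<lambda>p i. \<alpha> * hdx G p i + hdx H p i) \<longleftrightarrow>
    (\<forall>p\<in>W. F (prolong \<phi> p) * Dx (prol \<phi> 0) p = \<alpha> * G p + H p)"
proof -
  have pb: "pullback (prolong \<phi>) (hdx F) p i = F (prolong \<phi> p) * pd i (prol \<phi> 0) p" for p i
  proof -
    have "pullback (prolong \<phi>) (hdx F) p i = (\<Sum>j\<in>{0}. hdx F (prolong \<phi> p) j * pd i (\<lambda>q. prolong \<phi> q j) p)"
      unfolding pullback_def by (rule suminf_finite) (auto simp: hdx_def)
    also have "\<dots> = F (prolong \<phi> p) * pd i (prol \<phi> 0) p" by (simp add: hdx_def prolong_def del: prol.simps)
    finally show ?thesis .
  qed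
  have theta: "(\<Sum>k<K. c k * theta k p i) =
      (if i = 0 then - (\<Sum>k<K. c k * p (Suc (Suc k))) else if i - 1 < K then c (i - 1) else 0)" for c K p i
  proof (cases i)
    case (Suc l)
    have "(\<Sum>k<K. c k * theta k p i) = (\<Sum>k<K. if k = l then c k else 0)"
      by (rule sum.cong) (auto simp: theta_def Suc)
    then show ?thesis by (auto simp: Suc)
  qed (simp add: theta_def sum_negf)
  have fo: "finite_order 3 (prol \<phi> 0)" by (rule finite_order_prol) auto
  have Dx0: "Dx (prol \<phi> 0) p = pd 0 (prol \<phi> 0) p + (\<Sum>k<2. p (Suc (Suc k)) * pd (Suc k) (prol \<phi> 0) p)" for p
    by (subst Dx_finite_order[OF fo]) (simp_all add: eval_nat_numeral jet_dir_def del: prol.simps)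
  have "(\<exists>c K. \<forall>i. pullback (prolong \<phi>) (hdx F) p i - (\<alpha> * hdx G p i + hdx H p i) = (\<Sum>k<K. c k * theta k p i))
    \<longleftrightarrow> F (prolong \<phi> p) * Dx (prol \<phi> 0) p = \<alpha> * G p + H p" (is "?L \<longleftrightarrow> ?R") for p
  proof
    assume ?L
    then obtain c K where cK: "\<And>i. F (prolong \<phi> p) * pd i (prol \<phi> 0) p - (\<alpha> * hdx G p i + hdx H p i) = (\<Sum>k<K. c k * theta k p i)"
      unfolding pb by blast
    have ck: "F (prolong \<phi> p) * pd (Suc k) (prol \<phi> 0) p = (if k < K then c k else 0)" for k
      using cK[of "Suc k"] unfolding theta by (simp add: hdx_def del: prol.simps)
    \<comment> \<open>\<open>K\<close> is arbitrary while \<open>prol \<phi> 0\<close> involves only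
      \<open>y_0\<close> and \<open>y_1\<close> besides \<open>x\<close>; both sums are compared
      inside \<open>max K 2\<close>, where the extra terms are zero.\<close>
    have "(\<Sum>k<K. c k * p (Suc (Suc k))) = (\<Sum>k<max K 2. F (prolong \<phi> p) * pd (Suc k) (prol \<phi> 0) p * p (Suc (Suc k)))"
      unfolding ck by (rule sum.mono_neutral_cong_left) auto
    also have "\<dots> = (\<Sum>k<2. F (prolong \<phi> p) * pd (Suc k) (prol \<phi> 0) p * p (Suc (Suc k)))"
      by (rule sum.mono_neutral_right) (auto simp: pd_finite_order[OF fo] simp del: prol.simps)
    finally have "(\<Sum>k<K. c k * p (Suc (Suc k))) = F (prolong \<phi> p) * (\<Sum>k<2. p (Suc (Suc k)) * pd (Suc k) (prol \<phi> 0) p)"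
      by (simp add: sum_distrib_left mult_ac del: prol.simps)
    moreover have "F (prolong \<phi> p) * pd 0 (prol \<phi> 0) p - (\<alpha> * G p + H p) = - (\<Sum>k<K. c k * p (Suc (Suc k)))"
      using cK[of 0] unfolding theta by (simp add: hdx_def del: prol.simps)
    ultimately show ?R unfolding Dx0 by (simp add: algebra_simps del: prol.simps)
  next
    assume R: ?R
    show ?L
    proof (intro exI allI)
      fix i
      let ?c = "\<lambda>k. F (prolong \<phi> p) * pd (Suc k) (prol \<phi> 0) p"
      show "pullback (prolong \<phi>) (hdx F) p i - (\<alpha> * hdx G p i + hdx H p i) = (\<Sum>k<2. ?c k * theta k p i)"
      proof (cases i)
        case 0
        then show ?thesis using R unfolding theta pb Dx0
          by (simp add: hdx_def sum_distrib_left algebra_simps del: prol.simps)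
      next
        case (Suc l)
        then show ?thesis unfolding theta pb
          using pd_finite_order[OF fo, of i] by (auto simp: hdx_def simp del: prol.simps)
      qed
    qed
  qed
  then show ?thesis unfolding eq_mod_contact_def by blast
qed

section \<open>From Lagrangians to distributions\<close>

declare prol.simps [simp del]

text \<open>The coordinates from \<open>k\<close> on are frozen at \<open>p\<close>. This is a
  section of the truncation: it reads a function on a larger space, such as J^infinity, on the first
  \<open>k\<close> coordinates.\<close>

definition splice :: "nat \<Rightarrow> (nat \<Rightarrow> real) \<Rightarrow> (nat \<Rightarrow> real) \<Rightarrow> nat \<Rightarrow> real" where
  "splice k p q = (\<lambda>i. if i < k then q i else p i)"

lemma pd_splice: "pd i (\<lambda>q. F (splice k p q)) q = (if i < k then pd i F (splice k p q) else 0)"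
proof (cases "i < k")
  case True
  then have "splice k p (q(i := t)) = (splice k p q)(i := t)" for t by (auto simp: splice_def fun_eq_iff)
  with True show ?thesis by (simp add: pd_def splice_def)
next
  case False
  then have "splice k p (q(i := t)) = splice k p q" for t by (auto simp: splice_def fun_eq_iff)
  with False show ?thesis by (simp add: pd_def)
qed

lemma continuous_on_splice: "continuous_on S (splice k p)"
proof (rule continuous_on_coordinatewise_then_product)
  fix i show "continuous_on S (\<lambda>q. splice k p q i)"
    by (cases "i < k") (auto simp: splice_def intro: continuous_on_subset[OF continuous_on_product_coordinates])
qed

text \<open>The zero function belongs to the class because derivatives in frozen directions vanish.
  \<open>I\<close> and \<open>J\<close> are not tied to each other, so smoothness passes between R^m
  and J^infinity both ways.\<close>

lemma smooth_in_splice: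
  assumes S: "coord_open I S" and F: "smooth_in J W F" "{..<k} \<subseteq> J" and W: "\<And>q. q \<in> S \<Longrightarrow> splice k p q \<in> W"
  shows "smooth_in I S (\<lambda>q. F (splice k p q))"
proof (rule smooth_in_coinduct[OF S, where P = "\<lambda>G. (\<exists>F. smooth_in J W F \<and> G = (\<lambda>q. F (splice k p q))) \<or> G = (\<lambda>_. 0)"])
  fix G assume "(\<exists>F. smooth_in J W F \<and> G = (\<lambda>q. F (splice k p q))) \<or> G = (\<lambda>_. 0)"
  then show "continuous_on S G \<and> (\<forall>j\<in>I. \<forall>q\<in>S. (\<lambda>t. G (q(j := t))) differentiable at (q j)) \<and>
    (\<forall>j\<in>I. \<exists>H. ((\<exists>F. smooth_in J W F \<and> H = (\<lambda>q. F (splice k p q))) \<or> H = (\<lambda>_. 0)) \<and> (\<forall>q\<in>S. pd j G q = H q))"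
  proof
    assume "\<exists>F. smooth_in J W F \<and> G = (\<lambda>q. F (splice k p q))"
    then obtain F where F: "smooth_in J W F" and G: "G = (\<lambda>q. F (splice k p q))" by blast
    have "continuous_on S G"
      unfolding G by (rule continuous_on_compose2[OF smooth_in_continuous[OF F] continuous_on_splice]) (use W in auto)
    moreover have "(\<lambda>t. G (q(j := t))) differentiable at (q j)" if q: "q \<in> S" for q j
    proof (cases "j < k")
      case True
      have "splice k p (q(j := t)) = (splice k p q)(j := t)" for t
        using True by (auto simp: splice_def fun_eq_iff)
      moreover have "splice k p q j = q j" using True by (simp add: splice_def)
      ultimately show ?thesis using smooth_in_has_pd[OF F W[OF q], of j] True assms(3)
        unfolding G real_differentiable_def by auto
    next
      case False
      then have "splice k p (q(j := t)) = splice k p q" for t by (auto simp: splice_def fun_eq_iff)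
      then show ?thesis unfolding G by simp
    qed
    moreover have "\<exists>H. ((\<exists>F. smooth_in J W F \<and> H = (\<lambda>q. F (splice k p q))) \<or> H = (\<lambda>_. 0)) \<and> (\<forall>q\<in>S. pd j G q = H q)" for j
    proof (cases "j < k")
      case True
      then have "smooth_in J W (pd j F)" by (intro smooth_in_pd[OF F]) (use assms(3) in auto)
      then show ?thesis unfolding G pd_splice using True by auto
    next
      case False
      then show ?thesis unfolding G pd_splice by auto
    qed
    ultimately show ?thesis by blast
  next
    assume "G = (\<lambda>_. 0)" then show ?thesis by (auto simp: pd_const)
  qed
qed (use F in blast)

text \<open>The variable following the highest one in mu occurs linearly in Dx mu, with the highest
  partial derivative of mu as its coefficient.\<close>

lemma pd_zero_of_Dx:
  assumes W: "open W" and \<mu>: "smooth_in UNIV W \<mu>" and fin: "\<forall>p\<in>W. \<forall>q\<in>W. (\<forall>i<N. p i = q i) \<longrightarrow> \<mu> p = \<mu> q"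
    and D: "\<And>p. p \<in> W \<Longrightarrow> Dx \<mu> p = H p" and H: "finite_order (Suc K) H" and K: "1 \<le> K"
    and k: "K \<le> k" and p: "p \<in> W"
  shows "pd k \<mu> p = 0"
proof -
  have op: "coord_open UNIV W" by (rule coord_open_open[OF W])
  \<comment> \<open>Descending induction on \<open>k\<close>, with \<open>d\<close> bounding
    \<open>N - k\<close>; at \<open>d = 0\<close> the hypothesis \<open>fin\<close> makes
    \<open>\<mu>\<close> locally constant in direction \<open>k\<close>.\<close>
  have "\<forall>k p. K \<le> k \<longrightarrow> N \<le> k + d \<longrightarrow> p \<in> W \<longrightarrow> pd k \<mu> p = 0" for d
  proof (induction d)
    case 0
    have "pd k \<mu> p = 0" if "N \<le> k" "p \<in> W" for k p
    proof -
      have ev: "\<forall>\<^sub>F t in nhds (p k). \<mu> (p(k := t)) = \<mu> p"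
        using eventually_coord[OF op that(2) UNIV_I]
      proof (rule eventually_mono)
        show "\<mu> (p(k := t)) = \<mu> p" if "p(k := t) \<in> W" for t
          by (rule fin[rule_format, OF that \<open>p \<in> W\<close>]) (use \<open>N \<le> k\<close> in simp)
      qed
      have "deriv (\<lambda>t. \<mu> (p(k := t))) (p k) = deriv (\<lambda>t. \<mu> p) (p k)"
        by (rule deriv_cong_ev[OF ev refl])
      then show ?thesis by (simp add: pd_def)
    qed
    then show ?case by simp
  next
    case (Suc d)
    show ?case
    proof (intro allI impI)
      fix k p assume k: "K \<le> k" "N \<le> k + Suc d" and p: "p \<in> W"
      have z: "pd i \<mu> q = 0" if "Suc k \<le> i" "q \<in> W" for i q
        using Suc k that by auto
      have sm: "smooth_in UNIV W (\<lambda>p. jet_dir p i)" for i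
        by (cases "i = 0") (auto simp: jet_dir_def intro: smooth_in_const smooth_in_coord op)
      have H_eq: "H q = (\<Sum>i<Suc k. jet_dir q i * pd i \<mu> q)" if "q \<in> W" for q
        using D[OF that] Dx_finite[of "Suc k" \<mu> q] z[OF _ that] by simp
      \<comment> \<open>\<open>H\<close> does not involve coordinate \<open>k + 1\<close>. In the
        sum for \<open>Dx \<mu>\<close> that coordinate enters explicitly only through
        \<open>jet_dir q k\<close>, and the mixed derivatives vanish by the induction
        hypothesis.\<close>
      have "0 = pd (Suc k) H p" using pd_finite_order[OF H] k by simp
      also have "\<dots> = pd (Suc k) (\<lambda>q. \<Sum>i<Suc k. jet_dir q i * pd i \<mu> q) p"
        by (rule pd_cong[OF op p]) (auto simp: H_eq simp del: sum.lessThan_Suc)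
      also have "\<dots> = (\<Sum>i<Suc k. pd (Suc k) (\<lambda>q. jet_dir q i * pd i \<mu> q) p)"
        by (rule pd_sum[OF op _ p]) (auto intro!: smooth_in_mult[OF op] sm smooth_in_pd \<mu>)
      also have "\<dots> = (\<Sum>i<Suc k. if i = k then pd k \<mu> p else 0)"
      proof (intro sum.cong refl)
        fix i assume i: "i \<in> {..<Suc k}"
        have "pd (Suc k) (\<lambda>q. jet_dir q i * pd i \<mu> q) p
          = pd (Suc k) (\<lambda>q. jet_dir q i) p * pd i \<mu> p + jet_dir p i * pd (Suc k) (pd i \<mu>) p"
          by (rule pd_mult[OF op sm smooth_in_pd[OF \<mu>] p]) auto
        also have "pd (Suc k) (pd i \<mu>) p = pd i (pd (Suc k) \<mu>) p"
          by (rule pd_commute[OF \<mu> op p]) auto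
        also have "\<dots> = pd i (\<lambda>_. 0) p"
          by (rule pd_cong[OF op p]) (auto simp: z)
        also have "\<dots> = 0" by (rule pd_const)
        also have "pd (Suc k) (\<lambda>q. jet_dir q i) p = (if i = k then 1 else 0)"
          using K k i by (cases "i = 0") (auto simp: jet_dir_def pd_const pd_coord)
        finally show "pd (Suc k) (\<lambda>q. jet_dir q i * pd i \<mu> q) p = (if i = k then pd k \<mu> p else 0)" by simp
      qed
      also have "\<dots> = pd k \<mu> p" by simp
      finally show "pd k \<mu> p = 0" by simp
    qed
  qed
  from this[of N] show ?thesis using k p by simp
qed

definition cube :: "nat \<Rightarrow> (nat \<Rightarrow> real) \<Rightarrow> real \<Rightarrow> (nat \<Rightarrow> real) set" where
  "cube N p e = {q \<in> Rn N. \<forall>i<N. \<bar>q i - p i\<bar> < e}"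

lemma openin_cube: "openin (top_of_set (Rn N)) (cube N p e)"
proof -
  have "open {q::nat \<Rightarrow> real. \<bar>q i - p i\<bar> < e}" for i
    by (intro open_Collect_less continuous_intros continuous_on_subset[OF continuous_on_product_coordinates]) auto
  then have "open (\<Inter>i\<in>{..<N}. {q::nat \<Rightarrow> real. \<bar>q i - p i\<bar> < e})" by auto
  moreover have "cube N p e = Rn N \<inter> (\<Inter>i\<in>{..<N}. {q::nat \<Rightarrow> real. \<bar>q i - p i\<bar> < e})"
    by (auto simp: cube_def)
  ultimately show ?thesis by (auto simp: openin_open)
qed

text \<open>The map is triangular with respect to the two pairs of generators, with nonzero diagonal
  entries \<open>x\<close> and \<open>w\<close>.\<close>

lemma span2_image:
  assumes lin: "\<And>a b. dmap m \<psi> q (\<lambda>i. a * u i + b * v i) = (\<lambda>i. a * dmap m \<psi> q u i + b * dmap m \<psi> q v i)"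
    and u: "dmap m \<psi> q u = (\<lambda>i. x * u' i + y * v' i)" and v: "dmap m \<psi> q v = (\<lambda>i. w * v' i)"
    and nz: "x \<noteq> 0" "w \<noteq> 0"
  shows "dmap m \<psi> q ` span2 u v = span2 u' v'"
proof
  have L: "dmap m \<psi> q (\<lambda>i. a * u i + b * v i) = (\<lambda>i. (a * x) * u' i + (a * y + b * w) * v' i)" for a b
    unfolding lin u v by (auto simp: algebra_simps)
  then show "dmap m \<psi> q ` span2 u v \<subseteq> span2 u' v'" unfolding span2_def by auto
  show "span2 u' v' \<subseteq> dmap m \<psi> q ` span2 u v"
  proof
    fix z assume "z \<in> span2 u' v'"
    then obtain a b where z: "z = (\<lambda>i. a * u' i + b * v' i)" by (auto simp: span2_def)
    have "z = dmap m \<psi> q (\<lambda>i. (a / x) * u i + ((b - a / x * y) / w) * v i)"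
      unfolding L z using nz by (auto simp: field_simps)
    then show "z \<in> dmap m \<psi> q ` span2 u v" unfolding span2_def by blast
  qed
qed

lemma dmap_linear: "dmap m \<psi> q (\<lambda>i. a * u i + b * v i) = (\<lambda>i. a * dmap m \<psi> q u i + b * dmap m \<psi> q v i)"
  by (auto simp: dmap_def fun_eq_iff sum.distrib sum_distrib_left algebra_simps)

text \<open>\<open>\<mu>\<close> and \<open>W\<close> live on J^infinity, but the diffeomorphism
  acts on finitely many coordinates. Freezing all coordinates beyond those of J^n at a base point
  turns \<open>\<mu>\<close> into a function \<open>\<nu>\<close> on a cube; by the order bound on
  \<open>\<mu>\<close> nothing of \<open>Dx \<mu>\<close> is lost.\<close>

lemma distr_equiv_of_lagr_equiv:
  assumes lagr: "lagr_loc_equiv n O1 f1 O2 f2" and n: "n \<ge> 2"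
  shows "distr_loc_equiv n O1 f1 O2 f2"
proof -
  obtain W U V \<phi> \<alpha> \<mu> N' where W: "open W" "W \<noteq> {}" and c: "contact_transf U V \<phi>" and WU: "tr 3 ` W \<subseteq> U"
    and DX: "\<And>p. p \<in> W \<Longrightarrow> Dx (prol \<phi> 0) p \<noteq> 0"
    and WO1: "\<And>p. p \<in> W \<Longrightarrow> tr (n + 2) p \<in> O1" and WO2: "\<And>p. p \<in> W \<Longrightarrow> tr (n + 2) (prolong \<phi> p) \<in> O2"
    and \<alpha>: "\<alpha> \<noteq> 0" and \<mu>: "smooth_in UNIV W \<mu>" and fin: "\<forall>p\<in>W. \<forall>q\<in>W. (\<forall>i<N'. p i = q i) \<longrightarrow> \<mu> p = \<mu> q"
    and eq: "eq_mod_contact W (pullback (prolong \<phi>) (hdx (\<lambda>p. f2 (tr (n + 2) p))))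
          (\<lambda>p i. \<alpha> * hdx (\<lambda>p. f1 (tr (n + 2) p)) p i + hdx (Dx \<mu>) p i)"
    using lagr unfolding lagr_loc_equiv_def by (elim exE conjE) blast
  \<comment> \<open>The number of coordinates of J^n, and therefore also the index of
    \<open>z\<close>.\<close>
  define N where "N = n + 2"
  have N: "4 \<le> N" using n by (simp add: N_def)
  note c' = contact_transf_inverse[OF c]
  note CD = diffeoD[OF contact_diffeo[OF c]]
  let ?\<phi>' = "inv_into U \<phi>"
  define P where "P q = tr N (prolong \<phi> q)" for q
  define P' where "P' q = tr N (prolong ?\<phi>' q)" for q
  have Pnth: "P q j = (if j < N then prol \<phi> j q else 0)" "P' q j = (if j < N then prol ?\<phi>' j q else 0)" for q j
    by (simp_all add: P_def P'_def tr_def prolong_def)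
  have PtrN: "P (tr N q) = P q" "P' (tr N q) = P' q" for q
    using N prol_tr[of N] by (auto simp: Pnth fun_eq_iff)
  have E: "f2 (P p) * Dx (prol \<phi> 0) p = \<alpha> * f1 (tr N p) + Dx \<mu> p" if "p \<in> W" for p
    using eq that unfolding eq_mod_contact_hdx P_def N_def by blast
  define H where "H p = f2 (P p) * Dx (prol \<phi> 0) p - \<alpha> * f1 (tr N p)" for p
  have fo0: "finite_order N (Dx (prol \<phi> 0))"
    by (rule finite_order_Dx[OF finite_order_prol, of 3]) (use N in auto)
  have "finite_order N H"
    using fo0 by (simp add: finite_order_def H_def PtrN tr_tr)
  then have \<mu>0: "pd k \<mu> p = 0" if "n + 1 \<le> k" "p \<in> W" for k p
    by (intro pd_zero_of_Dx[OF W(1) \<mu> fin, of H "n + 1"]) (use that E in \<open>auto simp: H_def N_def\<close>)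
  obtain p0 where p0: "p0 \<in> W" using W by auto
  obtain e where e: "e > 0"
    "\<And>q. (\<And>i. i \<in> {..<N} \<Longrightarrow> \<bar>q i - p0 i\<bar> < e) \<Longrightarrow> (\<And>i. i \<notin> {..<N} \<Longrightarrow> q i = p0 i) \<Longrightarrow> q \<in> W"
    using coord_openD[OF coord_open_open[OF W(1)] p0, of "{..<N}" UNIV] by blast
  define B where "B = cube N p0 e"
  define s where "s = splice N p0"
  have sW: "s q \<in> W" if "tr N q \<in> B" for q
    by (rule e(2)) (use that in \<open>auto simp: B_def cube_def s_def splice_def tr_def\<close>)
  have trs: "tr N (s q) = tr N q" for q by (auto simp: s_def splice_def tr_def)
  have prol_s: "prol \<phi> j (s q) = prol \<phi> j q" if "j < N" for j q
    using prol_tr[of N j \<phi> q] prol_tr[of N j \<phi> "s q"] N that unfolding trs by simp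
  have Ps: "P (s q) = P q" for q by (auto simp: Pnth prol_s)
  have DX0_s: "Dx (prol \<phi> 0) (s q) = Dx (prol \<phi> 0) q" for q
    using fo0 unfolding finite_order_def by (metis trs)
  have Bdom: "B \<subseteq> jet_dom N U \<phi>"
  proof
    fix q assume q: "q \<in> B"
    then have R: "q \<in> Rn N" by (simp add: B_def cube_def)
    then have w: "s q \<in> W" using sW[of q] q tr_id by metis
    have "tr 3 (s q) = tr 3 q" using N by (auto simp: s_def splice_def tr_def)
    then have "tr 3 q \<in> U" using WU w by (metis image_subset_iff)
    then show "q \<in> jet_dom N U \<phi>" using R DX[OF w] by (simp add: jet_dom_def DX0_s)
  qed
  define m where "m = n + 3"
  define \<nu> where "\<nu> q = \<mu> (s q)" for q
  have \<nu>_tr: "\<nu> q = \<nu> q'" if "tr N q = tr N q'" for q q'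
  proof -
    have "q i = q' i" if "i < N" for i using fun_cong[OF \<open>tr N q = tr N q'\<close>, of i] that by (simp add: tr_def)
    then have "s q = s q'" by (auto simp: s_def splice_def)
    then show ?thesis by (simp add: \<nu>_def)
  qed
  define \<psi> where "\<psi> q j = (if j < N then prol \<phi> j q else if j = N then \<alpha> * q N + \<nu> q else 0)" for q j
  \<comment> \<open>The explicit inverse: undo the prolongation, then solve
    \<open>\<alpha> z + \<nu> = r N\<close> for \<open>z\<close>.\<close>
  define \<xi> where "\<xi> r j = (if j < N then prol ?\<phi>' j r else if j = N then (r N - \<nu> (P' r)) / \<alpha> else 0)" for r j
  define X where "X = {q \<in> Rn m. tr N q \<in> B}"
  \<comment> \<open>The image of \<open>X\<close>, described through the inverse so that openness
    follows from continuity of \<open>P'\<close>.\<close>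
  define Y where "Y = {r \<in> jet_dom m V ?\<phi>'. P' r \<in> B}"
  have Nm: "N < m" "m = Suc N" by (simp_all add: m_def N_def)
  have jet_tr: "tr N q \<in> jet_dom N U \<phi> \<longleftrightarrow> tr 3 q \<in> U \<and> Dx (prol \<phi> 0) q \<noteq> 0" for q
    using N fo0 by (simp add: jet_dom_def tr_in_Rn tr_tr finite_order_def)
  have fo0': "finite_order N (Dx (prol ?\<phi>' 0))"
    by (rule finite_order_Dx[OF finite_order_prol, of 3]) (use N in auto)
  have jet_tr': "tr N q \<in> jet_dom N V ?\<phi>' \<longleftrightarrow> tr 3 q \<in> V \<and> Dx (prol ?\<phi>' 0) q \<noteq> 0" for q
    using N fo0' by (simp add: jet_dom_def tr_in_Rn tr_tr finite_order_def)
  have tr\<psi>: "tr N (\<psi> q) = P q" and tr\<xi>: "tr N (\<xi> q) = P' q" for q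
    by (auto simp: tr_def \<psi>_def \<xi>_def Pnth)
  have oX: "openin (top_of_set (Rn m)) X"
    unfolding X_def B_def by (rule openin_tr_vimage[OF openin_cube])
  have oJ: "openin (top_of_set (Rn m)) (jet_dom m V ?\<phi>')"
    by (rule openin_contact_jet_dom[OF c']) (use N Nm in simp)
  have J_smooth: "smooth_in {..<m} (jet_dom m V ?\<phi>') (prol ?\<phi>' j)" if "j < m" for j
    by (rule prol_smooth_jet_dom[OF c']) (use N Nm that in simp_all)
  have oY: "openin (top_of_set (Rn m)) Y"
  proof -
    have "continuous_on (jet_dom m V ?\<phi>') P'"
    proof (rule continuous_on_coordinatewise_then_product)
      fix i show "continuous_on (jet_dom m V ?\<phi>') (\<lambda>q. P' q i)"
        by (cases "i < N") (use smooth_in_continuous[OF J_smooth, of i] Nm(1) in \<open>auto simp: Pnth\<close>)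
    qed
    then have "openin (top_of_set (jet_dom m V ?\<phi>')) (jet_dom m V ?\<phi>' \<inter> P' -` B)"
      by (rule continuous_openin_preimage[OF _ _ openin_cube[of N p0 e, folded B_def]]) (auto simp: P'_def tr_in_Rn)
    moreover have "jet_dom m V ?\<phi>' \<inter> P' -` B = Y" by (auto simp: Y_def)
    ultimately show ?thesis using openin_trans oJ by metis
  qed
  note copX = coord_open_Rn[OF oX] and copY = coord_open_Rn[OF oY]
  have Xdom: "tr 3 q \<in> U" "Dx (prol \<phi> 0) q \<noteq> 0" "tr N q \<in> jet_dom N U \<phi>" "s q \<in> W" if "q \<in> X" for q
    using that Bdom jet_tr[of q] sW[of q] by (auto simp: X_def)
  have prolX: "smooth_in {..<m} X (prol \<phi> j)" if "j < N" for j
    by (rule prol_smooth[OF CD(1,3) copX, of N]) (use N Nm that Xdom in auto)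
  have \<nu>X: "smooth_in {..<m} X \<nu>"
    unfolding \<nu>_def s_def by (rule smooth_in_splice[OF copX \<mu>]) (use Xdom s_def in auto)
  have \<psi>_smooth: "smooth_map m X \<psi>"
    unfolding smooth_map_def
  proof (intro conjI ballI allI impI)
    show "\<psi> q \<in> Rn m" for q by (simp add: Rn_def \<psi>_def Nm)
    fix j assume "j < m"
    then consider "j < N" | "j = N" using Nm by linarith
    then show "smooth_in {..<m} X (\<lambda>q. \<psi> q j)"
      by cases (auto simp: \<psi>_def intro!: prolX \<nu>X smooth_in_add smooth_in_mult smooth_in_coord smooth_in_const copX)
  qed
  have \<nu>B: "smooth_in {..<N} B \<nu>"
    unfolding \<nu>_def s_def
    by (rule smooth_in_splice[OF coord_open_Rn[OF openin_cube[of N p0 e, folded B_def]] \<mu>])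
      (use sW tr_id in \<open>auto simp: s_def[symmetric] B_def cube_def\<close>)
  have \<xi>_smooth: "smooth_map m Y \<xi>"
    unfolding smooth_map_def
  proof (intro conjI ballI allI impI)
    show "\<xi> q \<in> Rn m" for q by (simp add: Rn_def \<xi>_def Nm)
    have JY: "smooth_in {..<m} Y (prol ?\<phi>' j)" if "j < N" for j
      by (rule smooth_in_subset[OF J_smooth]) (use that Nm in \<open>auto simp: Y_def\<close>)
    have "smooth_in {..<m} Y (\<lambda>r. \<nu> (P' r))"
      by (rule smooth_in_comp[OF copY openin_cube[of N p0 e, folded B_def] \<nu>B]) (use JY in \<open>auto simp: Y_def Pnth\<close>)
    then have last: "smooth_in {..<m} Y (\<lambda>r. (r N - \<nu> (P' r)) / \<alpha>)"
      by (intro smooth_in_divide smooth_in_diff smooth_in_coord smooth_in_const copY \<alpha>)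
    fix j assume "j < m"
    then consider "j < N" | "j = N" using Nm by linarith
    then show "smooth_in {..<m} Y (\<lambda>q. \<xi> q j)"
      by cases (use JY last in \<open>auto simp: \<xi>_def\<close>)
  qed
  have P'P: "P' (P q) = tr N q" if "q \<in> X" for q
    using prolong_inverse[OF c N c' CD(7) Xdom(3)[OF that]] unfolding P_def[symmetric] P'_def[symmetric] PtrN .
  have PP': "P (P' r) = tr N r" if "r \<in> Y" for r
  proof -
    have "tr N r \<in> jet_dom N V ?\<phi>'" using that jet_tr' by (auto simp: Y_def jet_dom_def)
    from prolong_inverse[OF c' N c CD(8) this] show ?thesis
      unfolding P'_def[symmetric] P_def[symmetric] PtrN .
  qed
  have Rn: "\<psi> q \<in> Rn m" "\<xi> q \<in> Rn m" for q by (simp_all add: Rn_def \<psi>_def \<xi>_def Nm)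
  have P'\<psi>: "P' (\<psi> q) = tr N q" if "q \<in> X" for q
    using P'P[OF that] PtrN(2)[of "\<psi> q"] by (simp add: tr\<psi>)
  have P\<xi>: "P (\<xi> r) = tr N r" if "r \<in> Y" for r
    using PP'[OF that] PtrN(1)[of "\<xi> r"] by (simp add: tr\<xi>)
  have \<psi>Y: "\<psi> q \<in> Y" if q: "q \<in> X" for q
  proof -
    have "P q \<in> jet_dom N V ?\<phi>'"
      using prolong_maps_jet_dom(2)[OF c N c' CD(7) Xdom(3)[OF q]] unfolding P_def[symmetric] PtrN .
    then have "\<psi> q \<in> jet_dom m V ?\<phi>'"
      using jet_tr'[of "\<psi> q"] Rn(1) unfolding tr\<psi> by (simp add: jet_dom_def)
    then show ?thesis using P'\<psi>[OF q] q by (simp add: Y_def X_def)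
  qed
  have \<xi>X: "\<xi> r \<in> X" if "r \<in> Y" for r
    using that Rn(2) by (simp add: X_def Y_def tr\<xi>)
  have \<nu>eq: "\<nu> (tr N q) = \<nu> q" for q by (rule \<nu>_tr) (simp add: tr_tr)
  have RnD: "q j = 0" if "q \<in> Rn m" "N < j" for q j using that Nm by (simp add: Rn_def)
  have \<xi>\<psi>: "\<xi> (\<psi> q) = q" if q: "q \<in> X" for q
  proof
    fix j
    have "q \<in> Rn m" using q by (simp add: X_def)
    consider "j < N" | "j = N" | "N < j" by linarith
    then show "\<xi> (\<psi> q) j = q j"
    proof cases
      case 1
      then have "\<xi> (\<psi> q) j = P' (\<psi> q) j" by (simp add: \<xi>_def Pnth)
      then show ?thesis using 1 by (simp add: P'\<psi>[OF q] tr_nth)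
    next
      case 2
      then show ?thesis using \<alpha> by (simp add: \<xi>_def P'\<psi>[OF q] \<nu>eq) (simp add: \<psi>_def)
    next
      case 3
      then show ?thesis using RnD[OF \<open>q \<in> Rn m\<close>] RnD[OF Rn(2)] by simp
    qed
  qed
  have \<psi>\<xi>: "\<psi> (\<xi> r) = r" if r: "r \<in> Y" for r
  proof
    fix j
    have "r \<in> Rn m" using r by (simp add: Y_def jet_dom_def)
    consider "j < N" | "j = N" | "N < j" by linarith
    then show "\<psi> (\<xi> r) j = r j"
    proof cases
      case 1
      then have "\<psi> (\<xi> r) j = P (\<xi> r) j" by (simp add: \<psi>_def Pnth)
      then show ?thesis using 1 by (simp add: P\<xi>[OF r] tr_nth)
    next
      case 2
      have "\<nu> (\<xi> r) = \<nu> (P' r)" using \<nu>eq[of "\<xi> r"] by (simp add: tr\<xi>)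
      then show ?thesis using 2 \<alpha> by (simp add: \<psi>_def) (simp add: \<xi>_def)
    next
      case 3
      then show ?thesis using RnD[OF \<open>r \<in> Rn m\<close>] RnD[OF Rn(1)] by simp
    qed
  qed
  have diff: "diffeo m X Y \<psi>"
    by (rule diffeoI[OF oX oY \<psi>_smooth \<xi>_smooth \<psi>Y \<xi>X \<xi>\<psi> \<psi>\<xi>])
  have "tr N p0 \<in> X"
    using e(1) Nm by (simp add: X_def tr_in_Rn tr_tr B_def cube_def) (simp add: tr_def)
  then have ne: "X \<noteq> {}" by blast
  have O1: "tr (n + 2) q \<in> O1" if "q \<in> X" for q
    using WO1[OF Xdom(4)[OF that]] trs[of q] by (simp add: N_def)
  have O2: "tr (n + 2) r \<in> O2" if r: "r \<in> Y" for r
    using WO2[OF Xdom(4)[OF \<xi>X[OF r]]] P\<xi>[OF r] Ps[of "\<xi> r"] by (simp add: P_def N_def)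
  have span: "dmap m \<psi> q ` span2 (Xfield n f1 q) (Yfield n q) = span2 (Xfield n f2 (\<psi> q)) (Yfield n (\<psi> q))"
    if q: "q \<in> X" for q
  proof -
    have \<psi>low: "(\<lambda>q. \<psi> q j) = prol \<phi> j" if "j < N" for j using that by (simp add: \<psi>_def)
    have \<psi>N: "pd i (\<lambda>q. \<psi> q N) q = (if i = N then \<alpha> else if i \<le> n then pd i \<mu> (s q) else 0)" if "i < m" for i
    proof -
      have "pd i (\<lambda>q. \<psi> q N) q = pd i (\<lambda>q. \<alpha> * q N + \<nu> q) q" by (simp add: \<psi>_def)
      also have "\<dots> = pd i (\<lambda>q. \<alpha> * q N) q + pd i \<nu> q"
        by (rule pd_add[OF copX _ \<nu>X q]) (use that in \<open>auto intro!: smooth_in_mult smooth_in_coord smooth_in_const copX\<close>)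
      also have "pd i (\<lambda>q. \<alpha> * q N) q = \<alpha> * (if i = N then 1 else 0)"
        using pd_mult[OF copX smooth_in_const[OF copX, of \<alpha>] smooth_in_coord[OF copX, of N] q, of i] that
        by (simp add: pd_const pd_coord)
      also have "pd i \<nu> q = (if i < N then pd i \<mu> (s q) else 0)"
        unfolding \<nu>_def s_def by (rule pd_splice)
      finally show ?thesis using \<mu>0[OF _ Xdom(4)[OF q], of i] by (auto simp: N_def)
    qed
    have fo: "finite_order (n + 1) (prol \<phi> j)" if "j \<le> n" for j
      by (rule finite_order_prol) (use that n in auto)
    define x where "x = Dx (prol \<phi> 0) q"
    \<comment> \<open>The \<open>y_n\<close> component needs no formula, as it is absorbed by the
      multiple of \<open>Yfield\<close>.\<close>
    define y where "y = dmap m \<psi> q (Xfield n f1 q) (n + 1)"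
    define w where "w = pd (n + 1) (prol \<phi> (n + 1)) q"
    have jd: "Xfield n f1 q i = jet_dir q i" if "i < n + 1" for i
      using that by (auto simp: Xfield_def jet_dir_def)
    have dX: "dmap m \<psi> q (Xfield n f1 q) = (\<lambda>i. x * Xfield n f2 (\<psi> q) i + y * Yfield n (\<psi> q) i)"
    proof
      fix j
      consider "j \<le> n" | "j = n + 1" | "j = N" | "m \<le> j" using Nm N_def by linarith
      then show "dmap m \<psi> q (Xfield n f1 q) j = x * Xfield n f2 (\<psi> q) j + y * Yfield n (\<psi> q) j"
      proof cases
        case 1
        have "dmap m \<psi> q (Xfield n f1 q) j = (\<Sum>i<m. pd i (prol \<phi> j) q * Xfield n f1 q i)"
          using 1 by (simp add: dmap_def \<psi>low m_def N_def)
        also have "\<dots> = (\<Sum>i<n + 1. jet_dir q i * pd i (prol \<phi> j) q)"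
          by (rule sum.mono_neutral_cong_right) (auto simp: m_def pd_finite_order[OF fo[OF 1]] jd)
        also have "\<dots> = Dx (prol \<phi> j) q"
          by (rule Dx_finite_order[OF fo[OF 1], symmetric]) simp
        also have "\<dots> = x * Xfield n f2 (\<psi> q) j"
        proof (cases "j = 0")
          case False
          then have "Dx (prol \<phi> j) q = prol \<phi> (Suc j) q * x"
            unfolding x_def using Xdom[OF q] by (intro Dx_prol[OF c]) auto
          then show ?thesis using False 1 by (simp add: Xfield_def \<psi>_def N_def)
        qed (simp add: Xfield_def x_def)
        finally show ?thesis using 1 by (simp add: Yfield_def)
      next
        case 2
        then show ?thesis by (simp add: Xfield_def Yfield_def y_def)
      next
        case 3
        have "dmap m \<psi> q (Xfield n f1 q) j = (\<Sum>i<m. pd i (\<lambda>q. \<psi> q N) q * Xfield n f1 q i)"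
          using 3 Nm by (simp add: dmap_def)
        also have "\<dots> = (\<Sum>i<n + 1. jet_dir q i * pd i \<mu> (s q)) + \<alpha> * f1 (tr N q)"
        proof -
          have "{..<m} = insert N (insert (n + 1) {..<n + 1})" by (auto simp: m_def N_def)
          then have "(\<Sum>i<m. pd i (\<lambda>q. \<psi> q N) q * Xfield n f1 q i) =
             pd N (\<lambda>q. \<psi> q N) q * Xfield n f1 q N + pd (n + 1) (\<lambda>q. \<psi> q N) q * Xfield n f1 q (n + 1)
             + (\<Sum>i<n + 1. pd i (\<lambda>q. \<psi> q N) q * Xfield n f1 q i)"
            by (simp add: N_def del: sum.lessThan_Suc)
          also have "(\<Sum>i<n + 1. pd i (\<lambda>q. \<psi> q N) q * Xfield n f1 q i) = (\<Sum>i<n + 1. jet_dir q i * pd i \<mu> (s q))"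
            by (intro sum.cong refl) (use \<psi>N Nm in \<open>auto simp: jd N_def\<close>)
          finally show ?thesis using \<psi>N[of N] \<psi>N[of "n + 1"] Nm by (simp add: Xfield_def N_def)
        qed
        also have "(\<Sum>i<n + 1. jet_dir q i * pd i \<mu> (s q)) = Dx \<mu> (s q)"
        proof -
          have "Dx \<mu> (s q) = (\<Sum>i<n + 1. jet_dir (s q) i * pd i \<mu> (s q))"
            by (rule Dx_finite) (use \<mu>0 Xdom(4)[OF q] in auto)
          moreover have "jet_dir (s q) i = jet_dir q i" if "i < n + 1" for i
            using that by (simp add: jet_dir_def s_def splice_def N_def)
          ultimately show ?thesis by simp
        qed
        also have "Dx \<mu> (s q) + \<alpha> * f1 (tr N q) = f2 (P q) * x"
          using E[OF Xdom(4)[OF q]] by (simp add: Ps DX0_s trs x_def)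
        also have "P q = tr N (\<psi> q)" by (simp add: tr\<psi>)
        finally show ?thesis using 3 by (simp add: Xfield_def Yfield_def N_def)
      next
        case 4
        then show ?thesis by (simp add: dmap_def Xfield_def Yfield_def m_def)
      qed
    qed
    have dY_j: "pd (n + 1) (\<lambda>q. \<psi> q j) q = (if j = n + 1 then w else 0)" if "j < m" for j
    proof -
      consider "j \<le> n" | "j = n + 1" | "j = N" using \<open>j < m\<close> Nm N_def by linarith
      then show ?thesis
      proof cases
        case 1
        then show ?thesis using pd_finite_order[OF fo[OF 1], of "n + 1" q] by (simp add: \<psi>low N_def)
      next
        case 2
        then show ?thesis by (simp add: \<psi>low N_def w_def)
      next
        case 3
        then show ?thesis using \<psi>N[of "n + 1"] Nm by (simp add: N_def)
      qed
    qed
    have dY: "dmap m \<psi> q (Yfield n q) = (\<lambda>i. w * Yfield n (\<psi> q) i)"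
    proof
      fix j
      have "(\<Sum>i<m. pd i (\<lambda>q. \<psi> q j) q * Yfield n q i) = pd (n + 1) (\<lambda>q. \<psi> q j) q"
        by (simp add: Yfield_def m_def if_distrib cong: if_cong)
      then show "dmap m \<psi> q (Yfield n q) j = w * Yfield n (\<psi> q) j"
        using dY_j[of j] by (auto simp: dmap_def Yfield_def m_def)
    qed
    \<comment> \<open>Otherwise the \<open>y_n\<close> column of the Jacobian of a diffeomorphism
      would vanish.\<close>
    have "w \<noteq> 0"
    proof
      assume "w = 0"
      then have "pd (n + 1) (\<lambda>q. \<psi> q l) q = 0" if "l < m" for l using dY_j[OF that] by simp
      then have "(\<Sum>l<m. pd l (\<lambda>r. inv_into X \<psi> r (n + 1)) (\<psi> q) * pd (n + 1) (\<lambda>q. \<psi> q l) q) = 0"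
        by (intro sum.neutral) auto
      then show False using diffeo_jacobian[OF diff q, of "n + 1" "n + 1"] by (simp add: m_def)
    qed
    then show ?thesis
      using Xdom(2)[OF q] by (intro span2_image[OF dmap_linear dX dY]) (auto simp: x_def)
  qed
  show ?thesis unfolding distr_loc_equiv_def
    by (intro exI[of _ X] exI[of _ Y] exI[of _ \<psi>] conjI ballI ne diff[unfolded m_def] O1 O2 span[unfolded m_def])
qed

section \<open>From distributions to Lagrangians\<close>

lemma sum_delta_mult:
  fixes v :: "nat \<Rightarrow> real"
  shows "k < m \<Longrightarrow> (\<Sum>i<m. (if i = k then 1 else 0) * v i) = v k"
proof -
  assume "k < m"
  moreover have "(\<Sum>i<m. (if i = k then 1 else 0) * v i) = (\<Sum>i<m. if i = k then v i else 0)"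
    by (rule sum.cong) auto
  ultimately show ?thesis by simp
qed

text \<open>The data are symmetric in the two sides, so the inverse of \<open>\<psi>\<close> is an
  instance with the roles exchanged; one instance produces the contact transformation, the other its
  inverse.\<close>

locale distr_equiv =
  fixes n :: nat and O1 O2 :: "(nat \<Rightarrow> real) set" and f1 f2 :: "(nat \<Rightarrow> real) \<Rightarrow> real"
    and U V :: "(nat \<Rightarrow> real) set" and \<psi> :: "(nat \<Rightarrow> real) \<Rightarrow> nat \<Rightarrow> real"
  assumes n: "3 \<le> n"
    and O1: "openin (top_of_set (Rn (n + 2))) O1" and O2: "openin (top_of_set (Rn (n + 2))) O2"
    and f1: "smooth_in {..<n + 2} O1 f1" and f2: "smooth_in {..<n + 2} O2 f2"
    and f1'': "\<And>p. p \<in> O1 \<Longrightarrow> ipd [n + 1, n + 1] f1 p \<noteq> 0"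
    and f2'': "\<And>p. p \<in> O2 \<Longrightarrow> ipd [n + 1, n + 1] f2 p \<noteq> 0"
    and diff: "diffeo (n + 3) U V \<psi>"
    and UO1: "\<And>q. q \<in> U \<Longrightarrow> tr (n + 2) q \<in> O1" and VO2: "\<And>q. q \<in> V \<Longrightarrow> tr (n + 2) q \<in> O2"
    and span: "\<And>q. q \<in> U \<Longrightarrow> dmap (n + 3) \<psi> q ` span2 (Xfield n f1 q) (Yfield n q)
                 = span2 (Xfield n f2 (\<psi> q)) (Yfield n (\<psi> q))"
begin

lemmas D = diffeoD[OF diff]

abbreviation "c j \<equiv> (\<lambda>q. \<psi> q j)"
abbreviation "L \<equiv> vf_deriv (n + 3)"
definition g :: "(nat \<Rightarrow> real) \<Rightarrow> real" where "g q = f1 (tr (n + 2) q)"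
definition T :: "nat \<Rightarrow> (nat \<Rightarrow> real) \<Rightarrow> real" where "T i q = Xfield n f1 q i"

lemma op: "coord_open {..<n + 3} U" by (rule D(9))

lemma c_smooth: "j < n + 3 \<Longrightarrow> smooth_in {..<n + 3} U (c j)" by (rule D(13))

lemma g_smooth: "smooth_in {..<n + 3} U g"
  unfolding g_def
  by (rule smooth_in_comp[OF op O1 f1 UO1]) (auto simp: tr_def intro: smooth_in_coord[OF op])

lemma pd_g: "pd i g q = (if i < n + 2 then pd i f1 (tr (n + 2) q) else 0)"
proof (cases "i < n + 2")
  case True
  then show ?thesis unfolding g_def[abs_def] by (simp add: pd_tr_comp)
next
  case False
  have "finite_order (n + 2) g" by (simp add: finite_order_def g_def tr_tr)
  then show ?thesis using False by (simp add: pd_finite_order)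
qed

lemma g''_nonzero: "q \<in> U \<Longrightarrow> pd (n + 1) (pd (n + 1) g) q \<noteq> 0"
proof -
  assume q: "q \<in> U"
  have "pd (n + 1) g = (\<lambda>q. pd (n + 1) f1 (tr (n + 2) q))" by (auto simp: pd_g)
  then have "pd (n + 1) (pd (n + 1) g) q = pd (n + 1) (pd (n + 1) f1) (tr (n + 2) q)"
    by (simp add: pd_tr_comp)
  then show ?thesis using f1''[OF UO1[OF q]] by simp
qed

lemma T_eq: "T i = (if i = 0 then (\<lambda>_. 1) else if i \<le> n then (\<lambda>q. q (Suc i)) else if i = n + 2 then g else (\<lambda>_. 0))"
  by (auto simp: T_def Xfield_def g_def fun_eq_iff)

lemma T_smooth: "smooth_in {..<n + 3} U (T i)"
  using g_smooth by (simp add: T_eq smooth_in_const[OF op] smooth_in_coord[OF op])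

lemma pd_T: "pd k (T j) q = (if 1 \<le> j \<and> j \<le> n then (if k = Suc j then 1 else 0) else if j = n + 2 then pd k g q else 0)"
  by (simp add: T_eq pd_const pd_coord)

lemma LT_smooth: "smooth_in {..<n + 3} U F \<Longrightarrow> smooth_in {..<n + 3} U (L T F)"
  by (rule smooth_in_vf_deriv[OF op T_smooth])

text \<open>The coordinate field in direction \<open>k\<close>; in particular
  \<open>E (n + 1)\<close> is \<open>Yfield\<close>.\<close>

definition E :: "nat \<Rightarrow> nat \<Rightarrow> (nat \<Rightarrow> real) \<Rightarrow> real" where "E k i = (\<lambda>q. if i = k then 1 else 0)"

lemma L_E: "k < n + 3 \<Longrightarrow> L (E k) F q = pd k F q"
  unfolding vf_deriv_def E_def by (rule sum_delta_mult)

lemma E_smooth: "smooth_in {..<n + 3} U (E k i)"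
  unfolding E_def by (rule smooth_in_const[OF op])

lemma L_const: "L A (\<lambda>_. a) q = 0"
  by (simp add: vf_deriv_def pd_const)

lemma L_E_const: "L A (E k i) q = 0"
  by (simp add: E_def L_const)

lemma L_zero: "(\<And>q. q \<in> U \<Longrightarrow> F q = 0) \<Longrightarrow> q \<in> U \<Longrightarrow> L A F q = 0"
  using vf_deriv_cong[OF op, of q F "\<lambda>_. 0" A] by (simp add: L_const)

lemma pd_zero: "(\<And>q. q \<in> U \<Longrightarrow> F q = 0) \<Longrightarrow> q \<in> U \<Longrightarrow> i < n + 3 \<Longrightarrow> pd i F q = 0"
  using pd_cong[OF op, of q i F "\<lambda>_. 0"] by (simp add: pd_const)

text \<open>The functions \<open>pd k (T j)\<close> are the components of the bracket of
  \<open>E k\<close> with \<open>T\<close>, so that bracket is \<open>E (k - 1)\<close> plus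
  \<open>pd k g\<close> times \<open>E (n + 2)\<close>. The shift starts at \<open>k = 2\<close>
  because the components of \<open>T\<close> are 1, \<open>y_1\<close>, ..., \<open>y_n\<close>, 0,
  \<open>g\<close>, and \<open>y_1\<close> has index 2.\<close>

lemma sum_bracket_E_T:
  "k < n + 3 \<Longrightarrow> (\<Sum>j<n + 3. pd k (T j) q * v j) = (if 2 \<le> k \<and> k \<le> n + 1 then v (k - 1) else 0) + pd k g q * v (n + 2)"
proof -
  assume k: "k < n + 3"
  have "(\<Sum>j<n + 3. pd k (T j) q * v j)
    = (\<Sum>j<n + 3. (if j = k - 1 then (if 2 \<le> k \<and> k \<le> n + 1 then v j else 0) else 0) + (if j = n + 2 then pd k g q * v j else 0))"
    by (rule sum.cong) (auto simp: pd_T)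
  also have "\<dots> = (if 2 \<le> k \<and> k \<le> n + 1 then v (k - 1) else 0) + pd k g q * v (n + 2)"
    using k by (auto simp: sum.distrib)
  finally show ?thesis .
qed

text \<open>The commutator of \<open>E k\<close> and \<open>T\<close>, rearranged: derivatives of
  \<open>L T F\<close> reduce to derivatives of \<open>F\<close>, with the index lowered by one, and
  a \<open>z\<close> term.\<close>

lemma pd_LT:
  assumes F: "smooth_in {..<n + 3} U F" and q: "q \<in> U" and k: "k < n + 3"
  shows "pd k (L T F) q = L T (pd k F) q + (if 2 \<le> k \<and> k \<le> n + 1 then pd (k - 1) F q else 0) + pd k g q * pd (n + 2) F q"
proof -
  have e: "L (E k) F = pd k F" using L_E[OF k] by auto
  have "pd k (L T F) q - L T (pd k F) q = (\<Sum>j<n + 3. pd k (T j) q * pd j F q)"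
    using vf_deriv_bracket[where A = "E k" and B = T, OF op E_smooth T_smooth F q]
    unfolding e L_E[OF k] L_E_const by simp
  then show ?thesis unfolding sum_bracket_E_T[OF k] by simp
qed

text \<open>Index shift: coordinate k is y_(k-1), so this is the pullback of theta (k - 1) along psi.\<close>

definition \<omega> :: "nat \<Rightarrow> (nat \<Rightarrow> real) \<Rightarrow> nat \<Rightarrow> real" where
  "\<omega> k q i = pd i (c k) q - c (Suc k) q * pd i (c 0) q"

definition kills :: "nat \<Rightarrow> (nat \<Rightarrow> (nat \<Rightarrow> real) \<Rightarrow> real) \<Rightarrow> bool" where
  "kills k A \<longleftrightarrow> (\<forall>q\<in>U. (\<Sum>i<n + 3. A i q * \<omega> k q i) = 0)"

lemma sum_\<omega>: "(\<Sum>i<n + 3. A i * \<omega> k q i) = (\<Sum>i<n + 3. A i * pd i (c k) q) - c (Suc k) q * (\<Sum>i<n + 3. A i * pd i (c 0) q)"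
  by (simp add: \<omega>_def sum_distrib_left sum_subtractf[symmetric] algebra_simps del: sum.lessThan_Suc)

lemma kills_iff: "kills k A \<longleftrightarrow> (\<forall>q\<in>U. L A (c k) q = c (Suc k) q * L A (c 0) q)"
  unfolding kills_def sum_\<omega> by (simp add: vf_deriv_def)

lemma kills_E: "k < n + 3 \<Longrightarrow> kills j (E k) \<longleftrightarrow> (\<forall>q\<in>U. \<omega> j q k = 0)"
  unfolding kills_def E_def by (simp only: sum_delta_mult)

text \<open>Cartan's formula: the differential of \<open>\<omega> k\<close> is minus the wedge of
  \<open>dc_(k+1)\<close> and \<open>dc_0\<close>, and on two fields annihilated by
  \<open>\<omega> k\<close> it takes minus the value of \<open>\<omega> k\<close> on their
  bracket.\<close>

lemma bracket_\<omega>: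
  assumes A: "\<And>i. smooth_in {..<n + 3} U (A i)" and B: "\<And>i. smooth_in {..<n + 3} U (B i)"
    and kA: "kills k A" and kB: "kills k B" and k: "Suc k < n + 3" and q: "q \<in> U"
  shows "(\<Sum>j<n + 3. (L A (B j) q - L B (A j) q) * \<omega> k q j)
    = L A (c (Suc k)) q * L B (c 0) q - L B (c (Suc k)) q * L A (c 0) q"
proof -
  have *: "L A (L B (c k)) q = L A (c (Suc k)) q * L B (c 0) q + c (Suc k) q * L A (L B (c 0)) q"
    if "kills k B" "\<And>i. smooth_in {..<n + 3} U (B i)" for A B
  proof -
    have "L A (L B (c k)) q = L A (\<lambda>q. c (Suc k) q * L B (c 0) q) q"
      by (rule vf_deriv_cong[OF op q]) (use that(1) in \<open>simp add: kills_iff\<close>)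
    also have "\<dots> = L A (c (Suc k)) q * L B (c 0) q + c (Suc k) q * L A (L B (c 0)) q"
      by (rule vf_deriv_mult[OF op c_smooth[OF k] smooth_in_vf_deriv[OF op that(2)] q]) (rule c_smooth, simp)
    finally show ?thesis .
  qed
  have "(\<Sum>j<n + 3. (L A (B j) q - L B (A j) q) * \<omega> k q j) =
      (L A (L B (c k)) q - L B (L A (c k)) q) - c (Suc k) q * (L A (L B (c 0)) q - L B (L A (c 0)) q)"
    unfolding sum_\<omega> using vf_deriv_bracket[where A = A and B = B, OF op A B c_smooth[of k] q]
      vf_deriv_bracket[where A = A and B = B, OF op A B c_smooth[of 0] q] k
    by simp
  then show ?thesis unfolding *[OF kB B] *[OF kA A] by (simp add: algebra_simps)
qed

text \<open>Both derivatives of \<open>c (k+1)\<close> are \<open>c (k+2)\<close> times those of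
  \<open>c 0\<close>, so the determinant in \<open>bracket_\<omega>\<close> vanishes.\<close>

lemma bracket_kills:
  assumes "\<And>i. smooth_in {..<n + 3} U (A i)" "\<And>i. smooth_in {..<n + 3} U (B i)"
    "kills k A" "kills k B" "kills (Suc k) A" "kills (Suc k) B" "Suc k < n + 3" "q \<in> U"
  shows "(\<Sum>j<n + 3. (L A (B j) q - L B (A j) q) * \<omega> k q j) = 0"
  unfolding bracket_\<omega>[where A = A and B = B, OF assms(1-4,7,8)] using assms(5,6,8) by (simp add: kills_iff)

section \<open>The components of psi along the generators of the distribution\<close>

lemma dmap_T: "j < n + 3 \<Longrightarrow> dmap (n + 3) \<psi> q (Xfield n f1 q) j = L T (c j) q"
  unfolding dmap_def vf_deriv_def T_def by (simp add: mult.commute del: sum.lessThan_Suc)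

lemma dmap_Y: "j < n + 3 \<Longrightarrow> dmap (n + 3) \<psi> q (Yfield n q) j = pd (n + 1) (c j) q"
  unfolding dmap_def Yfield_def by (simp add: if_distrib cong: if_cong del: sum.lessThan_Suc)

text \<open>At index 0 \<open>Xfield\<close> has component 1 and \<open>Yfield\<close> component 0,
  so \<open>z 0\<close> is the coefficient of \<open>Xfield\<close>; and \<open>Yfield\<close> lives
  at index \<open>n + 1\<close> alone.\<close>

lemma span_component:
  assumes z: "z \<in> span2 (Xfield n f2 r) (Yfield n r)" and k: "k \<noteq> n + 1"
  shows "z k = Xfield n f2 r k * z 0"
  using assms by (auto simp: span2_def Yfield_def Xfield_def)

lemma LT_c: "q \<in> U \<Longrightarrow> k < n + 3 \<Longrightarrow> k \<noteq> n + 1 \<Longrightarrow> L T (c k) q = Xfield n f2 (\<psi> q) k * L T (c 0) q"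
proof -
  assume q: "q \<in> U" and k: "k < n + 3" "k \<noteq> n + 1"
  have "Xfield n f1 q \<in> span2 (Xfield n f1 q) (Yfield n q)"
    unfolding span2_def by (rule CollectI, rule exI[of _ 1], rule exI[of _ 0]) auto
  then have "dmap (n + 3) \<psi> q (Xfield n f1 q) \<in> span2 (Xfield n f2 (\<psi> q)) (Yfield n (\<psi> q))"
    using span[OF q] by blast
  from span_component[OF this k(2)] k(1) show ?thesis by (simp add: dmap_T)
qed

lemma pd_Y_c: "q \<in> U \<Longrightarrow> k < n + 3 \<Longrightarrow> k \<noteq> n + 1 \<Longrightarrow> pd (n + 1) (c k) q = Xfield n f2 (\<psi> q) k * pd (n + 1) (c 0) q"
proof -
  assume q: "q \<in> U" and k: "k < n + 3" "k \<noteq> n + 1"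
  have "Yfield n q \<in> span2 (Xfield n f1 q) (Yfield n q)"
    unfolding span2_def by (rule CollectI, rule exI[of _ 0], rule exI[of _ 1]) auto
  then have "dmap (n + 3) \<psi> q (Yfield n q) \<in> span2 (Xfield n f2 (\<psi> q)) (Yfield n (\<psi> q))"
    using span[OF q] by blast
  from span_component[OF this k(2)] k(1) dmap_Y[of k q] dmap_Y[of 0 q] show ?thesis by simp
qed

section \<open>The flag of brackets and the contact forms that annihilate it\<close>

lemma kills_T: "1 \<le> k \<Longrightarrow> k \<le> n \<Longrightarrow> kills k T"
  unfolding kills_iff using LT_c[of _ k] by (auto simp: Xfield_def)

lemma kills_Y: "1 \<le> k \<Longrightarrow> k \<le> n \<Longrightarrow> kills k (E (n + 1))"
  unfolding kills_iff using pd_Y_c[of _ k] L_E[of "n + 1"] by (auto simp: Xfield_def)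

text \<open>\<open>\<omega> (Suc k)\<close> is not assumed to kill \<open>E i\<close>, so a
  determinant remains on the right; for \<open>k = 1\<close> it supplies the equations for
  \<open>c 2\<close> and \<open>c 0\<close> in \<open>c_low\<close>.\<close>

lemma bracket_E_T:
  assumes i: "i < n + 3" and k: "1 \<le> k" "k \<le> n" and ki: "kills k (E i)" and q: "q \<in> U"
  shows "(if 2 \<le> i \<and> i \<le> n + 1 then \<omega> k q (i - 1) else 0) + pd i g q * \<omega> k q (n + 2)
    = pd i (c (Suc k)) q * L T (c 0) q - L T (c (Suc k)) q * pd i (c 0) q"
  using bracket_\<omega>[where A = "E i" and B = T, OF E_smooth T_smooth ki kills_T[OF k] _ q] k
  unfolding L_E[OF i] L_E_const diff_zero sum_bracket_E_T[OF i] by simp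

lemma bracket_E_T_kills:
  assumes i: "i < n + 3" and k: "1 \<le> k" "Suc k \<le> n" and ki: "kills k (E i)" "kills (Suc k) (E i)" and q: "q \<in> U"
  shows "(if 2 \<le> i \<and> i \<le> n + 1 then \<omega> k q (i - 1) else 0) + pd i g q * \<omega> k q (n + 2) = 0"
  using bracket_kills[where A = "E i" and B = T, OF E_smooth T_smooth ki(1) kills_T[OF k(1)] ki(2) kills_T[of "Suc k"] _ q] k
  unfolding L_E[OF i] L_E_const diff_zero sum_bracket_E_T[OF i] by simp

text \<open>The bracket of \<open>E (n + 1)\<close> with \<open>T\<close>.\<close>

definition S :: "nat \<Rightarrow> (nat \<Rightarrow> real) \<Rightarrow> real" where
  "S j = (if j = n then (\<lambda>_. 1) else if j = n + 2 then pd (n + 1) g else (\<lambda>_. 0))"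

lemma sum_S: "(\<Sum>j<n + 3. S j q * v j) = v n + pd (n + 1) g q * v (n + 2)"
proof -
  have "(\<Sum>j<n + 3. S j q * v j) = (\<Sum>j<n + 3. (if j = n then v j else 0) + (if j = n + 2 then pd (n + 1) g q * v j else 0))"
    by (rule sum.cong) (auto simp: S_def)
  then show ?thesis by (simp add: sum.distrib del: sum.lessThan_Suc)
qed

lemma S_smooth: "smooth_in {..<n + 3} U (S i)"
  using smooth_in_pd[OF g_smooth, of "n + 1"] by (simp add: S_def smooth_in_const[OF op])

lemma kills_S: "1 \<le> k \<Longrightarrow> Suc k \<le> n \<Longrightarrow> kills k S"
  unfolding kills_def sum_S using bracket_E_T_kills[of "n + 1" k] kills_Y[of k] kills_Y[of "Suc k"] by simp

text \<open>The bracket of \<open>E (n + 1)\<close> with \<open>S\<close> is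
  \<open>E (n + 2)\<close> times the second \<open>y_n\<close>-derivative of \<open>g\<close>, which
  is nonzero. The generators are killed for \<open>k\<close> up to \<open>n\<close>,
  \<open>S\<close> up to \<open>n - 1\<close>, and hence this bracket up to
  \<open>n - 2\<close>.\<close>

lemma \<omega>_z: "1 \<le> k \<Longrightarrow> k + 2 \<le> n \<Longrightarrow> q \<in> U \<Longrightarrow> \<omega> k q (n + 2) = 0"
proof -
  assume k: "1 \<le> k" "k + 2 \<le> n" and q: "q \<in> U"
  have "(\<Sum>j<n + 3. (L (E (n + 1)) (S j) q - L S (E (n + 1) j) q) * \<omega> k q j) = 0"
    by (rule bracket_kills[OF E_smooth S_smooth kills_Y kills_S kills_Y kills_S]) (use k q in auto)
  moreover have "(\<Sum>j<n + 3. (L (E (n + 1)) (S j) q - L S (E (n + 1) j) q) * \<omega> k q j)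
    = (\<Sum>j<n + 3. if j = n + 2 then pd (n + 1) (pd (n + 1) g) q * \<omega> k q j else 0)"
  proof (rule sum.cong[OF refl])
    fix j
    have "L (E (n + 1)) (S j) q = pd (n + 1) (S j) q" by (rule L_E) simp
    then show "(L (E (n + 1)) (S j) q - L S (E (n + 1) j) q) * \<omega> k q j
      = (if j = n + 2 then pd (n + 1) (pd (n + 1) g) q * \<omega> k q j else 0)"
      unfolding L_E_const by (simp add: S_def pd_const)
  qed
  ultimately have "pd (n + 1) (pd (n + 1) g) q * \<omega> k q (n + 2) = 0"
    by (simp del: sum.lessThan_Suc)
  then show ?thesis using g''_nonzero[OF q] by simp
qed

lemma \<omega>_n: "1 \<le> k \<Longrightarrow> k + 2 \<le> n \<Longrightarrow> q \<in> U \<Longrightarrow> \<omega> k q n = 0"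
  using bspec[OF kills_S[of k, unfolded kills_def sum_S], of q] \<omega>_z[of k q] by simp

text \<open>Modulo \<open>E (n + 2)\<close> the bracket of \<open>S\<close> with \<open>T\<close> is
  \<open>E (n - 1)\<close>. Using \<open>S\<close> instead of \<open>E n\<close> gains an index:
  \<open>S\<close> is killed up to \<open>k = n - 1\<close>, \<open>E n\<close> only up to
  \<open>n - 2\<close> by \<open>\<omega>_n\<close>. This gain lets the descent reach
  \<open>y_1\<close> for \<open>k = 1\<close>.\<close>

lemma \<omega>_n1: "1 \<le> k \<Longrightarrow> k + 2 \<le> n \<Longrightarrow> q \<in> U \<Longrightarrow> \<omega> k q (n - 1) = 0"
proof -
  assume k: "1 \<le> k" "k + 2 \<le> n" and q: "q \<in> U"
  have "(\<Sum>j<n + 3. (L S (T j) q - L T (S j) q) * \<omega> k q j) = 0"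
    by (rule bracket_kills[OF S_smooth T_smooth kills_S kills_T kills_S kills_T]) (use k q in auto)
  moreover have "(\<Sum>j<n + 3. (L S (T j) q - L T (S j) q) * \<omega> k q j) = (\<Sum>j<n + 3. if j = n - 1 then \<omega> k q j else 0)"
  proof (rule sum.cong[OF refl])
    fix j
    have "L S (T j) q = pd n (T j) q + pd (n + 1) g q * pd (n + 2) (T j) q"
      unfolding vf_deriv_def by (rule sum_S)
    moreover have "j \<noteq> n + 2 \<Longrightarrow> L T (S j) q = 0" by (simp add: S_def L_const)
    ultimately show "(L S (T j) q - L T (S j) q) * \<omega> k q j = (if j = n - 1 then \<omega> k q j else 0)"
      using n k by (cases "j = n + 2") (auto simp: \<omega>_z[OF k q, simplified] pd_T)
  qed
  moreover have "n - 1 < n + 3" by simp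
  ultimately show ?thesis by (simp del: sum.lessThan_Suc)
qed

text \<open>A bracket with \<open>T\<close> lowers the index of \<open>E\<close> by one at the cost
  of one \<open>k\<close>; its \<open>z\<close> term is zero by \<open>\<omega>_z\<close>. For
  \<open>k = 1\<close> and \<open>d = n - 3\<close> the index reached is 2, that is
  \<open>y_1\<close>.\<close>

lemma \<omega>_descend: "d + 3 \<le> n \<Longrightarrow> 1 \<le> k \<Longrightarrow> k + 2 + d \<le> n \<Longrightarrow> q \<in> U \<Longrightarrow> \<omega> k q (n - 1 - d) = 0"
proof (induction d arbitrary: k q)
  case 0
  then show ?case using \<omega>_n1 by simp
next
  case (Suc d)
  let ?i = "n - 1 - d"
  have "(if 2 \<le> ?i \<and> ?i \<le> n + 1 then \<omega> k q (?i - 1) else 0) + pd ?i g q * \<omega> k q (n + 2) = 0"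
    by (rule bracket_E_T_kills) (use Suc in \<open>auto simp: kills_E\<close>)
  moreover have "2 \<le> ?i" "?i \<le> n + 1" "?i - 1 = n - 1 - Suc d" using Suc.prems by auto
  moreover have "\<omega> k q (n + 2) = 0" by (rule \<omega>_z) (use Suc.prems in auto)
  ultimately show ?case by (simp only: if_True conj_absorb simp_thms mult_zero_right add_0_right)
qed

lemma \<omega>1: "2 \<le> i \<Longrightarrow> i < n + 3 \<Longrightarrow> q \<in> U \<Longrightarrow> \<omega> 1 q i = 0"
proof -
  assume i: "2 \<le> i" "i < n + 3" and q: "q \<in> U"
  consider "i < n" | "i = n" | "i = n + 1" | "i = n + 2" using i by linarith
  then show ?thesis
  proof cases
    case 1
    then show ?thesis using \<omega>_descend[of "n - 1 - i" 1 q] i q n by simp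
  next
    case 2 then show ?thesis using \<omega>_n[of 1] q n by simp
  next
    case 3 then show ?thesis using kills_Y[of 1] kills_E[of "n + 1" 1] q n by simp
  next
    case 4 then show ?thesis using \<omega>_z[of 1] q n by simp
  qed
qed

text \<open>Only the coefficients at \<open>x\<close> and \<open>y_0\<close> survive, and
  annihilation of \<open>T\<close> fixes their ratio: \<open>q 2\<close> is \<open>y_1\<close>, the
  \<open>y_0\<close> component of \<open>T\<close>.\<close>

lemma \<omega>1_contact: "q \<in> U \<Longrightarrow> i < n + 3 \<Longrightarrow> \<omega> 1 q i = \<omega> 1 q 1 * theta 0 q i"
proof -
  assume q: "q \<in> U" and i: "i < n + 3"
  have "(\<Sum>i<n + 3. T i q * \<omega> 1 q i) = 0" using kills_T[of 1] q n unfolding kills_def by simp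
  moreover have "(\<Sum>i<n + 3. T i q * \<omega> 1 q i) = (\<Sum>i<2. T i q * \<omega> 1 q i)"
    by (rule sum.mono_neutral_right) (use \<omega>1[OF _ _ q] in auto)
  ultimately have "\<omega> 1 q 0 = - q 2 * \<omega> 1 q 1" using n by (simp add: numeral_2_eq_2 T_eq)
  then show ?thesis using \<omega>1[of i q] q i
    by (cases "i = 0"; cases "i = 1") (auto simp: theta_def numeral_2_eq_2)
qed

text \<open>\<open>\<omega> 1\<close> is a nontrivial combination of rows 0 and 1 of an invertible
  Jacobian, with coefficient 1 at row 1.\<close>

lemma \<omega>1_nonzero: "q \<in> U \<Longrightarrow> \<omega> 1 q 1 \<noteq> 0"
proof
  assume q: "q \<in> U" and z: "\<omega> 1 q 1 = 0"
  define a where "a l = (if l = 1 then 1 else if l = 0 then - c 2 q else 0 :: real)" for l :: nat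
  have "(\<Sum>l<n + 3. a l * pd i (c l) q) = 0" if i: "i < n + 3" for i
  proof -
    have "(\<Sum>l<n + 3. a l * pd i (c l) q) = (\<Sum>l<2. a l * pd i (c l) q)"
      by (rule sum.mono_neutral_right) (auto simp: a_def)
    also have "\<dots> = \<omega> 1 q i" by (simp add: numeral_2_eq_2 a_def \<omega>_def)
    also have "\<dots> = 0" using \<omega>1_contact[OF q i] z by simp
    finally show ?thesis .
  qed
  from diffeo_rows_independent[OF diff q this, of 1] show False by (simp add: a_def)
qed

text \<open>By \<open>bracket_\<omega>\<close> for \<open>k = 1\<close>, the value of
  \<open>\<omega> 1\<close> on a bracket is a 2 by 2 determinant in the derivatives of
  \<open>c 2\<close> and \<open>c 0\<close>. The determinants of \<open>E i\<close> with
  \<open>T\<close> and with \<open>E 2\<close> vanish, whereas that of \<open>E 2\<close> with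
  \<open>T\<close> is \<open>\<omega> 1 q 1\<close>, which is nonzero. So the derivative of the pair
  along \<open>E i\<close> is parallel to two independent vectors, hence zero, and
  \<open>c 1\<close> follows from \<open>\<omega>1\<close>.\<close>

lemma c_low:
  assumes i: "3 \<le> i" "i < n + 3" and j: "j < 3" and q: "q \<in> U"
  shows "pd i (c j) q = 0"
proof -
  have kE: "kills 1 (E l)" if "2 \<le> l" "l < n + 3" for l using \<omega>1 that by (simp add: kills_E)
  let ?a = "\<omega> 1 q 1"
  have 1: "pd i (c 2) q * L T (c 0) q - L T (c 2) q * pd i (c 0) q = 0"
    using bracket_E_T[of i 1 q] kE[of i] i n q \<omega>1[of "i - 1" q] \<omega>1[of "n + 2" q]
    by (simp add: numeral_2_eq_2 split: if_splits)
  have 2: "pd 2 (c 2) q * L T (c 0) q - L T (c 2) q * pd 2 (c 0) q = ?a"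
    using bracket_E_T[of 2 1 q] kE[of 2] n q \<omega>1[of "n + 2" q] by (simp add: numeral_2_eq_2)
  have 3: "pd i (c 2) q * pd 2 (c 0) q - pd 2 (c 2) q * pd i (c 0) q = 0"
    using bracket_\<omega>[where A = "E i" and B = "E 2", OF E_smooth E_smooth kE kE _ q] i
    by (simp add: L_E L_E_const numeral_2_eq_2 del: sum.lessThan_Suc)
  have "?a * pd i (c 0) q = 0" "?a * pd i (c 2) q = 0"
    using 1 2 3 by algebra+
  then have 4: "pd i (c 0) q = 0" "pd i (c 2) q = 0" using \<omega>1_nonzero[OF q] by auto
  moreover have "pd i (c 1) q = 0" using \<omega>1[of i q] i q 4 by (simp add: \<omega>_def)
  moreover have "j = 0 \<or> j = 1 \<or> j = 2" using j by auto
  ultimately show ?thesis by blast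
qed

text \<open>The field \<open>Xfield n f2\<close> has \<open>x\<close> component 1 and is the image
  of a combination of the generators. \<open>E (n + 1)\<close> contributes nothing to that
  component, since \<open>c 0\<close> does not depend on \<open>y_n\<close>.\<close>

lemma LT_c0_nonzero: "q \<in> U \<Longrightarrow> L T (c 0) q \<noteq> 0"
proof
  assume q: "q \<in> U" and z: "L T (c 0) q = 0"
  have "Xfield n f2 (\<psi> q) \<in> span2 (Xfield n f2 (\<psi> q)) (Yfield n (\<psi> q))"
    unfolding span2_def by (rule CollectI, rule exI[of _ 1], rule exI[of _ 0]) auto
  then obtain a b where "Xfield n f2 (\<psi> q) = dmap (n + 3) \<psi> q (\<lambda>i. a * Xfield n f1 q i + b * Yfield n q i)"
    unfolding span[OF q, symmetric] by (auto simp: span2_def)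
  then have "Xfield n f2 (\<psi> q) 0 = a * L T (c 0) q + b * pd (n + 1) (c 0) q"
    unfolding dmap_linear using dmap_T[of 0 q] dmap_Y[of 0 q] by simp
  then show False using z c_low[of "n + 1" 0 q] n q by (simp add: Xfield_def)
qed

text \<open>Differentiate \<open>T c_j = c_(j+1) T c_0\<close> in direction \<open>i\<close>.
  Commuting with \<open>T\<close> lowers the index to \<open>i - 1\<close>, still beyond the
  variables of \<open>c_j\<close> and \<open>c_0\<close>, so only the derivative of
  \<open>c_(j+1)\<close> remains. The \<open>z\<close> component is left out by
  \<open>j < n + 2\<close>.\<close>

lemma c_triangular:
  "j < n + 2 \<Longrightarrow> max 3 (Suc j) \<le> i \<Longrightarrow> i < n + 3 \<Longrightarrow> q \<in> U \<Longrightarrow> pd i (c j) q = 0"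
proof (induction j arbitrary: i q)
  case 0
  then show ?case by (intro c_low) auto
next
  case (Suc j)
  show ?case
  proof (cases "Suc j < 3")
    case True
    then show ?thesis using Suc.prems by (intro c_low) auto
  next
    case False
    have vanish: "pd i (L T (c l)) q = 0" if l: "l = j \<or> l = 0" for l
    proof -
      have "pd i' (c l) q' = 0" if "max 3 (Suc j) \<le> i'" "i' < n + 3" "q' \<in> U" for i' q'
        using l Suc.IH[OF _ that] Suc.prems(1) c_low[of i' 0 q'] that by auto
      note z = this
      have "L T (pd i (c l)) q = 0" by (rule L_zero) (use z Suc.prems False in auto)
      moreover have "pd (i - 1) (c l) q = 0" "pd (n + 2) (c l) q = 0"
        using z[of "i - 1" q] z[of "n + 2" q] Suc.prems False n by auto
      ultimately show ?thesis using pd_LT[OF c_smooth[of l] Suc.prems(4,3)] l Suc.prems(1) by auto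
    qed
    have "pd i (L T (c j)) q = pd i (\<lambda>q. c (Suc j) q * L T (c 0) q) q"
      by (rule pd_cong[OF op Suc.prems(4)]) (use Suc.prems LT_c[of _ j] False in \<open>auto simp: Xfield_def\<close>)
    also have "\<dots> = pd i (c (Suc j)) q * L T (c 0) q + c (Suc j) q * pd i (L T (c 0)) q"
      by (rule pd_mult[OF op c_smooth LT_smooth[OF c_smooth] Suc.prems(4)]) (use Suc.prems in auto)
    finally have "pd i (c (Suc j)) q * L T (c 0) q = 0" using vanish by simp
    then show ?thesis using LT_c0_nonzero[OF Suc.prems(4)] by simp
  qed
qed

section \<open>The last component is affine in z\<close>

definition h :: "(nat \<Rightarrow> real) \<Rightarrow> real" where "h = pd (n + 2) (c (n + 2))"

lemma h_smooth: "smooth_in {..<n + 3} U h"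
  unfolding h_def by (intro smooth_in_pd c_smooth) auto

lemma pd_Y_z: "q \<in> U \<Longrightarrow> pd (n + 1) (c (n + 2)) q = 0"
  using pd_Y_c[of q "n + 2"] c_low[of "n + 1" 0 q] n by simp

lemma LT_z: "q \<in> U \<Longrightarrow> L T (c (n + 2)) q = f2 (tr (n + 2) (\<psi> q)) * L T (c 0) q"
  using LT_c[of q "n + 2"] by (simp add: Xfield_def)

text \<open>No coefficient of \<open>T\<close> involves \<open>z\<close>, so
  \<open>pd (n + 2)\<close> commutes with \<open>L T\<close>. In \<open>LT_z\<close> nothing on the
  right involves \<open>z\<close> either, by \<open>c_triangular\<close> and
  \<open>c_low\<close>.\<close>

lemma LT_h: "q \<in> U \<Longrightarrow> L T h q = 0"
proof -
  assume q: "q \<in> U"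
  let ?F = "\<lambda>q. f2 (tr (n + 2) (\<psi> q))"
  have cs: "smooth_in {..<n + 3} U (\<lambda>q. tr (n + 2) (\<psi> q) j)" if "j < n + 2" for j
    using c_smooth[of j] that by (simp add: tr_def)
  have maps: "tr (n + 2) (\<psi> q) \<in> O2" if "q \<in> U" for q using VO2 D(5) that by blast
  have F: "smooth_in {..<n + 3} U ?F" by (rule smooth_in_comp[OF op O2 f2 maps cs])
  have "pd (n + 2) ?F q = (\<Sum>j<n + 2. pd j f2 (tr (n + 2) (\<psi> q)) * pd (n + 2) (\<lambda>q. tr (n + 2) (\<psi> q) j) q)"
    by (rule pd_comp[OF op O2 f2 maps cs q]) auto
  also have "\<dots> = 0"
    by (intro sum.neutral ballI) (use c_triangular[of _ "n + 2" q] n q in \<open>auto simp: tr_nth\<close>)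
  finally have F0: "pd (n + 2) ?F q = 0" .
  have g0: "pd (n + 2) g q = 0" by (simp add: pd_g)
  have "L T (pd (n + 2) (c 0)) q = 0" by (rule L_zero) (use c_low n q in auto)
  then have T0: "pd (n + 2) (L T (c 0)) q = 0"
    using pd_LT[OF c_smooth[of 0] q, of "n + 2"] g0 by simp
  have "L T h q = pd (n + 2) (L T (c (n + 2))) q"
    using pd_LT[OF c_smooth[of "n + 2"] q, of "n + 2"] g0 by (simp add: h_def)
  also have "\<dots> = pd (n + 2) (\<lambda>q. ?F q * L T (c 0) q) q"
    by (rule pd_cong[OF op q]) (use LT_z in auto)
  also have "\<dots> = pd (n + 2) ?F q * L T (c 0) q + ?F q * pd (n + 2) (L T (c 0)) q"
    by (rule pd_mult[OF op F LT_smooth[OF c_smooth] q]) auto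
  finally show ?thesis by (simp only: F0 T0)
qed

lemma pd_Y_h: "q \<in> U \<Longrightarrow> pd (n + 1) h q = 0"
proof -
  assume q: "q \<in> U"
  have "pd (n + 1) h q = pd (n + 2) (pd (n + 1) (c (n + 2))) q"
    unfolding h_def by (rule pd_commute[OF c_smooth op q]) auto
  also have "\<dots> = 0" by (rule pd_zero[OF pd_Y_z q]) auto
  finally show ?thesis .
qed

text \<open>If \<open>E i\<close> and \<open>T\<close> both annihilate \<open>h\<close>, so does
  their bracket, which is \<open>E (i - 1)\<close> plus \<open>pd i g\<close> times
  \<open>E (n + 2)\<close>.\<close>

lemma pd_h_recursion:
  assumes q: "q \<in> U" and i: "2 \<le> i" "i \<le> n + 1" and z: "\<And>q. q \<in> U \<Longrightarrow> pd i h q = 0"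
  shows "pd (i - 1) h q + pd i g q * pd (n + 2) h q = 0"
proof -
  have "pd i (L T h) q = 0" by (rule pd_zero[OF LT_h q]) (use i in auto)
  moreover have "L T (pd i h) q = 0" by (rule L_zero[OF z q])
  ultimately show ?thesis using pd_LT[OF h_smooth q, of i] i by simp
qed

text \<open>Differentiating the recursion at \<open>i = n + 1\<close> along \<open>y_n\<close>
  leaves only the second derivative of \<open>g\<close> times \<open>pd (n + 2) h\<close>. This is
  the same double bracket as in \<open>\<omega>_z\<close>, now applied to \<open>h\<close>.\<close>

lemma pd_z_h: "q \<in> U \<Longrightarrow> pd (n + 2) h q = 0"
proof -
  assume q: "q \<in> U"
  have sn: "smooth_in {..<n + 3} U (pd n h)" and sz: "smooth_in {..<n + 3} U (pd (n + 2) h)"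
    and sg: "smooth_in {..<n + 3} U (pd (n + 1) g)"
    by (intro smooth_in_pd h_smooth g_smooth, simp)+
  have c1: "pd (n + 1) (pd j h) q = 0" if "j < n + 3" for j
  proof -
    have "pd (n + 1) (pd j h) q = pd j (pd (n + 1) h) q"
      by (rule pd_commute[OF h_smooth op q]) (use that in auto)
    also have "\<dots> = 0" by (rule pd_zero[OF pd_Y_h q that])
    finally show ?thesis .
  qed
  have "0 = pd (n + 1) (\<lambda>q. pd n h q + pd (n + 1) g q * pd (n + 2) h q) q"
    by (rule sym, rule pd_zero[OF _ q]) (use pd_h_recursion[of _ "n + 1"] pd_Y_h n in auto)
  also have "\<dots> = pd (n + 1) (pd n h) q + pd (n + 1) (\<lambda>q. pd (n + 1) g q * pd (n + 2) h q) q"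
    by (rule pd_add[OF op sn smooth_in_mult[OF op sg sz] q]) auto
  also have "pd (n + 1) (\<lambda>q. pd (n + 1) g q * pd (n + 2) h q) q
      = pd (n + 1) (pd (n + 1) g) q * pd (n + 2) h q + pd (n + 1) g q * pd (n + 1) (pd (n + 2) h) q"
    by (rule pd_mult[OF op sg sz q]) auto
  finally have "pd (n + 1) (pd (n + 1) g) q * pd (n + 2) h q = 0"
    using c1[of n] c1[of "n + 2"] by simp
  then show ?thesis using g''_nonzero[OF q] by simp
qed

text \<open>With the \<open>z\<close> derivative gone, the recursion descends from
  \<open>y_n\<close> to \<open>y_0\<close>, and \<open>LT_h\<close> then disposes of
  \<open>x\<close>.\<close>

lemma pd_h: "i < n + 3 \<Longrightarrow> q \<in> U \<Longrightarrow> pd i h q = 0"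
proof -
  have pos: "d \<le> n \<Longrightarrow> q \<in> U \<Longrightarrow> pd (n + 1 - d) h q = 0" for d q
  proof (induction d arbitrary: q)
    case 0 then show ?case using pd_Y_h by simp
  next
    case (Suc d)
    have "pd (n + 1 - d - 1) h q + pd (n + 1 - d) g q * pd (n + 2) h q = 0"
      by (rule pd_h_recursion) (use Suc in auto)
    then show ?case using pd_z_h[OF Suc.prems(2)] by simp
  qed
  have nz: "pd i h q = 0" if "i < n + 3" "i \<noteq> 0" "q \<in> U" for i q
    using pos[of "n + 1 - i" q] pd_z_h[of q] that by (cases "i = n + 2") auto
  assume i: "i < n + 3" and q: "q \<in> U"
  have "L T h q = (\<Sum>i<1. T i q * pd i h q)"
    unfolding vf_deriv_def by (rule sum.mono_neutral_right) (use nz q in auto)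
  then have "pd 0 h q = 0" using LT_h[OF q] by (simp add: T_eq)
  then show "pd i h q = 0" using nz i q by (cases "i = 0") auto
qed

text \<open>By \<open>c_triangular\<close>, \<open>h\<close> is the only entry in the
  \<open>z\<close> column of the Jacobian that can be nonzero.\<close>

lemma h_nonzero: "q \<in> U \<Longrightarrow> h q \<noteq> 0"
proof
  assume q: "q \<in> U" and z: "h q = 0"
  have "pd (n + 2) (c l) q = 0" if "l < n + 3" for l
    using that c_triangular[of l "n + 2" q] z q n by (cases "l = n + 2") (auto simp: h_def)
  then have "(\<Sum>l<n + 3. pd l (\<lambda>r. inv_into U \<psi> r (n + 2)) (\<psi> q) * pd (n + 2) (c l) q) = 0"
    by (intro sum.neutral) auto
  then show False using diffeo_jacobian[OF diff q, of "n + 2" "n + 2"] by simp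
qed

end

section \<open>From vanishing derivatives to maps defined on cubes\<close>

lemma cube_segment:
  assumes q: "q \<in> cube m p e" "q' \<in> cube m p e" and t: "0 \<le> t" "t \<le> 1"
  shows "(\<lambda>i. q i + t * (q' i - q i)) \<in> cube m p e"
proof -
  have "\<bar>q i + t * (q' i - q i) - p i\<bar> < e" if "i < m" for i
  proof -
    have "\<bar>q i - p i\<bar> < e" "\<bar>q' i - p i\<bar> < e" using q that by (auto simp: cube_def)
    then have "(1 - t) * (q i - p i) + t * (q' i - p i) < e" "(1 - t) * (p i - q i) + t * (p i - q' i) < e"
      using t by (auto intro!: convex_bound_lt)
    then show ?thesis by (auto simp: abs_less_iff algebra_simps)
  qed
  then show ?thesis using q by (auto simp: cube_def Rn_def)
qed

lemma open_contains_cube: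
  assumes "openin (top_of_set (Rn m)) S" "p \<in> S"
  obtains e where "e > 0" "cube m p e \<subseteq> S"
proof -
  obtain e where e: "e > 0"
    "\<And>q. (\<And>i. i \<in> {..<m} \<Longrightarrow> \<bar>q i - p i\<bar> < e) \<Longrightarrow> (\<And>i. i \<notin> {..<m} \<Longrightarrow> q i = p i) \<Longrightarrow> q \<in> S"
    using coord_openD[OF coord_open_Rn[OF assms(1)] assms(2), of "{..<m}"] by blast
  have "p \<in> Rn m" using assms openin_imp_subset by blast
  then have eq: "q i = p i" if "q \<in> cube m p e" "i \<notin> {..<m}" for q i
    using that by (simp add: cube_def Rn_def)
  have "cube m p e \<subseteq> S"
  proof
    fix q assume q: "q \<in> cube m p e"
    show "q \<in> S" by (rule e(2)) (use q eq[OF q] in \<open>simp_all add: cube_def\<close>)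
  qed
  with e(1) that show ?thesis by blast
qed

lemma dmap_inverse:
  assumes d: "diffeo m U V \<psi>" and q: "q \<in> U" and v: "\<And>i. m \<le> i \<Longrightarrow> v i = 0"
  shows "dmap m (inv_into U \<psi>) (\<psi> q) (dmap m \<psi> q v) = v"
proof
  fix j
  show "dmap m (inv_into U \<psi>) (\<psi> q) (dmap m \<psi> q v) j = v j"
  proof (cases "j < m")
    case True
    let ?J = "\<lambda>l. pd l (\<lambda>r. inv_into U \<psi> r j) (\<psi> q)"
    have "dmap m (inv_into U \<psi>) (\<psi> q) (dmap m \<psi> q v) j
      = (\<Sum>l<m. ?J l * (\<Sum>i<m. pd i (\<lambda>r. \<psi> r l) q * v i))"
      using True by (simp add: dmap_def)
    also have "\<dots> = (\<Sum>l<m. \<Sum>i<m. ?J l * pd i (\<lambda>r. \<psi> r l) q * v i)"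
      by (simp add: sum_distrib_left mult.assoc)
    also have "\<dots> = (\<Sum>i<m. (\<Sum>l<m. ?J l * pd i (\<lambda>r. \<psi> r l) q) * v i)"
      unfolding sum_distrib_right by (rule sum.swap)
    also have "\<dots> = (\<Sum>i<m. (if i = j then 1 else 0) * v i)"
      using diffeo_jacobian[OF d q _ True] by (intro sum.cong) auto
    also have "\<dots> = v j" by (rule sum_delta_mult[OF True])
    finally show ?thesis .
  qed (simp add: dmap_def v)
qed

context distr_equiv
begin

text \<open>Applying the inverse differential to the span equation exchanges its sides;
  \<open>dmap_inverse\<close> applies because both generators vanish from index \<open>n + 3\<close>
  on.\<close>

lemma reverse: "distr_equiv n O2 O1 f2 f1 V U (inv_into U \<psi>)"
proof
  show "diffeo (n + 3) V U (inv_into U \<psi>)" by (rule diffeo_inverse[OF diff])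
  fix r assume r: "r \<in> V"
  let ?\<xi> = "inv_into U \<psi>"
  define q where "q = ?\<xi> r"
  have q: "q \<in> U" "\<psi> q = r" using D(6,8) r by (auto simp: q_def)
  have "dmap (n + 3) ?\<xi> r ` span2 (Xfield n f2 r) (Yfield n r)
    = (\<lambda>v. dmap (n + 3) ?\<xi> (\<psi> q) (dmap (n + 3) \<psi> q v)) ` span2 (Xfield n f1 q) (Yfield n q)"
    using span[OF q(1)] by (simp add: q(2) image_image[symmetric])
  also have "\<dots> = (\<lambda>v. v) ` span2 (Xfield n f1 q) (Yfield n q)"
    by (rule image_cong[OF refl], rule dmap_inverse[OF diff q(1)]) (auto simp: span2_def Xfield_def Yfield_def)
  finally show "dmap (n + 3) ?\<xi> r ` span2 (Xfield n f2 r) (Yfield n r) = span2 (Xfield n f1 (?\<xi> r)) (Yfield n (?\<xi> r))"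
    by (simp add: q_def)
qed (use n O1 O2 f1 f2 f1'' f2'' UO1 VO2 in simp_all)

text \<open>Cubes are convex, so the vanishing derivatives of \<open>c_triangular\<close> integrate
  along the segment from \<open>q\<close> to \<open>q'\<close>.\<close>

lemma independent:
  assumes b: "cube (n + 3) p e \<subseteq> U" and q: "q \<in> cube (n + 3) p e" "q' \<in> cube (n + 3) p e"
    and j: "j < n + 2" and eq: "\<And>i. i < max 3 (Suc j) \<Longrightarrow> q i = q' i"
  shows "\<psi> q j = \<psi> q' j"
proof (rule const_along_segment[where F = "c j"])
  show "smooth_in {..<n + 3} (cube (n + 3) p e) (c j)"
    by (rule smooth_in_subset[OF c_smooth b]) (use j in simp)
  show "coord_open {..<n + 3} (cube (n + 3) p e)" by (rule coord_open_Rn[OF openin_cube])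
  show "(\<lambda>i. q i + t * (q' i - q i)) \<in> cube (n + 3) p e" if "0 \<le> t" "t \<le> 1" for t
    by (rule cube_segment[OF q that])
  show "q i = q' i" if "n + 3 \<le> i" for i using q that by (simp add: cube_def Rn_def)
  show "pd i (c j) r = 0" if "i < n + 3" "q i \<noteq> q' i" "r \<in> cube (n + 3) p e" for i r
    by (rule c_triangular[OF j]) (use that eq[of i] b in \<open>auto simp: not_less[symmetric]\<close>)
qed

lemma h_const:
  assumes b: "cube (n + 3) p e \<subseteq> U" and q: "q \<in> cube (n + 3) p e" "q' \<in> cube (n + 3) p e"
  shows "h q = h q'"
proof (rule const_along_segment[where F = h])
  show "smooth_in {..<n + 3} (cube (n + 3) p e) h" by (rule smooth_in_subset[OF h_smooth b])
  show "coord_open {..<n + 3} (cube (n + 3) p e)" by (rule coord_open_Rn[OF openin_cube])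
  show "(\<lambda>i. q i + t * (q' i - q i)) \<in> cube (n + 3) p e" if "0 \<le> t" "t \<le> 1" for t
    by (rule cube_segment[OF q that])
  show "q i = q' i" if "n + 3 \<le> i" for i using q that by (simp add: cube_def Rn_def)
  show "pd i h r = 0" if "i < n + 3" "r \<in> cube (n + 3) p e" for i r
    using pd_h that b by blast
qed

text \<open>The candidate contact transformation: the first three components of
  \<open>\<psi>\<close>, with the variables \<open>y_2, ..., y_n, z\<close> frozen at
  \<open>p0\<close>. By \<open>independent\<close> these variables do not matter on a cube.\<close>

definition base_map :: "(nat \<Rightarrow> real) \<Rightarrow> (nat \<Rightarrow> real) \<Rightarrow> nat \<Rightarrow> real" where
  "base_map p0 p = tr 3 (\<psi> (splice 3 p0 p))"

lemma base_map_nth: "j < 3 \<Longrightarrow> base_map p0 p j = \<psi> (splice 3 p0 p) j"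
  by (simp add: base_map_def tr_def)

lemma base_map_smooth:
  assumes "openin (top_of_set (Rn 3)) X" "\<And>p. p \<in> X \<Longrightarrow> splice 3 p0 p \<in> U"
  shows "smooth_map 3 X (base_map p0)"
  unfolding smooth_map_def
proof (intro conjI ballI allI impI)
  show "base_map p0 q \<in> Rn 3" for q by (simp add: base_map_def tr_in_Rn)
  fix j :: nat assume j: "j < 3"
  have "smooth_in {..<3} X (\<lambda>p. c j (splice 3 p0 p))"
    by (rule smooth_in_splice[OF coord_open_Rn[OF assms(1)] c_smooth[of j]]) (use j n assms(2) in auto)
  then show "smooth_in {..<3} X (\<lambda>q. base_map p0 q j)" using j by (simp add: base_map_nth)
qed

lemma base_map_contact:
  assumes "splice 3 p0 p \<in> U" and i: "i < 3"
  shows "pd i (\<lambda>q. base_map p0 q 1) p - base_map p0 p 2 * pd i (\<lambda>q. base_map p0 q 0) p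
    = \<omega> 1 (splice 3 p0 p) 1 * theta 0 p i"
proof -
  have "pd i (\<lambda>q. base_map p0 q j) p = pd i (c j) (splice 3 p0 p)" if "j < 3" for j
    using that i by (simp add: base_map_nth pd_splice[of i "c j"])
  moreover have "theta 0 (splice 3 p0 p) i = theta 0 p i" by (simp add: theta_def splice_def numeral_2_eq_2)
  ultimately show ?thesis
    using \<omega>1_contact[OF assms(1), of i] i by (simp add: base_map_nth) (simp add: \<omega>_def numeral_2_eq_2)
qed

lemma splice_cube:
  assumes "p0 \<in> Rn m" "k \<le> m" "p \<in> cube k p0 e" "0 < e"
  shows "splice k p0 p \<in> cube m p0 e"
  using assms by (auto simp: cube_def splice_def Rn_def)

lemma continuous_on_components:
  assumes "\<And>j. j < m \<Longrightarrow> continuous_on X (\<lambda>q. F q j)" "\<And>q. q \<in> X \<Longrightarrow> F q \<in> Rn m"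
  shows "continuous_on X F"
proof (rule continuous_on_coordinatewise_then_product)
  fix j show "continuous_on X (\<lambda>q. F q j)"
  proof (cases "j < m")
    case False
    then have "F q j = 0" if "q \<in> X" for q using assms(2)[OF that] by (simp add: Rn_def)
    then show ?thesis by (simp cong: continuous_on_cong)
  qed (rule assms(1))
qed

lemma \<psi>_continuous: "continuous_on U \<psi>"
  by (rule continuous_on_components[of "n + 3"]) (use c_smooth smooth_in_continuous D(5,12) in blast)+

text \<open>Both cubes matter: independence for \<open>\<psi>\<close> is available on a cube around
  \<open>p0\<close>, independence for its inverse on a cube around \<open>\<psi> p0\<close>.\<close>

definition slice_dom :: "(nat \<Rightarrow> real) \<Rightarrow> real \<Rightarrow> real \<Rightarrow> (nat \<Rightarrow> real) set" where
  "slice_dom p0 e e' = {p \<in> cube 3 p0 e. \<psi> (splice 3 p0 p) \<in> cube (n + 3) (\<psi> p0) e'}"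

lemma slice_dom_splice:
  assumes "p0 \<in> U" "0 < e" "p \<in> slice_dom p0 e e'"
  shows "splice 3 p0 p \<in> cube (n + 3) p0 e"
  by (rule splice_cube) (use assms D(11) in \<open>auto simp: slice_dom_def\<close>)

lemma openin_slice_dom:
  assumes p0: "p0 \<in> U" "0 < e" "cube (n + 3) p0 e \<subseteq> U" and Vb: "cube (n + 3) (\<psi> p0) e' \<subseteq> V"
  shows "openin (top_of_set (Rn 3)) (slice_dom p0 e e')"
proof -
  have sU: "splice 3 p0 p \<in> U" if "p \<in> cube 3 p0 e" for p
    using splice_cube[of p0 "n + 3" 3 p e] that p0 D(11) by auto
  have "continuous_on (cube 3 p0 e) (\<lambda>p. \<psi> (splice 3 p0 p))"
    by (rule continuous_on_compose2[OF \<psi>_continuous continuous_on_splice]) (use sU in auto)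
  then have "openin (top_of_set (cube 3 p0 e)) (cube 3 p0 e \<inter> (\<lambda>p. \<psi> (splice 3 p0 p)) -` cube (n + 3) (\<psi> p0) e')"
    by (rule continuous_openin_preimage[OF _ _ openin_cube]) (use sU D(5,12) in blast)
  moreover have "cube 3 p0 e \<inter> (\<lambda>p. \<psi> (splice 3 p0 p)) -` cube (n + 3) (\<psi> p0) e' = slice_dom p0 e e'"
    by (auto simp: slice_dom_def)
  ultimately show ?thesis using openin_trans openin_cube by metis
qed

lemma base_map_cube:
  assumes "p \<in> slice_dom p0 e e'"
  shows "base_map p0 p \<in> cube 3 (\<psi> p0) e'"
  using assms n by (auto simp: slice_dom_def cube_def base_map_def tr_in_Rn tr_nth)

lemma lagr_equiv:
  assumes "U \<noteq> {}"
  shows "lagr_loc_equiv n O1 f1 O2 f2"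
proof -
  interpret R: distr_equiv n O2 O1 f2 f1 V U "inv_into U \<psi>" by (rule reverse)
  let ?\<xi> = "inv_into U \<psi>"
  obtain p0 where p0: "p0 \<in> U" using assms by blast
  define q0 where "q0 = \<psi> p0"
  have q0: "q0 \<in> V" "?\<xi> q0 = p0" using D(5,7) p0 by (auto simp: q0_def)
  obtain e1 where e1: "e1 > 0" "cube (n + 3) p0 e1 \<subseteq> U" by (rule open_contains_cube[OF D(1) p0])
  obtain e2 where e2: "e2 > 0" "cube (n + 3) q0 e2 \<subseteq> V" by (rule open_contains_cube[OF D(2) q0(1)])
  define \<phi> where "\<phi> = base_map p0"
  define \<phi>' where "\<phi>' = R.base_map q0"
  define A where "A = slice_dom p0 e1 e2"
  define B where "B = R.slice_dom q0 e2 e1"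
  have oA: "openin (top_of_set (Rn 3)) A"
    unfolding A_def by (rule openin_slice_dom[OF p0 e1 e2(2)[unfolded q0_def]])
  have oB: "openin (top_of_set (Rn 3)) B"
    unfolding B_def by (rule R.openin_slice_dom[OF q0(1) e2]) (simp add: q0 e1)
  have sA: "splice 3 p0 p \<in> cube (n + 3) p0 e1" "\<psi> (splice 3 p0 p) \<in> cube (n + 3) q0 e2" if "p \<in> A" for p
    using slice_dom_splice[OF p0 e1(1)] that by (auto simp: A_def slice_dom_def q0_def)
  have sB: "splice 3 q0 r \<in> cube (n + 3) q0 e2" "?\<xi> (splice 3 q0 r) \<in> cube (n + 3) p0 e1" if "r \<in> B" for r
    using R.slice_dom_splice[OF q0(1) e2(1)] that by (auto simp: B_def R.slice_dom_def q0)
  have Rn3: "p \<in> Rn 3" if "p \<in> A \<or> p \<in> B" for p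
    using that oA oB openin_imp_subset by blast
  have \<phi>Rn: "\<phi> p \<in> Rn 3" "\<phi>' p \<in> Rn 3" for p
    by (simp_all add: \<phi>_def \<phi>'_def base_map_def R.base_map_def tr_in_Rn)
  have eqI: "p = p'" if "p \<in> Rn 3" "p' \<in> Rn 3" "\<And>j. j < 3 \<Longrightarrow> p j = p' j" for p p'
  proof
    fix j show "p j = p' j" using that by (cases "j < 3") (auto simp: Rn_def)
  qed
  have \<phi>'\<phi>: "\<phi>' (\<phi> p) = p" if p: "p \<in> A" for p
  proof (rule eqI[OF \<phi>Rn(2)])
    show "p \<in> Rn 3" using Rn3 p by blast
    fix j :: nat assume j: "j < 3"
    have "\<phi> p \<in> cube 3 q0 e2" using base_map_cube p by (simp add: A_def \<phi>_def q0_def)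
    then have "splice 3 q0 (\<phi> p) \<in> cube (n + 3) q0 e2" using splice_cube q0(1) D(12) e2(1) by auto
    then have "?\<xi> (splice 3 q0 (\<phi> p)) j = ?\<xi> (\<psi> (splice 3 p0 p)) j"
      by (rule R.independent[OF e2(2) _ sA(2)[OF p]])
        (use j n in \<open>auto simp: splice_def \<phi>_def base_map_def tr_def\<close>)
    also have "\<dots> = p j" using D(7) sA(1)[OF p] e1(2) j by (auto simp: splice_def)
    finally show "\<phi>' (\<phi> p) j = p j" using j by (simp add: \<phi>'_def R.base_map_nth)
  qed
  have \<phi>\<phi>': "\<phi> (\<phi>' r) = r" if r: "r \<in> B" for r
  proof (rule eqI[OF \<phi>Rn(1)])
    show "r \<in> Rn 3" using Rn3 r by blast
    fix j :: nat assume j: "j < 3"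
    have "\<phi>' r \<in> cube 3 p0 e1" using R.base_map_cube[of r q0 e2 e1] r by (simp add: B_def \<phi>'_def q0)
    then have "splice 3 p0 (\<phi>' r) \<in> cube (n + 3) p0 e1" using splice_cube p0 D(11) e1(1) by auto
    then have "\<psi> (splice 3 p0 (\<phi>' r)) j = \<psi> (?\<xi> (splice 3 q0 r)) j"
      by (rule independent[OF e1(2) _ sB(2)[OF r]])
        (use j n in \<open>auto simp: splice_def \<phi>'_def R.base_map_def tr_def\<close>)
    also have "\<dots> = r j" using D(8) sB(1)[OF r] e2(2) j by (auto simp: splice_def)
    finally show "\<phi> (\<phi>' r) j = r j" using j by (simp add: \<phi>_def base_map_nth)
  qed
  have \<phi>A: "smooth_map 3 A \<phi>"
    unfolding \<phi>_def by (rule base_map_smooth[OF oA]) (use sA e1 in blast)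
  have \<phi>'B: "smooth_map 3 B \<phi>'"
    unfolding \<phi>'_def by (rule R.base_map_smooth[OF oB]) (use sB e2 in blast)
  \<comment> \<open>\<open>\<phi>\<close> need not map \<open>A\<close> into \<open>B\<close>; the
    smaller sets make both compositions defined.\<close>
  define X where "X = {p \<in> A. \<phi> p \<in> B}"
  define Y where "Y = {r \<in> B. \<phi>' r \<in> A}"
  have cont: "continuous_on Z F" if "smooth_map 3 Z F" for Z F
    by (rule continuous_on_components[of 3]) (use that smooth_in_continuous in \<open>auto simp: smooth_map_def\<close>)
  have pre: "openin (top_of_set (Rn 3)) {p \<in> Z. F p \<in> Z'}"
    if "openin (top_of_set (Rn 3)) Z" "openin (top_of_set (Rn 3)) Z'" "smooth_map 3 Z F" for Z Z' F
  proof -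
    have "openin (top_of_set Z) (Z \<inter> F -` Z')"
      by (rule continuous_openin_preimage[OF cont[OF that(3)] _ that(2)]) (use that(3) in \<open>auto simp: smooth_map_def\<close>)
    moreover have "Z \<inter> F -` Z' = {p \<in> Z. F p \<in> Z'}" by auto
    ultimately show ?thesis using openin_trans that(1) by metis
  qed
  have oX: "openin (top_of_set (Rn 3)) X" and oY: "openin (top_of_set (Rn 3)) Y"
    unfolding X_def Y_def by (rule pre[OF oA oB \<phi>A], rule pre[OF oB oA \<phi>'B])
  have sub: "smooth_map 3 Z' F" if "smooth_map 3 Z F" "Z' \<subseteq> Z" for Z Z' F
    using that smooth_in_subset unfolding smooth_map_def by blast
  have "diffeo 3 X Y \<phi>"
  proof (rule diffeoI[OF oX oY, where \<xi> = \<phi>'])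
    show "smooth_map 3 X \<phi>" by (rule sub[OF \<phi>A]) (auto simp: X_def)
    show "smooth_map 3 Y \<phi>'" by (rule sub[OF \<phi>'B]) (auto simp: Y_def)
  qed (auto simp: X_def Y_def \<phi>'\<phi> \<phi>\<phi>')
  moreover have "\<exists>a. \<forall>i<3. pd i (\<lambda>q. \<phi> q 1) p - \<phi> p 2 * pd i (\<lambda>q. \<phi> q 0) p = a * theta 0 p i"
    if "p \<in> X" for p
  proof -
    have "splice 3 p0 p \<in> U" using that sA(1) e1(2) by (auto simp: X_def)
    then show ?thesis unfolding \<phi>_def using base_map_contact by blast
  qed
  ultimately have contact: "contact_transf X Y \<phi>" by (simp add: contact_transf_def)
  define W where "W = {p. (\<forall>i<n + 2. \<bar>p i - p0 i\<bar> < e1) \<and> tr 3 p \<in> X}"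
  \<comment> \<open>Index \<open>n + 2\<close> is \<open>y_(n+1)\<close> in J^infinity but
    \<open>z\<close> in J^n x R. The splice discards the former and inserts the \<open>z\<close>
    value of \<open>p0\<close>.\<close>
  define s where "s = splice (n + 2) p0"
  have "open W"
  proof -
    have "open {q::nat \<Rightarrow> real. \<bar>q i - p0 i\<bar> < e1}" for i
      by (intro open_Collect_less continuous_intros continuous_on_subset[OF continuous_on_product_coordinates]) auto
    then have "open (\<Inter>i\<in>{..<n + 2}. {q::nat \<Rightarrow> real. \<bar>q i - p0 i\<bar> < e1})" by auto
    moreover obtain G where G: "open G" "X = Rn 3 \<inter> G" using oX by (auto simp: openin_open)
    have "open (tr 3 -` G)" by (rule open_vimage[OF G(1) continuous_on_tr])
    moreover have "W = (\<Inter>i\<in>{..<n + 2}. {q. \<bar>q i - p0 i\<bar> < e1}) \<inter> tr 3 -` G"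
      by (auto simp: W_def G(2) tr_in_Rn)
    ultimately show ?thesis by (auto intro: open_Int)
  qed
  have opW: "coord_open UNIV W" by (rule coord_open_open[OF \<open>open W\<close>])
  have p0W: "p0 \<in> W"
  proof -
    have s3: "splice 3 p0 (tr 3 p0) = p0" "splice 3 q0 (tr 3 q0) = q0" by (auto simp: splice_def tr_def)
    have bx: "tr 3 p0 \<in> cube 3 p0 e1" "tr 3 q0 \<in> cube 3 q0 e2" "p0 \<in> cube (n + 3) p0 e1" "q0 \<in> cube (n + 3) q0 e2"
      using e1 e2 p0 q0 D(11,12) by (auto simp: cube_def tr_in_Rn tr_nth)
    have "tr 3 p0 \<in> A" using bx by (simp add: A_def slice_dom_def s3 q0_def)
    moreover have "tr 3 q0 \<in> B" using bx by (simp add: B_def R.slice_dom_def s3 q0)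
    moreover have "\<phi> (tr 3 p0) = tr 3 q0" by (simp add: \<phi>_def base_map_def s3 q0_def)
    ultimately have "tr 3 p0 \<in> X" by (simp add: X_def)
    then show ?thesis using e1 by (simp add: W_def)
  qed
  have s_cube: "s p \<in> cube (n + 3) p0 e1" if "p \<in> W" for p
    using that e1(1) p0 D(11) by (auto simp: W_def s_def splice_def cube_def Rn_def)
  have sU: "s p \<in> U" if "p \<in> W" for p using s_cube[OF that] e1(2) by blast
  have trs: "tr (n + 2) (s p) = tr (n + 2) p" for p by (auto simp: s_def splice_def tr_def)
  \<comment> \<open>\<open>D_x\<close> and \<open>T\<close> differ only in directions from
    \<open>y_n\<close> on, and for \<open>j <= n\<close> the component \<open>c j\<close> does not
    depend on \<open>y_n\<close> or \<open>z\<close>.\<close>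
  have Dx_s: "Dx F p = L T (c j) (s p)"
    if p: "p \<in> W" and j: "j \<le> n" and F: "\<And>q. q \<in> W \<Longrightarrow> F q = c j (s q)" "finite_order (n + 1) F" for F p j
  proof -
    have "pd i F p = (if i < n + 2 then pd i (c j) (s p) else 0)" for i
    proof -
      have "pd i F p = pd i (\<lambda>q. c j (splice (n + 2) p0 q)) p"
        by (rule pd_cong[OF opW p]) (use F(1) s_def in auto)
      then show ?thesis using pd_splice[of i "c j" "n + 2" p0 p] by (simp add: s_def)
    qed
    then have "Dx F p = (\<Sum>i<n + 1. jet_dir p i * pd i (c j) (s p))"
      using Dx_finite_order[OF F(2), of p] by simp
    also have "\<dots> = (\<Sum>i<n + 3. T i (s p) * pd i (c j) (s p))"
    proof (rule sum.mono_neutral_cong_left)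
      show "\<forall>i\<in>{..<n + 3} - {..<n + 1}. T i (s p) * pd i (c j) (s p) = 0"
        using c_triangular[of j _ "s p"] sU[OF p] j n by auto
      show "jet_dir p i * pd i (c j) (s p) = T i (s p) * pd i (c j) (s p)" if "i \<in> {..<n + 1}" for i
        using that by (auto simp: T_eq jet_dir_def s_def splice_def)
    qed auto
    finally show ?thesis unfolding vf_deriv_def .
  qed
  have prol_s: "j < n + 2 \<Longrightarrow> p \<in> W \<Longrightarrow> prol \<phi> j p = c j (s p)" for j p
  proof (induction j arbitrary: p rule: less_induct)
    case (less j)
    show ?case
    proof (cases "j < 3")
      case True
      have "tr 3 p \<in> A" using less.prems by (simp add: W_def X_def)
      then have "\<psi> (splice 3 p0 (tr 3 p)) j = \<psi> (s p) j"
        by (intro independent[OF e1(2) sA(1) s_cube[OF less.prems(2)] less.prems(1)])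
          (use True n in \<open>auto simp: splice_def s_def tr_def\<close>)
      then have "\<phi> (tr 3 p) j = \<psi> (s p) j" using True by (simp add: \<phi>_def base_map_nth)
      moreover have "j = 0 \<or> j = Suc 0 \<or> j = Suc (Suc 0)" using True by linarith
      ultimately show ?thesis by (auto simp: prol.simps numeral_2_eq_2)
    next
      case False
      then obtain k where k: "j = Suc (Suc (Suc k))" by (intro that[of "j - 3"]) simp
      have "Dx (prol \<phi> 0) p = L T (c 0) (s p)"
        by (rule Dx_s[OF less.prems(2)]) (use less k n finite_order_prol in auto)
      moreover have "Dx (prol \<phi> (Suc (Suc k))) p = L T (c (Suc (Suc k))) (s p)"
        by (rule Dx_s[OF less.prems(2)]) (use less k n finite_order_prol in auto)
      moreover have "L T (c (Suc (Suc k))) (s p) = c j (s p) * L T (c 0) (s p)"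
        using LT_c[OF sU[OF less.prems(2)], of "Suc (Suc k)"] less.prems k by (simp add: Xfield_def)
      ultimately show ?thesis using LT_c0_nonzero[OF sU[OF less.prems(2)]] unfolding k by (simp add: prol.simps(4))
    qed
  qed
  have DX: "Dx (prol \<phi> 0) p = L T (c 0) (s p)" if "p \<in> W" for p
    by (rule Dx_s[OF that]) (use prol_s n finite_order_prol in auto)
  have tr_prolong: "tr (n + 2) (prolong \<phi> p) = tr (n + 2) (\<psi> (s p))" if "p \<in> W" for p
    using prol_s[OF _ that] by (auto simp: tr_def prolong_def)
  \<comment> \<open>The last component on the slice where \<open>z\<close> has its value at
    \<open>p0\<close>; freezing \<open>z\<close> removes the term linear in \<open>z\<close> up to a
    constant.\<close>
  define \<mu> where "\<mu> p = c (n + 2) (s p)" for p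
  have \<mu>_smooth: "smooth_in UNIV W \<mu>"
    unfolding \<mu>_def s_def
    by (rule smooth_in_splice[OF opW c_smooth[of "n + 2"]]) (use sU s_def in auto)
  have \<mu>_fin: "\<mu> p = \<mu> q" if "\<forall>i<n + 2. p i = q i" for p q
  proof -
    have "s p = s q" using that by (auto simp: s_def splice_def)
    then show ?thesis by (simp add: \<mu>_def)
  qed
  \<comment> \<open>Freezing \<open>z\<close> drops the term \<open>g * h\<close> from
    \<open>LT_z\<close>, which is the contribution of \<open>f1\<close>. The \<open>y_(n+1)\<close>
    term of \<open>D_x\<close> is zero because the last component does not depend on
    \<open>y_n\<close>.\<close>
  have Dx\<mu>: "Dx \<mu> p = L T (c (n + 2)) (s p) - h p0 * f1 (tr (n + 2) p)" if p: "p \<in> W" for p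
  proof -
    have pd\<mu>: "pd i \<mu> p = (if i < n + 2 then pd i (c (n + 2)) (s p) else 0)" for i
      unfolding \<mu>_def s_def by (rule pd_splice[of i "c (n + 2)"])
    have "Dx \<mu> p = (\<Sum>i<n + 1. jet_dir p i * pd i \<mu> p)"
    proof (rule Dx_finite)
      show "pd k \<mu> p = 0" if "n + 1 \<le> k" for k
        using pd_Y_z[OF sU[OF p]] that pd\<mu>[of k] by (cases "k = n + 1") auto
    qed simp
    also have "\<dots> = (\<Sum>i<n + 1. T i (s p) * pd i (c (n + 2)) (s p))"
      by (rule sum.cong) (auto simp: pd\<mu> T_eq jet_dir_def s_def splice_def)
    also have "\<dots> = L T (c (n + 2)) (s p) - g (s p) * h (s p)"
    proof -
      have "{..<n + 3} = insert (n + 2) (insert (n + 1) {..<n + 1})" by auto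
      then have "L T (c (n + 2)) (s p) = T (n + 2) (s p) * h (s p) + T (n + 1) (s p) * pd (n + 1) (c (n + 2)) (s p)
          + (\<Sum>i<n + 1. T i (s p) * pd i (c (n + 2)) (s p))"
        unfolding vf_deriv_def h_def by (simp del: sum.lessThan_Suc)
      then show ?thesis by (simp add: T_eq del: sum.lessThan_Suc)
    qed
    also have "h (s p) = h p0" by (rule h_const[OF e1(2) s_cube[OF p]]) (use e1 p0 D(11) in \<open>auto simp: cube_def\<close>)
    also have "g (s p) = f1 (tr (n + 2) p)" unfolding g_def trs by (rule refl)
    finally show ?thesis by (simp add: mult.commute)
  qed
  have "eq_mod_contact W (pullback (prolong \<phi>) (hdx (\<lambda>p. f2 (tr (n + 2) p))))
          (\<lambda>p i. h p0 * hdx (\<lambda>p. f1 (tr (n + 2) p)) p i + hdx (Dx \<mu>) p i)"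
    unfolding eq_mod_contact_hdx using DX Dx\<mu> tr_prolong LT_z[OF sU] by simp
  moreover have "tr 3 ` W \<subseteq> X" by (auto simp: W_def)
  moreover have "\<forall>p\<in>W. Dx (prol \<phi> 0) p \<noteq> 0" using DX LT_c0_nonzero[OF sU] by simp
  moreover have "\<forall>p\<in>W. tr (n + 2) p \<in> O1" using UO1[OF sU] trs by simp
  moreover have "\<forall>p\<in>W. tr (n + 2) (prolong \<phi> p) \<in> O2" using VO2[OF D(5)[OF sU]] tr_prolong by simp
  moreover have "h p0 \<noteq> 0" by (rule h_nonzero[OF p0])
  moreover have "\<forall>p\<in>W. \<forall>q\<in>W. (\<forall>i<n + 2. p i = q i) \<longrightarrow> \<mu> p = \<mu> q" using \<mu>_fin by blast
  moreover have "W \<noteq> {}" using p0W by blast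
  ultimately show ?thesis unfolding lagr_loc_equiv_def
    using \<open>open W\<close> contact \<mu>_smooth by (intro exI conjI)
qed

end

theorem theorem2p1:
  fixes n :: nat
    and O1 O2 :: "(nat \<Rightarrow> real) set"
    and f1 f2 :: "(nat \<Rightarrow> real) \<Rightarrow> real"
  assumes "n \<ge> 3"
    and "openin (top_of_set (Rn (n + 2))) O1" and "openin (top_of_set (Rn (n + 2))) O2"
    and "smooth_in {..<n + 2} O1 f1" and "smooth_in {..<n + 2} O2 f2"
    and "\<forall>p\<in>O1. ipd [n + 1, n + 1] f1 p \<noteq> 0"
    and "\<forall>p\<in>O2. ipd [n + 1, n + 1] f2 p \<noteq> 0"
  shows "distr_loc_equiv n O1 f1 O2 f2 \<longleftrightarrow> lagr_loc_equiv n O1 f1 O2 f2"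
proof
  assume "distr_loc_equiv n O1 f1 O2 f2"
  then obtain U V \<psi> where "U \<noteq> {}" and "diffeo (n + 3) U V \<psi>"
    "\<forall>q\<in>U. tr (n + 2) q \<in> O1" "\<forall>q\<in>V. tr (n + 2) q \<in> O2"
    "\<forall>q\<in>U. dmap (n + 3) \<psi> q ` span2 (Xfield n f1 q) (Yfield n q)
       = span2 (Xfield n f2 (\<psi> q)) (Yfield n (\<psi> q))"
    unfolding distr_loc_equiv_def by blast
  then interpret distr_equiv n O1 O2 f1 f2 U V \<psi>
    using assms by unfold_locales auto
  show "lagr_loc_equiv n O1 f1 O2 f2" by (rule lagr_equiv) fact
next
  assume "lagr_loc_equiv n O1 f1 O2 f2"
  then show "distr_loc_equiv n O1 f1 O2 f2"
    using distr_equiv_of_lagr_equiv assms(1) by simp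
qed

end
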